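(* For each $n$ let $p=p_n$, $q_n$, $q_{1,n}$, $q_{2,n}$ be positive integers with $q_n=q_{1,n}+q_{2,n}$, let $z_1,\ldots,z_n\in\mathbb{R}^{q_n}$ be known (non-random) design vectors such that the matrix $(z_1,\ldots,z_n)$ has rank $q_n$, and let $X_1,\ldots,X_n$ be independent $p$-dimensional random vectors with $X_k\sim\mathcal{N}(\beta z_k,\Sigma)$, $1\le k\le n$, where $\beta\in\mathbb{R}^{p\times q_n}$ and $\Sigma\in\mathbb{R}^{p\times p}$ is positive definite (the $z_k$, $\beta$ and $\Sigma$ may depend on $n$). Write $\beta=(\beta_1,\beta_2)$ with $\beta_1\in\mathbb{R}^{p\times q_{1,n}}$ and $\beta_2\in\mathbb{R}^{p\times q_{2,n}}$, let $\beta_{01}\in\mathbb{R}^{p\times q_{1,n}}$ be a given matrix, and let $\Lambda_n$ be the likelihood ratio statistic (defined in the context) for the null hypothesis $$H_0:\ \beta_1=\beta_{01}.$$ Assume that, as $n\to\infty$, $p\to\infty$, $q_{1,n}\to\infty$, $n-q_n\to\infty$, $\frac{p}{q_{1,n}}\to y_1\in(0,\infty)$ and $\frac{p}{n-q_n}\to y_2\in(0,1)$. Then, under the null hypothesis $H_0$, $$\frac2n\log\Lambda_n-s_n\ \xrightarrow{\mathcal{D}}\ \mathcal{N}(0,\sigma^2)\qquad(n\to\infty),$$ where $$\sigma^2=2\Big\{\log\Big(\frac{1}{1-y_2}\Big)-\log\Big(\frac{y_1+y_2}{y_1+y_2-y_1y_2}\Big)\Big\},$$ $$s_n=(n-q_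{2,n}-1)\log\Big(\frac{n-q_n-1}{n-q_{2,n}-1}\Big)+q_{1,n}\log\Big(\frac{n-q_n-p-1}{n-q_n-1}\Big)+(n-q_{2,n}-p-1)\log\Big(\frac{n-q_{2,n}-p-1}{n-q_n-p-1}\Big)+\frac{\sigma^2}{4}.$$
   Context: $\mathcal{N}(\mu,\Sigma)$ denotes the multivariate normal distribution, $|\cdot|$ the determinant, and $\xrightarrow{\mathcal{D}}$ weak convergence (convergence in distribution). Partition $z_i^\top=(z_{i,1}^\top,z_{i,2}^\top)$ with $z_{i,1}\in\mathbb{R}^{q_{1,n}}$ and $z_{i,2}\in\mathbb{R}^{q_{2,n}}$. Define $$\hat B=\Big(\sum_{i=1}^nX_iz_i^\top\Big)\Big(\sum_{i=1}^nz_iz_i^\top\Big)^{-1},\qquad \hat B_{20}=\Big(\sum_{i=1}^n(X_i-\beta_{01}z_{i,1})z_{i,2}^\top\Big)\Big(\sum_{i=1}^nz_{i,2}z_{i,2}^\top\Big)^{-1}$$ (the maximum likelihood estimators of $\beta$ without restriction and of $\beta_2$ under $H_0$, respectively), and $$\hat\Sigma=\frac1n\sum_{i=1}^n(X_i-\hat Bz_i)(X_i-\hat Bz_i)^\top,$$ $$\hat\Sigma_0=\frac1n\sum_{i=1}^n(X_i-\beta_{01}z_{i,1}-\hat B_{20}z_{i,2})(X_i-\beta_{01}z_{i,1}-\hat B_{20}z_{i,2})^\top .$$ The likelihood ratio statistic is $$\Lambda_n=\frac{|\hat\Sigma|^{n/2}}{|\hat\Sigma_0|^{n/2}} .$$ Under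 the stated asymptotics it is almost surely well defined and positive for all sufficiently large $n$. *)

theory Defs
  imports
    "HOL-Probability.Probability"
    "Jordan_Normal_Form.DL_Rank"
    "Jordan_Normal_Form.Gauss_Jordan_Elimination"
begin

hide_const (open) Finite_Cartesian_Product.vec Finite_Cartesian_Product.mat Determinants.det
no_notation vec_nth (infixl \<open>$\<close> 90)
no_notation inner (infixl \<open>\<bullet>\<close> 70)

(* The dimensions vary with the sample size, so vectors and matrices are those of
   Jordan_Normal_Form, with explicit carriers carrier_vec p and carrier_mat p q. *)

definition outer_prod :: "real vec \<Rightarrow> real vec \<Rightarrow> real mat" where
  "outer_prod u v = mat (dim_vec u) (dim_vec v) (\<lambda>(i, j). u $ i * v $ j)"

definition mat_setsum :: "nat \<Rightarrow> nat \<Rightarrow> ('i \<Rightarrow> real mat) \<Rightarrow> 'i set \<Rightarrow> real mat" where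
  "mat_setsum nr nc F I = mat nr nc (\<lambda>ij. \<Sum>k\<in>I. F k $$ ij)"

(* Unspecified if A is not an invertible square matrix. *)
definition mat_inv :: "real mat \<Rightarrow> real mat" where
  "mat_inv A = the (mat_inverse A)"

definition append_cols :: "real mat \<Rightarrow> real mat \<Rightarrow> real mat" where
  "append_cols A B = four_block_mat A B (0\<^sub>m 0 (dim_col A)) (0\<^sub>m 0 (dim_col B))"

definition positive_definite_mat :: "nat \<Rightarrow> real mat \<Rightarrow> bool" where
  "positive_definite_mat p A \<longleftrightarrow>
     A \<in> carrier_mat p p \<and> transpose_mat A = A \<and>
     (\<forall>v\<in>carrier_vec p. v \<noteq> 0\<^sub>v p \<longrightarrow> v \<bullet> (A *\<^sub>v v) > 0)"


(* The Borel sigma-algebra and the Lebesgue measure on p-dimensional vectors, transported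
   from the product spaces of functions on {..<p} along the coordinate isomorphism. *)

definition borel_vec :: "nat \<Rightarrow> real vec measure" where
  "borel_vec p = vimage_algebra (carrier_vec p) (\<lambda>v. \<lambda>i\<in>{..<p}. v $ i) (Pi\<^sub>M {..<p} (\<lambda>_. borel))"

definition lborel_vec :: "nat \<Rightarrow> real vec measure" where
  "lborel_vec p = distr (Pi\<^sub>M {..<p} (\<lambda>_. lborel)) (borel_vec p) (vec p)"

lemma space_borel_vec [simp]: "space (borel_vec p) = carrier_vec p"
  by (simp add: borel_vec_def)

lemma sets_lborel_vec [simp, measurable_cong]: "sets (lborel_vec p) = sets (borel_vec p)"
  by (simp add: lborel_vec_def)

lemma space_lborel_vec [simp]: "space (lborel_vec p) = carrier_vec p"
  by (simp add: lborel_vec_def)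

lemma measurable_vec_index:
  assumes "i < p"
  shows "(\<lambda>v. v $ i) \<in> borel_measurable (borel_vec p)"
proof -
  have "(\<lambda>v. \<lambda>i\<in>{..<p}. v $ i) \<in> measurable (borel_vec p) (Pi\<^sub>M {..<p} (\<lambda>_. borel :: real measure))"
    unfolding borel_vec_def by (rule measurable_vimage_algebra1) (auto simp: space_PiM)
  then have "(\<lambda>v. (\<lambda>i\<in>{..<p}. v $ i) i) \<in> borel_measurable (borel_vec p)"
    by (rule measurable_compose) (use assms in \<open>auto intro!: measurable_component_singleton\<close>)
  with assms show ?thesis by simp
qed

lemma measurable_vec: "vec p \<in> measurable (Pi\<^sub>M {..<p} (\<lambda>_. borel)) (borel_vec p)"
  unfolding borel_vec_def
proof (rule measurable_vimage_algebra2)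
  show "vec p \<in> space (Pi\<^sub>M {..<p} (\<lambda>_. borel)) \<rightarrow> carrier_vec p"
    by auto
  have "(\<lambda>x. \<lambda>i\<in>{..<p}. vec p x $ i) \<in> measurable (Pi\<^sub>M {..<p} (\<lambda>_. borel)) (Pi\<^sub>M {..<p} (\<lambda>_. borel :: real measure))
    \<longleftrightarrow> (\<lambda>x. \<lambda>i\<in>{..<p}. x i) \<in> measurable (Pi\<^sub>M {..<p} (\<lambda>_. borel)) (Pi\<^sub>M {..<p} (\<lambda>_. borel :: real measure))"
    by (intro measurable_cong) auto
  then show "(\<lambda>x. \<lambda>i\<in>{..<p}. vec p x $ i) \<in> measurable (Pi\<^sub>M {..<p} (\<lambda>_. borel)) (Pi\<^sub>M {..<p} (\<lambda>_. borel :: real measure))"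
    by (auto intro!: measurable_restrict measurable_component_singleton)
qed


definition multivariate_normal_density :: "real vec \<Rightarrow> real mat \<Rightarrow> real vec \<Rightarrow> real" where
  "multivariate_normal_density \<mu> \<Sigma> x =
     exp (- (1 / 2) * ((x - \<mu>) \<bullet> (mat_inv \<Sigma> *\<^sub>v (x - \<mu>)))) /
     sqrt ((2 * pi) ^ dim_vec \<mu> * det \<Sigma>)"

definition multivariate_normal :: "real vec \<Rightarrow> real mat \<Rightarrow> real vec measure" where
  "multivariate_normal \<mu> \<Sigma> =
     density (lborel_vec (dim_vec \<mu>)) (\<lambda>x. ennreal (multivariate_normal_density \<mu> \<Sigma> x))"


(* In the following, x and z are the families of observations and design vectors
   (relevant for the indices 1, ..., n), in dimension p and q (or q1 + q2), respectively. *)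

definition mle_coeff ::
  "nat \<Rightarrow> nat \<Rightarrow> nat \<Rightarrow> (nat \<Rightarrow> real vec) \<Rightarrow> (nat \<Rightarrow> real vec) \<Rightarrow> real mat" where
  "mle_coeff p q n z x =
     mat_setsum p q (\<lambda>i. outer_prod (x i) (z i)) {1..n} *
     mat_inv (mat_setsum q q (\<lambda>i. outer_prod (z i) (z i)) {1..n})"

definition mle_coeff0 ::
  "nat \<Rightarrow> nat \<Rightarrow> nat \<Rightarrow> nat \<Rightarrow> real mat \<Rightarrow> (nat \<Rightarrow> real vec) \<Rightarrow> (nat \<Rightarrow> real vec) \<Rightarrow> real mat" where
  "mle_coeff0 p q1 q2 n \<beta>01 z x =
     mat_setsum p q2
       (\<lambda>i. outer_prod (x i - \<beta>01 *\<^sub>v vec_first (z i) q1) (vec_last (z i) q2)) {1..n} *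
     mat_inv (mat_setsum q2 q2 (\<lambda>i. outer_prod (vec_last (z i) q2) (vec_last (z i) q2)) {1..n})"

definition mle_cov ::
  "nat \<Rightarrow> nat \<Rightarrow> nat \<Rightarrow> (nat \<Rightarrow> real vec) \<Rightarrow> (nat \<Rightarrow> real vec) \<Rightarrow> real mat" where
  "mle_cov p q n z x =
     (let r = (\<lambda>i. x i - mle_coeff p q n z x *\<^sub>v z i)
      in (1 / real n) \<cdot>\<^sub>m mat_setsum p p (\<lambda>i. outer_prod (r i) (r i)) {1..n})"

definition mle_cov0 ::
  "nat \<Rightarrow> nat \<Rightarrow> nat \<Rightarrow> nat \<Rightarrow> real mat \<Rightarrow> (nat \<Rightarrow> real vec) \<Rightarrow> (nat \<Rightarrow> real vec) \<Rightarrow> real mat" where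
  "mle_cov0 p q1 q2 n \<beta>01 z x =
     (let r = (\<lambda>i. x i - \<beta>01 *\<^sub>v vec_first (z i) q1
                     - mle_coeff0 p q1 q2 n \<beta>01 z x *\<^sub>v vec_last (z i) q2)
      in (1 / real n) \<cdot>\<^sub>m mat_setsum p p (\<lambda>i. outer_prod (r i) (r i)) {1..n})"

definition likelihood_ratio ::
  "nat \<Rightarrow> nat \<Rightarrow> nat \<Rightarrow> nat \<Rightarrow> real mat \<Rightarrow> (nat \<Rightarrow> real vec) \<Rightarrow> (nat \<Rightarrow> real vec) \<Rightarrow> real" where
  "likelihood_ratio p q1 q2 n \<beta>01 z x =
     det (mle_cov p (q1 + q2) n z x) powr (real n / 2) /
     det (mle_cov0 p q1 q2 n \<beta>01 z x) powr (real n / 2)"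

end

theory Submission
  imports Defs "HOL-Real_Asymp.Real_Asymp"
begin

text \<open>
  Write the model under \<open>H\<^sub>0\<close> as \<open>X = L G + B Z\<close> with \<open>\<Sigma> = L L\<^sup>T\<close>, a \<open>p \<times> n\<close> matrix \<open>G\<close> of independent
  standard normals and the design matrix \<open>Z\<close> with row blocks \<open>Z\<^sub>1\<close>, \<open>Z\<^sub>2\<close>. A residual covariance
  determinant is a quotient of Gram determinants of rows, so that \<open>2/n log \<Lambda>\<^sub>n\<close> is the logarithm of
  \<open>gram(G, Z\<^sub>1, Z\<^sub>2) gram(Z\<^sub>2) / (gram(Z\<^sub>1, Z\<^sub>2) gram(G, Z\<^sub>2))\<close>. Adjoining the rows of \<open>G\<close> one at a time
  multiplies this quantity by the ratio of the squared distances of a standard normal vector to two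
  nested subspaces. That ratio is independent of the larger distance, and the squared distances are
  chi-square distributed; hence the characteristic function of \<open>2/n log \<Lambda>\<^sub>n\<close> at \<open>t\<close> is the product over
  \<open>j < p\<close> of \<open>\<phi> (n - q - j) / \<phi> (n - q\<^sub>2 - j)\<close> with \<open>\<phi> k = Gamma (k/2 + \<i>t) / Gamma (k/2)\<close>. Expanding
  \<open>ln_Gamma\<close> to second order along vertical lines with an error of order \<open>1/k\<^sup>2\<close> makes the sum over \<open>j\<close>
  telescope, and Levy's continuity theorem applies.
\<close>

no_notation inner (infix \<open>\<bullet>\<close> 70)

section \<open>The logarithm of the Gamma function on vertical lines\<close>

text \<open>The ratio of the two squared distances has a beta law, but its density never appears.
  The ratio times the larger squared distance is the smaller one, so by independence the
  characteristic functions of the logarithms multiply, and the factor of the larger distance can be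
  cancelled because Gamma has no zeros. Given the rows already adjoined, the integral contributed by
  a new row does not depend on them; hence the product formula is exact for every admissible n.
  Independence of length and direction is obtained without polar coordinates, from the scaling of
  Lebesgue measure alone. The dimension is a variable throughout, so most facts about it are proved
  by induction, splitting off the last coordinate. The accuracy of the Gamma expansion is dictated
  by the error sum: p errors of order \<open>1 / k^2\<close>, with k at least n - q - p, add up to
  at most a multiple of \<open>p / (n - q - p)^2\<close>. This vanishes because
  \<open>y2 < 1\<close> keeps n - q - p of the order of n - q; errors of order 1/k would only give a
  bounded sum. The term \<open>\<sigma>2 / 4\<close> in the centring is the limit of what the
  summand \<open>ln y / 2\<close> of \<open>lgam_centre\<close> contributes.\<close>

lemma has_field_derivative_ln_minus_trapezoid:
  fixes u :: real
  assumes "u > -1"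
  shows "((\<lambda>u. ln (1 + u) - (u + u / (1 + u)) / 2) has_real_derivative - (u\<^sup>2 / (2 * (1 + u)\<^sup>2))) (at u)"
proof -
  have "((\<lambda>u. ln (1 + u) - (u + u / (1 + u)) / 2) has_real_derivative
      (1 / (1 + u) - (1 + (1 * (1 + u) - u * 1) / ((1 + u) * (1 + u))) / 2)) (at u)"
    using assms by (auto intro!: derivative_eq_intros)
  also have "1 / (1 + u) - (1 + (1 * (1 + u) - u * 1) / ((1 + u) * (1 + u))) / 2 = - (u\<^sup>2 / (2 * (1 + u)\<^sup>2))"
    using assms by (simp add: divide_simps power2_eq_square) (simp add: algebra_simps)
  finally show ?thesis .
qed

text \<open>The subtracted term is the trapezoidal rule for the integral of 1/(1+x) over [0,u],
  whose error is cubic in u. The mean value theorem turns the quadratic derivative of the error into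
  this bound.\<close>

lemma ln_trapezoid_bound:
  fixes u :: real
  assumes u: "u \<ge> 0"
  shows "\<bar>ln (1 + u) - (u + u / (1 + u)) / 2\<bar> \<le> u ^ 3 / 2"
proof (cases "u = 0")
  case False
  then have u0: "0 < u" using u by simp
  let ?k = "\<lambda>u::real. ln (1 + u) - (u + u / (1 + u)) / 2"
  obtain v where v: "0 < v" "v < u" "?k u - ?k 0 = (u - 0) * - (v\<^sup>2 / (2 * (1 + v)\<^sup>2))"
    using MVT2[OF u0, of ?k "\<lambda>v. - (v\<^sup>2 / (2 * (1 + v)\<^sup>2))"] has_field_derivative_ln_minus_trapezoid by force
  have "\<bar>?k u\<bar> = u * (v\<^sup>2 / (2 * (1 + v)\<^sup>2))" using v u by (simp add: abs_mult)
  also have "\<dots> \<le> u * (u\<^sup>2 / (2 * 1))"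
    using v u by (intro mult_left_mono frac_le mult_mono power_mono) (auto intro!: one_le_power)
  finally show ?thesis by (simp add: power2_eq_square power3_eq_cube)
qed simp

section \<open>Polygamma estimates from telescoping comparison series\<close>

text \<open>Both bounds telescope: 1/y^2 lies between 1/(y(y+1)) and 1/(y^2 - 1/4), and each of
  these is a difference of two reciprocals. The half-integer shift makes the upper bound agree with
  1/x up to order 1/x^2.\<close>

lemma sum_inverse_squares_bounds:
  fixes x :: real
  assumes x: "x \<ge> 1"
  shows "(\<Sum>k<n. 1 / (x + real k)\<^sup>2) \<le> 1 / (x - 1/2)"
    and "(\<Sum>k<n. 1 / (x + real k)\<^sup>2) \<ge> 1 / x - 1 / (x + real n)"
proof -
  have "(\<Sum>k<n. 1 / (x + real k)\<^sup>2) \<le> 1 / (x - 1/2) - 1 / (x + real n - 1/2)"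
  proof (induction n)
    case (Suc n)
    define y where "y = x + real n"
    have y: "y \<ge> 1" using x by (simp add: y_def)
    have "1 \<le> y\<^sup>2" using y by (simp add: one_le_power)
    then have y4: "0 < y\<^sup>2 - 1/4" by simp
    have "1 / y\<^sup>2 \<le> 1 / (y\<^sup>2 - 1/4)"
      using y y4 by (intro frac_le) auto
    also have "\<dots> = 1 / (y - 1/2) - 1 / (y + 1/2)"
      using y y4 by (simp add: field_simps power2_eq_square)
    finally show ?case using Suc by (simp add: y_def algebra_simps)
  qed simp
  moreover have "0 \<le> 1 / (x + real n - 1/2)" using x by simp
  ultimately show "(\<Sum>k<n. 1 / (x + real k)\<^sup>2) \<le> 1 / (x - 1/2)" by linarith
  show "(\<Sum>k<n. 1 / (x + real k)\<^sup>2) \<ge> 1 / x - 1 / (x + real n)"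
  proof (induction n)
    case (Suc n)
    define y where "y = x + real n"
    have y: "y \<ge> 1" using x by (simp add: y_def)
    have "1 / y - 1 / (y + 1) = 1 / (y * (y + 1))" using y by (simp add: field_simps)
    also have "\<dots> \<le> 1 / y\<^sup>2" using y by (intro frac_le) (auto simp: power2_eq_square)
    finally show ?case using Suc by (simp add: y_def algebra_simps)
  qed simp
qed

lemma sum_inverse_cubes_bound:
  fixes x :: real
  assumes x: "x \<ge> 1"
  shows "(\<Sum>k<n. 1 / (x + real k) ^ 3) \<le> 2 / x\<^sup>2"
proof -
  have "(\<Sum>k<n. 1 / (x + real k) ^ 3) \<le> (\<Sum>k<n. 1 / x * (1 / (x + real k)\<^sup>2))"
    using x by (intro sum_mono) (auto simp: power3_eq_cube power2_eq_square intro!: frac_le mult_right_mono)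
  also have "\<dots> = 1 / x * (\<Sum>k<n. 1 / (x + real k)\<^sup>2)" by (simp add: sum_distrib_left)
  also have "\<dots> \<le> 1 / x * (1 / (x - 1/2))"
    using x by (intro mult_left_mono sum_inverse_squares_bounds) auto
  also have "\<dots> \<le> 1 / x * (2 / x)"
    using x by (intro mult_left_mono) (auto simp: field_simps)
  finally show ?thesis by (simp add: power2_eq_square)
qed

text \<open>The function \<open>g\<close> satisfies the recurrence of Digamma, increment 1/y, up to
  a cubic trapezoidal error, and \<open>g (x + m) - ln m\<close> tends to 0. Replacing
  \<open>ln m\<close> by \<open>g (x + m)\<close> in the limit formula for Digamma therefore
  exhibits \<open>Digamma x - g x\<close> as a convergent sum of cubic errors.\<close>

lemma Digamma_approx:
  fixes x :: real
  assumes x: "x \<ge> 1"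
  shows "\<bar>Digamma x - (ln x - 1 / (2 * x))\<bar> \<le> 1 / x\<^sup>2"
proof -
  define g where "g = (\<lambda>y::real. ln y - 1 / (2 * y))"
  have gd: "\<bar>g (y + 1) - g y - 1 / y\<bar> \<le> 1 / (2 * y ^ 3)" if y: "y \<ge> 1" for y
  proof -
    define u v where "u = 1 / y" and "v = 1 / (y + 1)"
    have "1 + u = (y + 1) / y" using y by (simp add: u_def field_simps)
    then have e1: "ln (1 + u) = ln (y + 1) - ln y" using y by (simp add: ln_div)
    have e2: "u / (1 + u) = v" using y by (simp add: u_def v_def field_simps)
    have e3: "1 / (2 * (y + 1)) = v / 2" "1 / (2 * y) = u / 2" by (simp_all add: u_def v_def)
    have "g (y + 1) - g y - u = ln (1 + u) - (u + u / (1 + u)) / 2"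
      unfolding g_def e1 e2 e3 by (simp add: field_simps)
    moreover have "u \<ge> 0" using y by (simp add: u_def)
    ultimately have "\<bar>g (y + 1) - g y - u\<bar> \<le> u ^ 3 / 2" using ln_trapezoid_bound[of u] by simp
    then show ?thesis by (simp add: u_def power_one_over)
  qed
  have "(\<lambda>m. ln (real m) - (\<Sum>k<m. inverse (x + real k))) \<longlonglongrightarrow> Digamma x"
    using Digamma_LIMSEQ[of x] x by simp
  moreover have "(\<lambda>m. g (x + real m) - ln (real m)) \<longlonglongrightarrow> 0"
    unfolding g_def using x by real_asymp
  ultimately have "(\<lambda>m. (ln (real m) - (\<Sum>k<m. inverse (x + real k))) + (g (x + real m) - ln (real m)) - g x) \<longlonglongrightarrow> Digamma x + 0 - g x"
    by (intro tendsto_intros)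
  then have "(\<lambda>m. \<Sum>k<m. g (x + real k + 1) - g (x + real k) - 1 / (x + real k)) \<longlonglongrightarrow> Digamma x + 0 - g x"
  proof (rule Lim_transform_eventually, intro eventuallyI)
    fix m
    have "(\<Sum>k<m. g (x + real k + 1) - g (x + real k)) = g (x + real m) - g x"
      by (induction m) (auto simp: algebra_simps)
    then show "ln (real m) - (\<Sum>k<m. inverse (x + real k)) + (g (x + real m) - ln (real m)) - g x =
         (\<Sum>k<m. g (x + real k + 1) - g (x + real k) - 1 / (x + real k))"
      by (simp add: sum_subtractf inverse_eq_divide)
  qed
  then have lim: "(\<lambda>m. \<bar>\<Sum>k<m. g (x + real k + 1) - g (x + real k) - 1 / (x + real k)\<bar>) \<longlonglongrightarrow> \<bar>Digamma x - g x\<bar>"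
    by (intro tendsto_rabs) simp
  have "\<bar>Digamma x - g x\<bar> \<le> 1 / x\<^sup>2"
  proof (rule LIMSEQ_le_const2[OF lim], intro exI[of _ 0] allI impI)
    fix m
    have "\<bar>\<Sum>k<m. g (x + real k + 1) - g (x + real k) - 1 / (x + real k)\<bar> \<le> (\<Sum>k<m. 1 / (2 * (x + real k) ^ 3))"
      using x by (intro order_trans[OF sum_abs] sum_mono gd) auto
    also have "\<dots> = (\<Sum>k<m. 1 / (x + real k) ^ 3) / 2"
      by (simp add: sum_divide_distrib mult.commute)
    also have "\<dots> \<le> (2 / x\<^sup>2) / 2"
      by (intro divide_right_mono sum_inverse_cubes_bound x) auto
    finally show "\<bar>\<Sum>k<m. g (x + real k + 1) - g (x + real k) - 1 / (x + real k)\<bar> \<le> 1 / x\<^sup>2" by simp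
  qed
  then show ?thesis by (simp add: g_def)
qed

lemma Trigamma_approx:
  fixes x :: real
  assumes x: "x \<ge> 1"
  shows "\<bar>Polygamma 1 x - 1 / x\<bar> \<le> 1 / x\<^sup>2"
proof -
  have "(\<lambda>k. inverse ((x + of_nat k) ^ Suc 1)) sums ((-1) ^ Suc 1 * Polygamma 1 x / fact 1)"
    using x by (intro Polygamma_LIMSEQ) auto
  then have S: "(\<lambda>k. 1 / (x + real k)\<^sup>2) sums Polygamma 1 x"
    by (simp add: inverse_eq_divide power2_eq_square)
  then have L: "(\<lambda>n. \<Sum>k<n. 1 / (x + real k)\<^sup>2) \<longlonglongrightarrow> Polygamma 1 x" by (simp add: sums_def)
  have "Polygamma 1 x \<le> 1 / (x - 1/2)"
    by (rule LIMSEQ_le_const2[OF L]) (auto intro!: exI[of _ 0] sum_inverse_squares_bounds x)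
  also have "\<dots> \<le> 1 / x + 1 / x\<^sup>2"
  proof -
    have "1 / (x - 1/2) - 1 / x = 1 / (2 * x * (x - 1/2))" using x by (simp add: field_simps)
    also have "\<dots> \<le> 1 / x\<^sup>2" using x by (intro frac_le) (auto simp: power2_eq_square field_simps)
    finally show ?thesis by simp
  qed
  finally have up: "Polygamma 1 x \<le> 1 / x + 1 / x\<^sup>2" .
  have "(\<lambda>n. 1 / x - 1 / (x + real n)) \<longlonglongrightarrow> 1 / x" by real_asymp
  then have "1 / x \<le> Polygamma 1 x"
    by (rule LIMSEQ_le[OF _ L]) (auto intro!: exI[of _ 0] sum_inverse_squares_bounds x)
  with up show ?thesis by simp
qed

text \<open>Termwise \<open>norm (z + k)\<close> is at least x + k on the half-plane, so the bound
  is uniform over the whole vertical line, which the Taylor remainder requires.\<close>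

lemma norm_Polygamma2_bound:
  fixes z :: complex
  assumes x: "x \<ge> 1" and z: "Re z \<ge> x"
  shows "norm (Polygamma 2 z) \<le> 4 / x\<^sup>2"
proof -
  have z0: "z \<noteq> 0" using assms by auto
  have "(\<lambda>k. inverse ((z + of_nat k) ^ Suc 2)) sums ((-1) ^ Suc 2 * Polygamma 2 z / fact 2)"
    using z0 by (intro Polygamma_LIMSEQ) auto
  then have "(\<lambda>n. norm (\<Sum>k<n. inverse ((z + of_nat k) ^ Suc 2))) \<longlonglongrightarrow> norm ((-1) ^ Suc 2 * Polygamma 2 z / fact 2)"
    unfolding sums_def by (rule tendsto_norm)
  then have "norm ((-1) ^ Suc 2 * Polygamma 2 z / fact 2) \<le> 2 / x\<^sup>2"
  proof (rule LIMSEQ_le_const2, intro exI[of _ 0] allI impI)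
    fix n
    have "norm (\<Sum>k<n. inverse ((z + of_nat k) ^ Suc 2)) \<le> (\<Sum>k<n. 1 / (x + real k) ^ 3)"
    proof (rule sum_norm_le)
      fix k
      have "x + real k \<le> Re (z + of_nat k)" using z by simp
      also have "\<dots> \<le> norm (z + of_nat k)" by (rule complex_Re_le_cmod)
      finally show "norm (inverse ((z + of_nat k) ^ Suc 2)) \<le> 1 / (x + real k) ^ 3"
        using x by (auto simp: norm_inverse norm_power inverse_eq_divide norm_divide numeral_3_eq_3[symmetric] intro!: frac_le power_mono)
    qed
    also have "\<dots> \<le> 2 / x\<^sup>2" by (rule sum_inverse_cubes_bound[OF x])
    finally show "norm (\<Sum>k<n. inverse ((z + of_nat k) ^ Suc 2)) \<le> 2 / x\<^sup>2" .
  qed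
  then show ?thesis by (simp add: norm_mult norm_divide)
qed

text \<open>The half-plane \<open>Re z \<ge> x\<close> is convex, contains both points and avoids
  the branch cut and the poles of \<open>ln_Gamma\<close>; the uniform bound on its third derivative
  \<open>Polygamma 2\<close> there controls the remainder of the second-order expansion at the real
  point.\<close>

lemma ln_Gamma_vertical_Taylor:
  fixes x t :: real
  assumes x: "x \<ge> 1"
  shows "norm (ln_Gamma (Complex x t) - ln_Gamma (of_real x) - (\<i> * (t * Digamma x) - t\<^sup>2 / 2 * Polygamma 1 x)) \<le> 2 * \<bar>t\<bar> ^ 3 / x\<^sup>2"
proof -
  define f where "f = (\<lambda>i. case i of 0 \<Rightarrow> ln_Gamma | Suc j \<Rightarrow> (Polygamma j :: complex \<Rightarrow> complex))"
  let ?S = "{z. Re z \<ge> x}"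
  have "norm (f 0 (Complex x t) - (\<Sum>i\<le>2. f i (of_real x) * (Complex x t - of_real x) ^ i / fact i)) \<le>
     4 / x\<^sup>2 * norm (Complex x t - of_real x) ^ Suc 2 / fact 2"
  proof (rule complex_Taylor)
    show "convex ?S" using convex_halfspace_Re_ge .
    fix z i assume z: "z \<in> ?S"
    then have "Re z > 0" using x by auto
    then have n: "z \<notin> \<real>\<^sub>\<le>\<^sub>0" "z \<notin> \<int>\<^sub>\<le>\<^sub>0" by (auto simp: complex_nonpos_Reals_iff elim!: nonpos_Ints_cases)
    show "(f i has_field_derivative f (Suc i) z) (at z within ?S)"
      using n by (cases i) (auto simp: f_def intro!: derivative_eq_intros)
    show "norm (f (Suc 2) z) \<le> 4 / x\<^sup>2"
      using z norm_Polygamma2_bound[OF x, of z] by (simp add: f_def)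
  qed auto
  moreover have "Complex x t - of_real x = \<i> * t" by (simp add: complex_eq_iff)
  moreover have "(\<Sum>i\<le>2. f i (of_real x) * (\<i> * t) ^ i / fact i) =
     ln_Gamma (of_real x) + (\<i> * (t * Digamma x) - t\<^sup>2 / 2 * Polygamma 1 x)"
  proof -
    have "{..2::nat} = {0, 1, 2}" by auto
    then show ?thesis using x by (simp add: f_def Polygamma_of_real power_mult_distrib numeral_2_eq_2)
  qed
  moreover have "norm (\<i> * complex_of_real t) ^ Suc 2 = \<bar>t\<bar> ^ 3"
    by (simp add: norm_mult numeral_3_eq_3 numeral_2_eq_2)
  ultimately have "norm (ln_Gamma (Complex x t) - (ln_Gamma (of_real x) + (\<i> * (t * Digamma x) - t\<^sup>2 / 2 * Polygamma 1 x)))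
      \<le> 4 / x\<^sup>2 * \<bar>t\<bar> ^ 3 / 2"
    by (simp only: f_def nat.case fact_2)
  then show ?thesis by (simp add: diff_diff_eq mult.commute)
qed

text \<open>
  The increments of \<open>lgam_centre\<close> and of \<open>ln\<close> match the first two logarithmic derivatives
  of \<open>Gamma\<close> at \<open>y / 2\<close> up to an error of order \<open>1 / y\<^sup>2\<close>, so that sums over \<open>y\<close> telescope.
\<close>

definition lgam_centre :: "real \<Rightarrow> real" where
  "lgam_centre y = (y - 1) * ln (y - 1) - y + ln y / 2 - y * ln 2"

lemma bigo_at_top_bound:
  fixes f g :: "real \<Rightarrow> real"
  assumes "f \<in> O[at_top](g)"
  shows "\<exists>C Y. C > 0 \<and> (\<forall>y\<ge>Y. \<bar>f y\<bar> \<le> C * \<bar>g y\<bar>)"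
proof -
  from assms obtain C where C: "C > 0" "eventually (\<lambda>y. norm (f y) \<le> C * norm (g y)) at_top"
    by (rule landau_o.bigE)
  from C(2) obtain Y where Y: "\<forall>y\<ge>Y. norm (f y) \<le> C * norm (g y)"
    unfolding eventually_at_top_linorder by (rule exE)
  show ?thesis using C(1) Y by (intro exI[of _ C] exI[of _ Y] conjI) (simp_all only: real_norm_def)
qed

section \<open>Expansion along vertical lines and its sum\<close>

text \<open>The argument \<open>y\<close> counts degrees of freedom, hence the halving: for a
  positive integer y the exponential is the characteristic function of the logarithm of half a
  chi-square variable.\<close>

definition lgam_vert :: "real \<Rightarrow> real \<Rightarrow> complex" where
  "lgam_vert t y = ln_Gamma (Complex (y / 2) t) - ln_Gamma (complex_of_real (y / 2))"

definition lgam_approx :: "real \<Rightarrow> real \<Rightarrow> complex" where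
  "lgam_approx t y = \<i> * of_real (t * lgam_centre y) - of_real (t\<^sup>2 * ln y)"

lemma lgam_vert_increment:
  "\<exists>C Y. C \<ge> 0 \<and> Y \<ge> 2 \<and> (\<forall>y\<ge>Y. norm (lgam_vert t y - (lgam_approx t y - lgam_approx t (y - 1))) \<le> C / y\<^sup>2)"
proof -
  \<comment> \<open>The increment of \<open>lgam_centre\<close> without its constant
    \<open>- ln 2\<close>, which is matched with the one in \<open>ln (y / 2)\<close>.\<close>
  define r where "r = (\<lambda>y::real. (y - 1) * ln (y - 1) - (y - 2) * ln (y - 2) - 1 + (ln y - ln (y - 1)) / 2)"
  have "(\<lambda>y. (ln y - 1 / y) - r y) \<in> O[at_top](\<lambda>y. 1 / y\<^sup>2)"
    unfolding r_def by real_asymp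
  from bigo_at_top_bound[OF this] obtain C1 Y1 where
    C1: "C1 > 0" and Y1: "\<forall>y\<ge>Y1. \<bar>ln y - 1 / y - r y\<bar> \<le> C1 * \<bar>1 / y\<^sup>2\<bar>" by (elim exE conjE)
  have "(\<lambda>y::real. 1 / y - (ln y - ln (y - 1))) \<in> O[at_top](\<lambda>y. 1 / y\<^sup>2)"
    by real_asymp
  from bigo_at_top_bound[OF this] obtain C2 Y2 where
    C2: "C2 > 0" and Y2: "\<forall>y\<ge>Y2. \<bar>1 / y - (ln y - ln (y - 1))\<bar> \<le> C2 * \<bar>1 / (y::real)\<^sup>2\<bar>"
    by (elim exE conjE)
  \<comment> \<open>The argument is y/2, so each 1/x^2 becomes 4/y^2: this gives 8 from the Taylor
    remainder, 4 from Digamma, and 2 from half of Trigamma. \<open>C1\<close> and \<open>C2\<close>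
    bound the replacement of the leading terms by increments.\<close>
  let ?C = "8 * \<bar>t\<bar> ^ 3 + \<bar>t\<bar> * (4 + C1) + t\<^sup>2 * (2 + C2)"
  have "norm (lgam_vert t y - (lgam_approx t y - lgam_approx t (y - 1))) \<le> ?C / y\<^sup>2"
    if y: "max 2 (max Y1 Y2) \<le> y" for y
  proof -
    let ?x = "y / 2"
    define D P l e where "D = Digamma ?x" and "P = Polygamma 1 ?x"
      and "l = lgam_centre y - lgam_centre (y - 1)" and "e = ln y - ln (y - 1)"
    have x: "?x \<ge> 1" using y by simp
    have "y - 1 - 1 = y - 2" by simp
    then have "r y - ln 2 = l"
      unfolding r_def l_def lgam_centre_def by (simp only:) (simp add: field_simps)
    moreover have "ln (y / 2) = ln y - ln 2" using y by (simp add: ln_div)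
    moreover have "\<bar>ln y - 1 / y - r y\<bar> \<le> C1 / y\<^sup>2" using Y1 y by simp
    moreover have "\<bar>D - (ln (y / 2) - 1 / y)\<bar> \<le> 4 / y\<^sup>2"
      using Digamma_approx[OF x] by (simp add: power_divide D_def)
    ultimately have A: "\<bar>D - l\<bar> \<le> (4 + C1) / y\<^sup>2"
      unfolding add_divide_distrib by linarith
    have "\<bar>P - 2 / y\<bar> \<le> 4 / y\<^sup>2"
      using Trigamma_approx[OF x] by (simp add: power_divide P_def)
    then have "\<bar>P / 2 - 1 / y\<bar> \<le> 2 / y\<^sup>2" by linarith
    moreover have "\<bar>1 / y - e\<bar> \<le> C2 / y\<^sup>2"
      using Y2 y by (simp add: e_def)
    ultimately have B: "\<bar>P / 2 - e\<bar> \<le> (2 + C2) / y\<^sup>2"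
      unfolding add_divide_distrib by linarith
    define T where "T = lgam_vert t y - (\<i> * of_real (t * D) - of_real (t\<^sup>2 / 2 * P))"
    have T: "norm T \<le> 2 * \<bar>t\<bar> ^ 3 / ?x\<^sup>2"
      using ln_Gamma_vertical_Taylor[OF x, of t] unfolding T_def D_def P_def lgam_vert_def by simp
    have "lgam_approx t y - lgam_approx t (y - 1) = \<i> * of_real (t * l) - of_real (t\<^sup>2 * e)"
      unfolding lgam_approx_def l_def e_def by (simp add: algebra_simps)
    then have "lgam_vert t y - (lgam_approx t y - lgam_approx t (y - 1)) =
        T + \<i> * of_real (t * (D - l)) - of_real (t\<^sup>2 * (P / 2 - e))"
      unfolding T_def by (simp add: algebra_simps)
    also have "norm \<dots> \<le> norm T + norm (\<i> * complex_of_real (t * (D - l))) + norm (complex_of_real (t\<^sup>2 * (P / 2 - e)))"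
      by (intro order_trans[OF norm_triangle_ineq4] add_right_mono norm_triangle_ineq)
    also have "\<dots> \<le> 2 * \<bar>t\<bar> ^ 3 / ?x\<^sup>2 + \<bar>t\<bar> * ((4 + C1) / y\<^sup>2) + t\<^sup>2 * ((2 + C2) / y\<^sup>2)"
    proof (intro add_mono T)
      show "norm (\<i> * complex_of_real (t * (D - l))) \<le> \<bar>t\<bar> * ((4 + C1) / y\<^sup>2)"
        unfolding norm_mult norm_ii norm_of_real abs_mult mult_1 by (intro mult_left_mono A) simp
      have "\<bar>t\<^sup>2\<bar> * \<bar>P / 2 - e\<bar> \<le> \<bar>t\<^sup>2\<bar> * ((2 + C2) / y\<^sup>2)" by (intro mult_left_mono B) simp
      then show "norm (complex_of_real (t\<^sup>2 * (P / 2 - e))) \<le> t\<^sup>2 * ((2 + C2) / y\<^sup>2)"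
        unfolding norm_of_real abs_mult by simp
    qed
    also have "\<dots> = ?C / y\<^sup>2" by (simp add: power_divide add_divide_distrib distrib_left)
    finally show ?thesis .
  qed
  moreover have "?C \<ge> 0" using C1 C2 by simp
  ultimately show ?thesis
    by (intro exI[of _ ?C] exI[of _ "max 2 (max Y1 Y2)"]) simp
qed

text \<open>The main terms telescope, so only the end points m and m - p remain. Every index exceeds
  m - p, which bounds each of the p errors by the worst one; the threshold is therefore imposed on m
  - p.\<close>

lemma lgam_vert_sum:
  "\<exists>C Y. C \<ge> 0 \<and> (\<forall>m p. Y \<le> real m - real p \<longrightarrow> p < m \<longrightarrow>
      norm ((\<Sum>j<p. lgam_vert t (real (m - j))) - (lgam_approx t (real m) - lgam_approx t (real m - real p)))
        \<le> C * real p / (real m - real p)\<^sup>2)"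
proof -
  from lgam_vert_increment[of t] obtain C Y where C: "C \<ge> 0" "Y \<ge> 2"
    and inc: "\<forall>y\<ge>Y. norm (lgam_vert t y - (lgam_approx t y - lgam_approx t (y - 1))) \<le> C / y\<^sup>2"
    by (elim exE conjE)
  have "norm ((\<Sum>j<p. lgam_vert t (real (m - j))) - (lgam_approx t (real m) - lgam_approx t (real m - real p)))
      \<le> C * real p / (real m - real p)\<^sup>2" if mp: "Y \<le> real m - real p" "p < m" for m p
  proof -
    let ?A = "lgam_approx t" and ?E = "lgam_vert t"
    have tele: "(\<Sum>j<k. ?A (real m - real j) - ?A (real m - real j - 1)) = ?A (real m) - ?A (real m - real k)" for k
      by (induction k) (auto simp: algebra_simps)
    have "norm (\<Sum>j<p. ?E (real m - real j) - (?A (real m - real j) - ?A (real m - real j - 1))) \<le> real (card {..<p}) * (C / (real m - real p)\<^sup>2)"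
    proof (rule sum_norm_bound)
      fix j assume j: "j \<in> {..<p}"
      have "Y \<le> real m - real j" using mp j by auto
      then have "norm (?E (real m - real j) - (?A (real m - real j) - ?A (real m - real j - 1))) \<le> C / (real m - real j)\<^sup>2"
        using inc by simp
      also have "\<dots> \<le> C / (real m - real p)\<^sup>2"
        using C mp j by (intro divide_left_mono power_mono mult_pos_pos) auto
      finally show "norm (?E (real m - real j) - (?A (real m - real j) - ?A (real m - real j - 1))) \<le> C / (real m - real p)\<^sup>2" .
    qed
    moreover have "(\<Sum>j<p. ?E (real (m - j))) = (\<Sum>j<p. ?E (real m - real j))"
      using mp by (intro sum.cong) (auto simp: of_nat_diff)
    ultimately show ?thesis unfolding sum_subtractf[of "\<lambda>j. ?E (real m - real j)"] tele by (simp add: mult.commute)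
  qed
  then show ?thesis using C(1) by (intro exI[of _ C] exI[of _ Y]) simp
qed

section \<open>Random vectors with independent coordinates\<close>

text \<open>The new coordinate is put last because the integrals over product spaces peel off the
  last factor; the rotations of the Gram determinant arguments aim at the same axis.\<close>

definition vsnoc :: "real vec \<Rightarrow> real \<Rightarrow> real vec" where
  "vsnoc v x = v @\<^sub>v vec 1 (\<lambda>_. x)"

lemma dim_vsnoc [simp]: "dim_vec (vsnoc v x) = Suc (dim_vec v)"
  by (simp add: vsnoc_def)

lemma vsnoc_carrier [simp, intro]: "v \<in> carrier_vec n \<Longrightarrow> vsnoc v x \<in> carrier_vec (Suc n)"
  by (rule carrier_vecI) simp

lemma index_vsnoc: "i < Suc (dim_vec v) \<Longrightarrow> vsnoc v x $ i = (if i < dim_vec v then v $ i else x)"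
  by (auto simp: vsnoc_def)

lemma measurable_borel_vecI:
  assumes "f \<in> space N \<rightarrow> carrier_vec n"
    and "\<And>i. i < n \<Longrightarrow> (\<lambda>w. f w $ i) \<in> borel_measurable N"
  shows "f \<in> measurable N (borel_vec n)"
proof -
  have "(\<lambda>w. vec n (\<lambda>i\<in>{..<n}. f w $ i)) \<in> measurable N (borel_vec n)"
    by (rule measurable_compose[OF _ measurable_vec]) (auto intro!: measurable_restrict assms(2))
  then show ?thesis
  proof (rule measurable_cong[THEN iffD1, rotated])
    fix w assume "w \<in> space N"
    then have "f w \<in> carrier_vec n" using assms(1) by auto
    then show "vec n (\<lambda>i\<in>{..<n}. f w $ i) = f w" by (intro eq_vecI) simp_all
  qed
qed

lemma measurable_mult_mat_vec [measurable]:
  assumes "A \<in> carrier_mat m n"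
  shows "(\<lambda>v. A *\<^sub>v v) \<in> measurable (borel_vec n) (borel_vec m)"
proof (rule measurable_borel_vecI)
  fix i assume "i < m"
  have "(\<lambda>v. \<Sum>j<n. A $$ (i, j) * v $ j) \<in> borel_measurable (borel_vec n)"
    by (intro borel_measurable_sum borel_measurable_times measurable_vec_index) auto
  then show "(\<lambda>v. (A *\<^sub>v v) $ i) \<in> borel_measurable (borel_vec n)"
    by (rule measurable_cong[THEN iffD1, rotated])
       (use assms \<open>i < m\<close> in \<open>auto simp: scalar_prod_def lessThan_atLeast0 intro!: sum.cong\<close>)
qed (use assms in auto)

lemma measurable_add_vec:
  assumes "c \<in> carrier_vec n"
  shows "(\<lambda>v. v + c) \<in> measurable (borel_vec n) (borel_vec n)"
  by (rule measurable_borel_vecI)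
     (use assms in \<open>auto intro!: borel_measurable_add measurable_vec_index borel_measurable_const\<close>)

lemma measurable_vsnoc: "(\<lambda>(v, x). vsnoc v x) \<in> measurable (borel_vec n \<Otimes>\<^sub>M borel) (borel_vec (Suc n))"
proof (rule measurable_borel_vecI)
  fix i assume i: "i < Suc n"
  have "(\<lambda>p. if i < n then fst p $ i else snd p) \<in> borel_measurable (borel_vec n \<Otimes>\<^sub>M borel)"
    by (cases "i < n") (auto intro!: measurable_compose[OF measurable_fst] measurable_vec_index)
  then show "(\<lambda>w. (case w of (v, x) \<Rightarrow> vsnoc v x) $ i) \<in> borel_measurable (borel_vec n \<Otimes>\<^sub>M borel)"
    by (rule measurable_cong[THEN iffD1, rotated])
       (use i in \<open>auto simp: space_pair_measure index_vsnoc\<close>)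
qed (auto simp: space_pair_measure)

lemma measurable_vsnoc2 [measurable (raw)]:
  assumes "f \<in> measurable N (borel_vec n)" "g \<in> borel_measurable N"
  shows "(\<lambda>w. vsnoc (f w) (g w)) \<in> measurable N (borel_vec (Suc n))"
  using measurable_compose[OF measurable_Pair[OF assms] measurable_vsnoc] by simp

text \<open>Lebesgue measure and the standard normal law are both instances, so that the Fubini step
  over the last coordinate is proved once, for any sigma-finite factor on the Borel sets.\<close>

definition iid_vec :: "real measure \<Rightarrow> nat \<Rightarrow> real vec measure" where
  "iid_vec \<nu> n = distr (Pi\<^sub>M {..<n} (\<lambda>_. \<nu>)) (borel_vec n) (vec n)"

lemma lborel_vec_eq: "lborel_vec n = iid_vec lborel n"
  by (simp add: lborel_vec_def iid_vec_def)

lemma sets_iid_vec [simp, measurable_cong]: "sets (iid_vec \<nu> n) = sets (borel_vec n)"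
  by (simp add: iid_vec_def)

lemma space_iid_vec [simp]: "space (iid_vec \<nu> n) = carrier_vec n"
  by (simp add: iid_vec_def)

lemma measurable_vec_iid:
  assumes "sets \<nu> = sets borel"
  shows "vec n \<in> measurable (Pi\<^sub>M {..<n} (\<lambda>_. \<nu>)) (borel_vec n)"
  using measurable_vec by (subst measurable_cong_sets[OF sets_PiM_cong refl]) (auto simp: assms)

lemma nn_integral_iid_vec:
  assumes "sets \<nu> = sets borel" "f \<in> borel_measurable (borel_vec n)"
  shows "(\<integral>\<^sup>+v. f v \<partial>iid_vec \<nu> n) = (\<integral>\<^sup>+x. f (vec n x) \<partial>Pi\<^sub>M {..<n} (\<lambda>_. \<nu>))"
  unfolding iid_vec_def using assms by (subst nn_integral_distr) (auto intro: measurable_vec_iid)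

lemma nn_integral_iid_vec_0:
  assumes "sets \<nu> = sets borel" "f \<in> borel_measurable (borel_vec 0)"
  shows "(\<integral>\<^sup>+v. f v \<partial>iid_vec \<nu> 0) = f (0\<^sub>v 0)"
proof -
  have "vec 0 x = (0\<^sub>v 0 :: real vec)" for x by (intro eq_vecI) auto
  then have "f (vec 0 x) = f (0\<^sub>v 0)" for x by metis
  then show ?thesis
    by (simp add: nn_integral_iid_vec[OF assms] PiM_empty nn_integral_count_space_finite)
qed

text \<open>A push-forward need not inherit sigma-finiteness. Here \<open>vec n\<close> is inverted
  by the coordinate map, along which a countable cover of the product space by sets of finite
  measure can be pulled back.\<close>

lemma sigma_finite_iid_vec:
  assumes "sigma_finite_measure \<nu>" and s: "sets \<nu> = sets borel"
  shows "sigma_finite_measure (iid_vec \<nu> n)"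
proof -
  interpret product_sigma_finite "\<lambda>_::nat. \<nu>" by standard (use assms in \<open>auto simp: sigma_finite_measure_def\<close>)
  interpret f: finite_product_sigma_finite "\<lambda>_::nat. \<nu>" "{..<n}" by standard auto
  have inv: "(\<lambda>v. \<lambda>i\<in>{..<n}. v $ i) \<in> measurable (borel_vec n) (Pi\<^sub>M {..<n} (\<lambda>_. \<nu>))"
    by (intro measurable_restrict) (auto simp: measurable_cong_sets[OF refl s] intro!: measurable_vec_index)
  obtain A where A: "countable A" "A \<subseteq> sets (Pi\<^sub>M {..<n} (\<lambda>_. \<nu>))" "\<Union>A = space (Pi\<^sub>M {..<n} (\<lambda>_. \<nu>))"
      "\<forall>a\<in>A. emeasure (Pi\<^sub>M {..<n} (\<lambda>_. \<nu>)) a \<noteq> \<infinity>"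
    using f.sigma_finite_countable by auto
  let ?P = "Pi\<^sub>M {..<n} (\<lambda>_. \<nu>)" and ?r = "\<lambda>v. \<lambda>i\<in>{..<n}. v $ i"
  let ?B = "(\<lambda>a. ?r -` a \<inter> carrier_vec n) ` A"
  show ?thesis
  proof
    show "\<exists>B. countable B \<and> B \<subseteq> sets (iid_vec \<nu> n) \<and> \<Union> B = space (iid_vec \<nu> n) \<and> (\<forall>a\<in>B. emeasure (iid_vec \<nu> n) a \<noteq> \<infinity>)"
    proof (rule exI[of _ ?B], safe)
      show "countable ?B" using A(1) by auto
    next
      fix a assume "a \<in> A" then show "?r -` a \<inter> carrier_vec n \<in> sets (iid_vec \<nu> n)"
        using measurable_sets[OF inv, of a] A(2) by auto
    next
      fix v :: "real vec" assume v: "v \<in> space (iid_vec \<nu> n)"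
      have "?r v \<in> space ?P" using measurable_space[OF inv, of v] v by simp
      then show "v \<in> \<Union> ?B" using A(3) v by auto
    next
      fix a assume a: "a \<in> A" "emeasure (iid_vec \<nu> n) (?r -` a \<inter> carrier_vec n) = \<infinity>"
      have "emeasure (iid_vec \<nu> n) (?r -` a \<inter> carrier_vec n) = emeasure ?P (vec n -` (?r -` a \<inter> carrier_vec n) \<inter> space ?P)"
        unfolding iid_vec_def using measurable_sets[OF inv, of a] a A(2)
        by (subst emeasure_distr) (auto intro!: measurable_vec_iid s)
      also have "vec n -` (?r -` a \<inter> carrier_vec n) \<inter> space ?P = a"
      proof -
        have "?r (vec n x) = x" if "x \<in> space ?P" for x
          using that by (auto simp: space_PiM PiE_def extensional_def)
        moreover have "a \<subseteq> space ?P" using a A(3) by auto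
        ultimately show ?thesis by (auto simp: subset_eq)
      qed
      finally show False using A(4) a(1,2) by (metis infinity_ennreal_def)
    qed auto
  qed
qed

lemma nn_integral_iid_vec_Suc:
  assumes sf: "sigma_finite_measure \<nu>" and s: "sets \<nu> = sets borel"
    and f [measurable]: "f \<in> borel_measurable (borel_vec (Suc n))"
  shows "(\<integral>\<^sup>+v. f v \<partial>iid_vec \<nu> (Suc n)) = (\<integral>\<^sup>+x. \<integral>\<^sup>+v. f (vsnoc v x) \<partial>iid_vec \<nu> n \<partial>\<nu>)"
proof -
  interpret product_sigma_finite "\<lambda>_::nat. \<nu>" by standard (use sf in \<open>auto simp: sigma_finite_measure_def\<close>)
  have m: "(\<lambda>x. f (vec (Suc n) x)) \<in> borel_measurable (Pi\<^sub>M {..<Suc n} (\<lambda>_. \<nu>))"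
    by (rule measurable_compose[OF measurable_vec_iid[OF s] f])
  have ins: "{..<Suc n} = insert n {..<n}" by auto
  have "(\<integral>\<^sup>+v. f v \<partial>iid_vec \<nu> (Suc n)) = (\<integral>\<^sup>+x. f (vec (Suc n) x) \<partial>Pi\<^sub>M (insert n {..<n}) (\<lambda>_. \<nu>))"
    by (simp add: nn_integral_iid_vec[OF s f] ins)
  also have "\<dots> = (\<integral>\<^sup>+y. \<integral>\<^sup>+x. f (vec (Suc n) (x(n := y))) \<partial>Pi\<^sub>M {..<n} (\<lambda>_. \<nu>) \<partial>\<nu>)"
    by (subst product_nn_integral_insert_rev) (use m in \<open>auto simp: ins\<close>)
  also have "\<dots> = (\<integral>\<^sup>+y. \<integral>\<^sup>+x. f (vsnoc (vec n x) y) \<partial>Pi\<^sub>M {..<n} (\<lambda>_. \<nu>) \<partial>\<nu>)"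
    by (intro nn_integral_cong arg_cong[where f=f] eq_vecI) (auto simp: index_vsnoc)
  also have "\<dots> = (\<integral>\<^sup>+x. \<integral>\<^sup>+v. f (vsnoc v x) \<partial>iid_vec \<nu> n \<partial>\<nu>)"
  proof (intro nn_integral_cong nn_integral_iid_vec[symmetric] s)
    fix y show "(\<lambda>v. f (vsnoc v y)) \<in> borel_measurable (borel_vec n)" by measurable
  qed
  finally show ?thesis .
qed

lemma nn_integral_iid_vec_Suc':
  assumes sf: "sigma_finite_measure \<nu>" and s[measurable_cong]: "sets \<nu> = sets borel"
    and f [measurable]: "f \<in> borel_measurable (borel_vec (Suc n))"
  shows "(\<integral>\<^sup>+v. f v \<partial>iid_vec \<nu> (Suc n)) = (\<integral>\<^sup>+v. \<integral>\<^sup>+x. f (vsnoc v x) \<partial>\<nu> \<partial>iid_vec \<nu> n)"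
proof -
  interpret pair_sigma_finite "iid_vec \<nu> n" \<nu>
    using sf sigma_finite_iid_vec[OF sf s] by (simp add: pair_sigma_finite_def)
  show ?thesis
    unfolding nn_integral_iid_vec_Suc[OF assms]
    by (rule Fubini') measurable
qed

lemma nn_integral_lborel_vec_translate:
  assumes "f \<in> borel_measurable (borel_vec n)" "c \<in> carrier_vec n"
  shows "(\<integral>\<^sup>+v. f (v + c) \<partial>lborel_vec n) = (\<integral>\<^sup>+v. f v \<partial>lborel_vec n)"
  using assms
proof (induction n arbitrary: f c)
  case 0
  have "c = 0\<^sub>v 0" using 0 by auto
  then have "(\<lambda>v. f (v + c)) \<in> borel_measurable (borel_vec 0)"
    using measurable_compose[OF measurable_add_vec 0(1)] 0(2) by auto
  moreover have "0\<^sub>v 0 + 0\<^sub>v 0 = (0\<^sub>v 0 :: real vec)" by auto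
  ultimately show ?case using 0 \<open>c = 0\<^sub>v 0\<close>
    by (simp only: lborel_vec_eq nn_integral_iid_vec_0 sets_lborel)
next
  case (Suc n)
  note [measurable] = Suc.prems(1) measurable_add_vec[OF Suc.prems(2)]
  define c' where "c' = vec_first c n"
  define a where "a = c $ n"
  have c': "c' \<in> carrier_vec n" by (simp add: c'_def)
  have eq: "vsnoc v x + c = vsnoc (v + c') (x + a)" if "v \<in> carrier_vec n" for v x
    using that Suc.prems(2) by (intro eq_vecI) (auto simp: c'_def a_def vec_first_def less_Suc_eq index_vsnoc)
  have "(\<integral>\<^sup>+v. f (v + c) \<partial>lborel_vec (Suc n)) = (\<integral>\<^sup>+x. \<integral>\<^sup>+v. f (vsnoc v x + c) \<partial>iid_vec lborel n \<partial>lborel)"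
    unfolding lborel_vec_eq
    by (rule nn_integral_iid_vec_Suc) (auto intro: lborel.sigma_finite_measure_axioms)
  also have "\<dots> = (\<integral>\<^sup>+x. \<integral>\<^sup>+v. f (vsnoc (v + c') (x + a)) \<partial>lborel_vec n \<partial>lborel)"
    unfolding lborel_vec_eq by (intro nn_integral_cong) (simp add: eq)
  also have "\<dots> = (\<integral>\<^sup>+x. \<integral>\<^sup>+v. f (vsnoc v (x + a)) \<partial>lborel_vec n \<partial>lborel)"
    by (intro nn_integral_cong Suc.IH c') measurable
  also have "\<dots> = (\<integral>\<^sup>+x. \<integral>\<^sup>+v. f (vsnoc v x) \<partial>lborel_vec n \<partial>lborel)"
  proof -
    interpret sigma_finite_measure "lborel_vec n"
      unfolding lborel_vec_eq by (intro sigma_finite_iid_vec) (auto intro: lborel.sigma_finite_measure_axioms)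
    have "(\<lambda>x. \<integral>\<^sup>+v. f (vsnoc v x) \<partial>lborel_vec n) \<in> borel_measurable borel" by measurable
    from nn_integral_real_affine[OF this, of 1 a] show ?thesis by (simp add: add.commute)
  qed
  also have "\<dots> = (\<integral>\<^sup>+v. f v \<partial>lborel_vec (Suc n))"
    unfolding lborel_vec_eq by (rule nn_integral_iid_vec_Suc[symmetric]) (auto intro: lborel.sigma_finite_measure_axioms)
  finally show ?case .
qed

section \<open>Linear change of variables\<close>

text \<open>Block elimination with pivot \<open>D\<close>. For a 1 x 1 pivot the factors are an
  upper shear, a block diagonal matrix and a lower shear, the three kinds for which a change of
  variables reduces to one coordinate or to a smaller dimension.\<close>

lemma four_block_schur:
  fixes A B C D Di :: "'a :: comm_ring_1 mat"
  assumes A: "A \<in> carrier_mat n n" and B: "B \<in> carrier_mat n m" and C: "C \<in> carrier_mat m n"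
    and D: "D \<in> carrier_mat m m" and Di: "Di \<in> carrier_mat m m" and inv: "Di * D = 1\<^sub>m m" "D * Di = 1\<^sub>m m"
  shows "four_block_mat A B C D =
    four_block_mat (1\<^sub>m n) (B * Di) (0\<^sub>m m n) (1\<^sub>m m) *
    (four_block_mat (A - B * Di * C) (0\<^sub>m n m) (0\<^sub>m m n) D *
     four_block_mat (1\<^sub>m n) (0\<^sub>m n m) (Di * C) (1\<^sub>m m))"
proof -
  have S: "A - B * Di * C \<in> carrier_mat n n" using A B C Di by auto
  have DC: "D * (Di * C) = C"
    using C D Di inv by (simp add: assoc_mult_mat[symmetric, OF D Di C])
  have BD: "B * Di * D = B"
    using B D Di inv by (simp add: assoc_mult_mat[OF B Di D])
  have "four_block_mat (A - B * Di * C) (0\<^sub>m n m) (0\<^sub>m m n) D *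
     four_block_mat (1\<^sub>m n) (0\<^sub>m n m) (Di * C) (1\<^sub>m m) =
     four_block_mat (A - B * Di * C) (0\<^sub>m n m) C D"
    using A B C D Di S
    by (subst mult_four_block_mat[where ?n1.0=n and ?n2.0=m and ?nr1.0=n and ?nr2.0=m and ?nc1.0=n and ?nc2.0=m])
       (auto simp: DC)
  moreover have "A - B * Di * C + B * Di * C = A"
    using A B C Di by (intro eq_matI) auto
  ultimately show ?thesis
    using A B C D Di S
    by (simp add: mult_four_block_mat[where ?n1.0=n and ?n2.0=m and ?nr1.0=n and ?nr2.0=m and ?nc1.0=n and ?nc2.0=m] BD)
qed

lemma det_four_block_schur:
  fixes A B C D Di :: "'a :: idom mat"
  assumes A: "A \<in> carrier_mat n n" and B: "B \<in> carrier_mat n m" and C: "C \<in> carrier_mat m n"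
    and D: "D \<in> carrier_mat m m" and Di: "Di \<in> carrier_mat m m" and inv: "Di * D = 1\<^sub>m m" "D * Di = 1\<^sub>m m"
  shows "det (four_block_mat A B C D) = det (A - B * Di * C) * det D"
proof -
  have S: "A - B * Di * C \<in> carrier_mat n n" using A B C Di by auto
  have "det (four_block_mat (1\<^sub>m n) (B * Di) (0\<^sub>m m n) (1\<^sub>m m)) = 1"
    using B Di by (subst det_four_block_mat_lower_left_zero[of _ n _ m]) auto
  moreover have "det (four_block_mat (1\<^sub>m n) (0\<^sub>m n m) (Di * C) (1\<^sub>m m)) = 1"
    using C Di by (subst det_four_block_mat_upper_right_zero[of _ n _ m]) auto
  moreover have "det (four_block_mat (A - B * Di * C) (0\<^sub>m n m) (0\<^sub>m m n) D) = det (A - B * Di * C) * det D"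
    using S D by (subst det_four_block_mat_upper_right_zero[of _ n _ m]) auto
  moreover have "det (U * (V * W)) = det U * (det V * det W)"
    if "U \<in> carrier_mat (n + m) (n + m)" "V \<in> carrier_mat (n + m) (n + m)" "W \<in> carrier_mat (n + m) (n + m)" for U V W :: "'a mat"
    using that by (simp add: det_mult[of _ "n + m"])
  ultimately show ?thesis
    unfolding four_block_schur[OF assms] using S B C D Di
    by simp
qed

section \<open>Change of variables for Lebesgue measure\<close>

text \<open>The change of variables formula is made a predicate on matrices because it is closed
  under products and can then be checked on the factors of an elimination. With the determinant as a
  factor on the transformed side, no division occurs in \<open>ennreal\<close>.\<close>

definition lborel_scaling :: "nat \<Rightarrow> real mat \<Rightarrow> bool" where
  "lborel_scaling n A \<longleftrightarrow> A \<in> carrier_mat n n \<and>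
     (\<forall>f\<in>borel_measurable (borel_vec n).
        ennreal \<bar>det A\<bar> * (\<integral>\<^sup>+v. f (A *\<^sub>v v) \<partial>lborel_vec n) = (\<integral>\<^sup>+v. f v \<partial>lborel_vec n))"

lemma lborel_scalingD:
  assumes "lborel_scaling n A" "f \<in> borel_measurable (borel_vec n)"
  shows "ennreal \<bar>det A\<bar> * (\<integral>\<^sup>+v. f (A *\<^sub>v v) \<partial>lborel_vec n) = (\<integral>\<^sup>+v. f v \<partial>lborel_vec n)"
  using assms by (simp add: lborel_scaling_def)

lemma lborel_scaling_mult:
  assumes "lborel_scaling n A" "lborel_scaling n B"
  shows "lborel_scaling n (A * B)"
  unfolding lborel_scaling_def
proof (intro conjI ballI)
  have AB: "A \<in> carrier_mat n n" "B \<in> carrier_mat n n" using assms by (auto simp: lborel_scaling_def)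
  then show "A * B \<in> carrier_mat n n" by auto
  fix f :: "real vec \<Rightarrow> ennreal" assume f: "f \<in> borel_measurable (borel_vec n)"
  have "(\<lambda>v. f (A *\<^sub>v v)) \<in> borel_measurable (borel_vec n)"
    using measurable_compose[OF measurable_mult_mat_vec f] AB by auto
  then have "(\<integral>\<^sup>+v. f (A *\<^sub>v v) \<partial>lborel_vec n) = ennreal \<bar>det B\<bar> * (\<integral>\<^sup>+v. f (A *\<^sub>v (B *\<^sub>v v)) \<partial>lborel_vec n)"
    by (rule lborel_scalingD[OF assms(2), of "\<lambda>v. f (A *\<^sub>v v)", symmetric])
  moreover have "(\<integral>\<^sup>+v. f (A *\<^sub>v (B *\<^sub>v v)) \<partial>lborel_vec n) = (\<integral>\<^sup>+v. f (A * B *\<^sub>v v) \<partial>lborel_vec n)"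
    using AB by (intro nn_integral_cong) (auto simp: assoc_mult_mat_vec)
  moreover have "ennreal \<bar>det A\<bar> * (\<integral>\<^sup>+v. f (A *\<^sub>v v) \<partial>lborel_vec n) = (\<integral>\<^sup>+v. f v \<partial>lborel_vec n)"
    using assms(1) f by (simp add: lborel_scaling_def)
  ultimately show "ennreal \<bar>det (A * B)\<bar> * (\<integral>\<^sup>+v. f (A * B *\<^sub>v v) \<partial>lborel_vec n) = (\<integral>\<^sup>+v. f v \<partial>lborel_vec n)"
    using AB by (simp add: det_mult abs_mult ennreal_mult mult.assoc)
qed

lemma nn_integral_lborel_vec_Suc:
  assumes "f \<in> borel_measurable (borel_vec (Suc n))"
  shows "(\<integral>\<^sup>+v. f v \<partial>lborel_vec (Suc n)) = (\<integral>\<^sup>+x. \<integral>\<^sup>+v. f (vsnoc v x) \<partial>lborel_vec n \<partial>lborel)"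
    and "(\<integral>\<^sup>+v. f v \<partial>lborel_vec (Suc n)) = (\<integral>\<^sup>+v. \<integral>\<^sup>+x. f (vsnoc v x) \<partial>lborel \<partial>lborel_vec n)"
  unfolding lborel_vec_eq
  by (rule nn_integral_iid_vec_Suc nn_integral_iid_vec_Suc'; simp add: assms lborel.sigma_finite_measure_axioms)+

lemma four_block_mult_vsnoc:
  assumes A: "A \<in> carrier_mat n n" and B: "B \<in> carrier_mat n 1" and C: "C \<in> carrier_mat 1 n"
    and D: "D \<in> carrier_mat 1 1" and v: "v \<in> carrier_vec n"
  shows "four_block_mat A B C D *\<^sub>v vsnoc v x =
    vsnoc (A *\<^sub>v v + B *\<^sub>v vec 1 (\<lambda>_. x)) ((C *\<^sub>v v) $ 0 + D $$ (0, 0) * x)"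
proof -
  have "C *\<^sub>v v + D *\<^sub>v vec 1 (\<lambda>_. x) = vec 1 (\<lambda>_. (C *\<^sub>v v) $ 0 + D $$ (0, 0) * x)"
    using C D v by (intro eq_vecI) (auto simp: scalar_prod_def)
  then show ?thesis
    unfolding vsnoc_def using assms
    by (subst four_block_mat_mult_vec[of _ n n _ 1 _ 1]) auto
qed

lemma four_block_mult_vsnoc_special:
  assumes "S \<in> carrier_mat n n" "B \<in> carrier_mat n 1" "C \<in> carrier_mat 1 n" "D \<in> carrier_mat 1 1" "v \<in> carrier_vec n"
  shows "four_block_mat (1\<^sub>m n) B (0\<^sub>m 1 n) (1\<^sub>m 1) *\<^sub>v vsnoc v x = vsnoc (v + B *\<^sub>v vec 1 (\<lambda>_. x)) x"
    and "four_block_mat (1\<^sub>m n) (0\<^sub>m n 1) C (1\<^sub>m 1) *\<^sub>v vsnoc v x = vsnoc v ((C *\<^sub>v v) $ 0 + x)"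
    and "four_block_mat S (0\<^sub>m n 1) (0\<^sub>m 1 n) D *\<^sub>v vsnoc v x = vsnoc (S *\<^sub>v v) (D $$ (0, 0) * x)"
proof -
  have z: "0\<^sub>m n 1 *\<^sub>v vec 1 (\<lambda>_. x) = 0\<^sub>v n" "(0\<^sub>m 1 n *\<^sub>v v) $ 0 = 0"
    using assms by (auto intro!: eq_vecI simp: scalar_prod_def)
  show "four_block_mat (1\<^sub>m n) B (0\<^sub>m 1 n) (1\<^sub>m 1) *\<^sub>v vsnoc v x = vsnoc (v + B *\<^sub>v vec 1 (\<lambda>_. x)) x"
    using assms by (subst four_block_mult_vsnoc[of _ n]) (auto simp: z simp del: One_nat_def)
  show "four_block_mat (1\<^sub>m n) (0\<^sub>m n 1) C (1\<^sub>m 1) *\<^sub>v vsnoc v x = vsnoc v ((C *\<^sub>v v) $ 0 + x)"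
    using assms by (subst four_block_mult_vsnoc[of _ n]) (auto simp: z simp del: One_nat_def)
  show "four_block_mat S (0\<^sub>m n 1) (0\<^sub>m 1 n) D *\<^sub>v vsnoc v x = vsnoc (S *\<^sub>v v) (D $$ (0, 0) * x)"
    using assms by (subst four_block_mult_vsnoc[of _ n]) (auto simp: z simp del: One_nat_def)
qed

text \<open>The shear translates \<open>v\<close> by a vector depending on \<open>x\<close> alone,
  so \<open>v\<close> is integrated first. For the lower shear the roles are exchanged, and with
  them the order of integration.\<close>

lemma lborel_scaling_upper:
  assumes B: "B \<in> carrier_mat n 1"
  shows "lborel_scaling (Suc n) (four_block_mat (1\<^sub>m n) B (0\<^sub>m 1 n) (1\<^sub>m 1))" (is "lborel_scaling _ ?U")
  unfolding lborel_scaling_def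
proof (intro conjI ballI)
  show c: "?U \<in> carrier_mat (Suc n) (Suc n)" using B by auto
  fix f :: "real vec \<Rightarrow> ennreal" assume f[measurable]: "f \<in> borel_measurable (borel_vec (Suc n))"
  have m: "(\<lambda>v. f (?U *\<^sub>v v)) \<in> borel_measurable (borel_vec (Suc n))"
    using measurable_compose[OF measurable_mult_mat_vec[OF c] f] .
  have d: "det ?U = 1"
    using B by (subst det_four_block_mat_lower_left_zero[of _ n _ 1]) auto
  have "(\<integral>\<^sup>+v. f (?U *\<^sub>v v) \<partial>lborel_vec (Suc n)) = (\<integral>\<^sup>+x. \<integral>\<^sup>+v. f (vsnoc (v + B *\<^sub>v vec 1 (\<lambda>_. x)) x) \<partial>lborel_vec n \<partial>lborel)"
    unfolding nn_integral_lborel_vec_Suc(1)[OF m]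
    using B by (intro nn_integral_cong) (simp add: four_block_mult_vsnoc_special(1)[of "1\<^sub>m n" _ _ "0\<^sub>m 1 n" "1\<^sub>m 1"] del: One_nat_def)
  also have "\<dots> = (\<integral>\<^sup>+x. \<integral>\<^sup>+v. f (vsnoc v x) \<partial>lborel_vec n \<partial>lborel)"
    using B by (intro nn_integral_cong nn_integral_lborel_vec_translate[where f="\<lambda>v. f (vsnoc v _)"]) auto
  finally show "ennreal \<bar>det ?U\<bar> * (\<integral>\<^sup>+v. f (?U *\<^sub>v v) \<partial>lborel_vec (Suc n)) = (\<integral>\<^sup>+v. f v \<partial>lborel_vec (Suc n))"
    by (simp add: d nn_integral_lborel_vec_Suc(1)[OF f] del: One_nat_def)
qed

lemma lborel_scaling_lower:
  assumes C: "C \<in> carrier_mat 1 n"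
  shows "lborel_scaling (Suc n) (four_block_mat (1\<^sub>m n) (0\<^sub>m n 1) C (1\<^sub>m 1))" (is "lborel_scaling _ ?U")
  unfolding lborel_scaling_def
proof (intro conjI ballI)
  show c: "?U \<in> carrier_mat (Suc n) (Suc n)" using C by auto
  fix f :: "real vec \<Rightarrow> ennreal" assume f[measurable]: "f \<in> borel_measurable (borel_vec (Suc n))"
  have m: "(\<lambda>v. f (?U *\<^sub>v v)) \<in> borel_measurable (borel_vec (Suc n))"
    using measurable_compose[OF measurable_mult_mat_vec[OF c] f] .
  have d: "det ?U = 1"
    using C by (subst det_four_block_mat_upper_right_zero[of _ n _ 1]) auto
  have "(\<integral>\<^sup>+v. f (?U *\<^sub>v v) \<partial>lborel_vec (Suc n)) = (\<integral>\<^sup>+v. \<integral>\<^sup>+x. f (vsnoc v ((C *\<^sub>v v) $ 0 + x)) \<partial>lborel \<partial>lborel_vec n)"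
    unfolding nn_integral_lborel_vec_Suc(2)[OF m]
    using C by (intro nn_integral_cong) (simp add: four_block_mult_vsnoc_special(2)[of "1\<^sub>m n" _ "0\<^sub>m n 1" _ "1\<^sub>m 1"] del: One_nat_def index_mult_mat_vec)
  also have "\<dots> = (\<integral>\<^sup>+v. \<integral>\<^sup>+x. f (vsnoc v x) \<partial>lborel \<partial>lborel_vec n)"
  proof (rule nn_integral_cong)
    fix v :: "real vec" assume v: "v \<in> space (lborel_vec n)"
    have "(\<lambda>x. f (vsnoc v x)) \<in> borel_measurable borel"
      using v by (intro measurable_compose[OF measurable_vsnoc2[of "\<lambda>_. v" borel n "\<lambda>x. x"] f]) auto
    from nn_integral_real_affine[OF this, of 1 "(C *\<^sub>v v) $ 0"]
    show "(\<integral>\<^sup>+x. f (vsnoc v ((C *\<^sub>v v) $ 0 + x)) \<partial>lborel) = (\<integral>\<^sup>+x. f (vsnoc v x) \<partial>lborel)" by simp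
  qed
  finally show "ennreal \<bar>det ?U\<bar> * (\<integral>\<^sup>+v. f (?U *\<^sub>v v) \<partial>lborel_vec (Suc n)) = (\<integral>\<^sup>+v. f v \<partial>lborel_vec (Suc n))"
    by (simp add: d nn_integral_lborel_vec_Suc(2)[OF f] del: One_nat_def)
qed

lemma lborel_scaling_diag:
  assumes S: "lborel_scaling n S" and D: "D \<in> carrier_mat 1 1" "det D \<noteq> 0"
  shows "lborel_scaling (Suc n) (four_block_mat S (0\<^sub>m n 1) (0\<^sub>m 1 n) D)" (is "lborel_scaling _ ?U")
  unfolding lborel_scaling_def
proof (intro conjI ballI)
  have Sc: "S \<in> carrier_mat n n" using S by (auto simp: lborel_scaling_def)
  show c: "?U \<in> carrier_mat (Suc n) (Suc n)" using Sc D by auto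
  fix f :: "real vec \<Rightarrow> ennreal" assume f[measurable]: "f \<in> borel_measurable (borel_vec (Suc n))"
  have m: "(\<lambda>v. f (?U *\<^sub>v v)) \<in> borel_measurable (borel_vec (Suc n))"
    using measurable_compose[OF measurable_mult_mat_vec[OF c] f] .
  have d: "det ?U = det S * det D"
    using Sc D by (subst det_four_block_mat_upper_right_zero[of _ n _ 1]) auto
  have dD: "D $$ (0, 0) = det D" using D det_single[of D] by simp
  interpret sigma_finite_measure "lborel_vec n"
    unfolding lborel_vec_eq by (intro sigma_finite_iid_vec) (auto intro: lborel.sigma_finite_measure_axioms)
  note [measurable] = measurable_mult_mat_vec[OF Sc]
  have "(\<integral>\<^sup>+v. f (?U *\<^sub>v v) \<partial>lborel_vec (Suc n)) = (\<integral>\<^sup>+x. \<integral>\<^sup>+v. f (vsnoc (S *\<^sub>v v) (det D * x)) \<partial>lborel_vec n \<partial>lborel)"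
    unfolding nn_integral_lborel_vec_Suc(1)[OF m]
    using D Sc by (intro nn_integral_cong) (simp add: four_block_mult_vsnoc_special(3)[of _ _ "0\<^sub>m n 1" "0\<^sub>m 1 n"] dD del: One_nat_def)
  then have "ennreal \<bar>det ?U\<bar> * (\<integral>\<^sup>+v. f (?U *\<^sub>v v) \<partial>lborel_vec (Suc n)) =
     ennreal \<bar>det D\<bar> * (\<integral>\<^sup>+x. ennreal \<bar>det S\<bar> * (\<integral>\<^sup>+v. f (vsnoc (S *\<^sub>v v) (det D * x)) \<partial>lborel_vec n) \<partial>lborel)"
    by (subst nn_integral_cmult) (measurable, simp add: d abs_mult ennreal_mult mult_ac del: One_nat_def)
  also have "\<dots> = ennreal \<bar>det D\<bar> * (\<integral>\<^sup>+x. \<integral>\<^sup>+v. f (vsnoc v (det D * x)) \<partial>lborel_vec n \<partial>lborel)"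
  proof (intro arg_cong2[where f="(*)"] refl nn_integral_cong)
    fix x :: real
    have "(\<lambda>v. f (vsnoc v (det D * x))) \<in> borel_measurable (borel_vec n)" by measurable
    then show "ennreal \<bar>det S\<bar> * (\<integral>\<^sup>+v. f (vsnoc (S *\<^sub>v v) (det D * x)) \<partial>lborel_vec n) = (\<integral>\<^sup>+v. f (vsnoc v (det D * x)) \<partial>lborel_vec n)"
      by (rule lborel_scalingD[OF S])
  qed
  also have "\<dots> = (\<integral>\<^sup>+x. \<integral>\<^sup>+v. f (vsnoc v x) \<partial>lborel_vec n \<partial>lborel)"
  proof -
    have "(\<lambda>x. \<integral>\<^sup>+v. f (vsnoc v x) \<partial>lborel_vec n) \<in> borel_measurable borel" by measurable
    from nn_integral_real_affine[OF this D(2), of 0] show ?thesis by simp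
  qed
  finally show "ennreal \<bar>det ?U\<bar> * (\<integral>\<^sup>+v. f (?U *\<^sub>v v) \<partial>lborel_vec (Suc n)) = (\<integral>\<^sup>+v. f v \<partial>lborel_vec (Suc n))"
    by (simp add: nn_integral_lborel_vec_Suc(1)[OF f] del: One_nat_def)
qed

lemma mat_1x1_inverse:
  fixes D :: "real mat"
  assumes D: "D \<in> carrier_mat 1 1" "D $$ (0, 0) \<noteq> 0"
  obtains Di where "Di \<in> carrier_mat 1 1" "Di * D = 1\<^sub>m 1" "D * Di = 1\<^sub>m 1"
proof
  let ?Di = "mat 1 1 (\<lambda>_. 1 / D $$ (0, 0))"
  show "?Di \<in> carrier_mat 1 1" by simp
  show "?Di * D = 1\<^sub>m 1" "D * ?Di = 1\<^sub>m 1"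
    using D by (auto intro!: eq_matI simp: scalar_prod_def)
qed

text \<open>Elimination with the bottom right entry as pivot, by induction on the dimension. The
  Schur complement stays invertible since \<open>det A = det S * det D\<close>.\<close>

proposition lborel_scaling:
  assumes "A \<in> carrier_mat n n" "det A \<noteq> 0"
  shows "lborel_scaling n A"
  using assms
proof (induction n arbitrary: A)
  case 0
  have "A = 1\<^sub>m 0" using 0 by auto
  moreover have "f (1\<^sub>m 0 *\<^sub>v v) = f v" if "v \<in> carrier_vec 0" for f :: "real vec \<Rightarrow> ennreal" and v
    using that by simp
  ultimately show ?case
    by (auto simp: lborel_scaling_def intro!: nn_integral_cong)
next
  case (Suc n)
  have pivot: "lborel_scaling (Suc n) A"
    if A: "A \<in> carrier_mat (Suc n) (Suc n)" "det A \<noteq> 0" and p: "A $$ (n, n) \<noteq> 0" for A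
  proof -
    obtain A1 B C D where s: "split_block A n n = (A1, B, C, D)" by (metis prod_cases4)
    note sb = split_block[OF s, of 1 1]
    have car: "A1 \<in> carrier_mat n n" "B \<in> carrier_mat n 1" "C \<in> carrier_mat 1 n" "D \<in> carrier_mat 1 1"
      and Aeq: "A = four_block_mat A1 B C D"
      using sb A by auto
    have "D $$ (0, 0) = A $$ (n, n)" unfolding Aeq using car by auto
    then have D: "D $$ (0, 0) \<noteq> 0" "det D \<noteq> 0" using p car det_single[of D] by auto
    obtain Di where Di: "Di \<in> carrier_mat 1 1" "Di * D = 1\<^sub>m 1" "D * Di = 1\<^sub>m 1"
      using mat_1x1_inverse[OF car(4) D(1)] by blast
    define S where "S = A1 - B * Di * C"
    have S: "S \<in> carrier_mat n n" using car Di by (auto simp: S_def)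
    have "det A = det S * det D"
      unfolding Aeq S_def by (rule det_four_block_schur[OF car Di])
    then have "lborel_scaling n S" using Suc.IH[OF S] A(2) by auto
    then show ?thesis
      unfolding Aeq four_block_schur[OF car Di]
      unfolding S_def[symmetric]
      using car Di D
      by (intro lborel_scaling_mult lborel_scaling_upper lborel_scaling_diag lborel_scaling_lower) auto
  qed
  show ?case
  proof (cases "A $$ (n, n) = 0")
    case False
    with pivot Suc.prems show ?thesis by auto
  next
    case True
    obtain A1 B C D where s: "split_block A n n = (A1, B, C, D)" by (metis prod_cases4)
    note sb = split_block[OF s, of 1 1]
    have car: "A1 \<in> carrier_mat n n" "B \<in> carrier_mat n 1" "C \<in> carrier_mat 1 n" "D \<in> carrier_mat 1 1"
      and Aeq: "A = four_block_mat A1 B C D"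
      using sb Suc.prems by auto
    have "D $$ (0, 0) = A $$ (n, n)" unfolding Aeq using car by auto
    then have D0: "D $$ (0, 0) = 0" using True by simp
    \<comment> \<open>A unitriangular factor replaces the vanishing pivot by the sum of squares of the entries above it.\<close>
    let ?L = "\<lambda>C. four_block_mat (1\<^sub>m n) (0\<^sub>m n 1) C (1\<^sub>m 1) :: real mat"
    let ?Bt = "transpose_mat B"
    have Bt: "?Bt \<in> carrier_mat 1 n" "- ?Bt \<in> carrier_mat 1 n" using car by auto
    have LA: "?L ?Bt * A = four_block_mat A1 B (?Bt * A1 + C) (?Bt * B + D)"
      unfolding Aeq using car Bt
      by (subst mult_four_block_mat[where ?n1.0=n and ?n2.0=1 and ?nr1.0=n and ?nr2.0=1 and ?nc1.0=n and ?nc2.0=1]) auto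
    have LL: "?L (- ?Bt) * ?L ?Bt = 1\<^sub>m (Suc n)"
    proof -
      have "- ?Bt + ?Bt = 0\<^sub>m 1 n" using car by (intro eq_matI) auto
      then show ?thesis using car Bt
        by (subst mult_four_block_mat[where ?n1.0=n and ?n2.0=1 and ?nr1.0=n and ?nr2.0=1 and ?nc1.0=n and ?nc2.0=1]) auto
    qed
    have Lc: "?L ?Bt \<in> carrier_mat (Suc n) (Suc n)" "?L (- ?Bt) \<in> carrier_mat (Suc n) (Suc n)"
      using Bt by auto
    have "A = (?L (- ?Bt) * ?L ?Bt) * A" unfolding LL using Suc.prems by simp
    also have "\<dots> = ?L (- ?Bt) * (?L ?Bt * A)"
      using Lc Suc.prems by (intro assoc_mult_mat) auto
    finally have A: "A = ?L (- ?Bt) * (?L ?Bt * A)" .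
    have "det (?L ?Bt) = 1"
      using car by (subst det_four_block_mat_upper_right_zero[of _ n _ 1]) auto
    then have dLA: "det (?L ?Bt * A) \<noteq> 0"
      using Lc Suc.prems by (subst det_mult[of _ "Suc n"]) auto
    have "(?L ?Bt * A) $$ (n, n) = (\<Sum>i<n. (B $$ (i, 0))\<^sup>2)"
      unfolding LA using car D0
      by (auto simp: scalar_prod_def power2_eq_square lessThan_atLeast0 intro!: sum.cong)
    \<comment> \<open>The old pivot is zero as well, so a vanishing sum would make the whole last
      column of \<open>A\<close> zero and \<open>A\<close> singular.\<close>
    moreover have "(\<Sum>i<n. (B $$ (i, 0))\<^sup>2) \<noteq> 0"
    proof
      assume "(\<Sum>i<n. (B $$ (i, 0))\<^sup>2) = 0"
      then have B0: "B $$ (i, 0) = 0" if "i < n" for i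
        using that by (subst (asm) sum_nonneg_eq_0_iff) auto
      have "A $$ (i, n) = 0" if "i < Suc n" for i
        unfolding Aeq using car B0 D0 that by (cases "i = n") auto
      then have "A *\<^sub>v unit_vec (Suc n) n = 0\<^sub>v (Suc n)"
        using Suc.prems by (intro eq_vecI) (auto simp: scalar_prod_right_unit)
      then have "det A = 0"
        using Suc.prems by (subst det_0_iff_vec_prod_zero[of _ "Suc n"]) (auto intro!: exI[of _ "unit_vec (Suc n) n"])
      then show False using Suc.prems by simp
    qed
    ultimately have "lborel_scaling (Suc n) (?L ?Bt * A)"
      using Lc Suc.prems dLA by (intro pivot) auto
    then show ?thesis
      using A lborel_scaling_mult[OF lborel_scaling_lower[OF Bt(2)]] by metis
  qed
qed

section \<open>Normal random vectors\<close>

lemma inverse_matE: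
  fixes A :: "real mat"
  assumes "A \<in> carrier_mat n n" "det A \<noteq> 0"
  obtains B where "B \<in> carrier_mat n n" "A * B = 1\<^sub>m n" "B * A = 1\<^sub>m n"
  using det_non_zero_imp_unit[OF assms, of "()"] by (auto simp: Units_def ring_mat_def)

lemma mat_inv_eqI:
  assumes A: "A \<in> carrier_mat n n" and B: "B \<in> carrier_mat n n" and AB: "A * B = 1\<^sub>m n"
  shows "mat_inv A = B"
proof -
  have BA: "B * A = 1\<^sub>m n" using mat_mult_left_right_inverse[OF A B AB] .
  have "A \<in> Units (ring_mat TYPE(real) n ())"
    using A B AB BA by (auto simp: Units_def ring_mat_def)
  then obtain C where C: "mat_inverse A = Some C" using mat_inverse(1)[OF A, where b = "()"] by (cases "mat_inverse A") auto
  have C': "C \<in> carrier_mat n n" "C * A = 1\<^sub>m n" using mat_inverse(2)[OF A C] by auto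
  have "C = C * (A * B)" using C' AB by simp
  also have "\<dots> = B" using A B C' by (simp add: assoc_mult_mat[symmetric])
  finally show ?thesis using C by (simp add: mat_inv_def)
qed

lemma nn_integral_iid_vec_density:
  assumes g[measurable]: "g \<in> borel_measurable borel" and gp: "\<And>x. 0 \<le> g x"
    and sf: "sigma_finite_measure (density lborel (\<lambda>x. ennreal (g x)))"
    and f: "f \<in> borel_measurable (borel_vec n)"
  shows "(\<integral>\<^sup>+v. f v \<partial>iid_vec (density lborel (\<lambda>x. ennreal (g x))) n) =
    (\<integral>\<^sup>+v. ennreal (\<Prod>i<n. g (v $ i)) * f v \<partial>lborel_vec n)"
  using f
proof (induction n arbitrary: f)
  case 0
  then show ?case by (simp add: lborel_vec_eq nn_integral_iid_vec_0 del: zero_vec_zero)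
next
  case (Suc n)
  note [measurable] = Suc.prems
  have [measurable]: "(\<lambda>v. g (v $ i)) \<in> borel_measurable (borel_vec m)" if "i < m" for i m
    by (rule measurable_compose[OF measurable_vec_index[OF that] g])
  have m: "(\<lambda>v. ennreal (\<Prod>i<Suc n. g (v $ i)) * f v) \<in> borel_measurable (borel_vec (Suc n))"
    by (intro borel_measurable_times_ennreal measurable_compose[OF borel_measurable_prod measurable_ennreal]) auto
  have m': "(\<lambda>v. ennreal (\<Prod>i<n. g (v $ i))) \<in> borel_measurable (borel_vec n)"
    by (intro measurable_compose[OF borel_measurable_prod measurable_ennreal]) auto
  interpret sigma_finite_measure "lborel_vec n"
    unfolding lborel_vec_eq by (intro sigma_finite_iid_vec) (auto intro: lborel.sigma_finite_measure_axioms)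
  let ?\<nu> = "density lborel (\<lambda>x. ennreal (g x))"
  have "(\<integral>\<^sup>+v. f v \<partial>iid_vec ?\<nu> (Suc n)) = (\<integral>\<^sup>+x. \<integral>\<^sup>+v. f (vsnoc v x) \<partial>iid_vec ?\<nu> n \<partial>?\<nu>)"
    by (rule nn_integral_iid_vec_Suc[OF sf]) auto
  also have "\<dots> = (\<integral>\<^sup>+x. \<integral>\<^sup>+v. ennreal (\<Prod>i<n. g (v $ i)) * f (vsnoc v x) \<partial>lborel_vec n \<partial>?\<nu>)"
    by (intro nn_integral_cong Suc.IH) measurable
  also have "\<dots> = (\<integral>\<^sup>+x. ennreal (g x) * (\<integral>\<^sup>+v. ennreal (\<Prod>i<n. g (v $ i)) * f (vsnoc v x) \<partial>lborel_vec n) \<partial>lborel)"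
    using m' by (intro nn_integral_density) measurable
  also have "\<dots> = (\<integral>\<^sup>+x. \<integral>\<^sup>+v. ennreal (g x) * (ennreal (\<Prod>i<n. g (v $ i)) * f (vsnoc v x)) \<partial>lborel_vec n \<partial>lborel)"
    using m' by (intro nn_integral_cong nn_integral_cmult[symmetric]) measurable
  also have "\<dots> = (\<integral>\<^sup>+x. \<integral>\<^sup>+v. ennreal (\<Prod>i<Suc n. g (vsnoc v x $ i)) * f (vsnoc v x) \<partial>lborel_vec n \<partial>lborel)"
    by (intro nn_integral_cong)
       (auto simp: index_vsnoc ennreal_mult gp prod_nonneg mult_ac)
  also have "\<dots> = (\<integral>\<^sup>+v. ennreal (\<Prod>i<Suc n. g (v $ i)) * f v \<partial>lborel_vec (Suc n))"
    by (rule nn_integral_lborel_vec_Suc(1)[OF m, symmetric])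
  finally show ?case .
qed

abbreviation std_normal_vec :: "nat \<Rightarrow> real vec measure" where
  "std_normal_vec \<equiv> iid_vec std_normal_distribution"

lemma prob_space_std_normal: "prob_space std_normal_distribution"
  by (rule prob_space_normal_density) simp

lemma sigma_finite_std_normal: "sigma_finite_measure std_normal_distribution"
  using prob_space_std_normal by (rule prob_space_imp_sigma_finite)

lemma prob_space_std_normal_vec: "prob_space (std_normal_vec n)"
  unfolding iid_vec_def
  by (intro prob_space.prob_space_distr prob_space_PiM prob_space_std_normal measurable_vec_iid) simp

lemma prod_std_normal_density:
  assumes "v \<in> carrier_vec n"
  shows "(\<Prod>i<n. std_normal_density (v $ i)) = exp (- (1 / 2) * (v \<bullet> v)) / sqrt ((2 * pi) ^ n)"
proof -
  have "(\<Prod>i<n. std_normal_density (v $ i)) = (\<Prod>i<n. exp (- (v $ i)\<^sup>2 / 2)) / (\<Prod>i<n. sqrt (2 * pi))"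
    by (simp add: std_normal_density_def prod_dividef)
  also have "(\<Prod>i<n. exp (- (v $ i)\<^sup>2 / 2)) = exp (\<Sum>i<n. - (v $ i)\<^sup>2 / 2)"
    by (simp add: exp_sum)
  also have "(\<Sum>i<n. - (v $ i)\<^sup>2 / 2) = - (1 / 2) * (v \<bullet> v)"
    using assms by (simp add: scalar_prod_def lessThan_atLeast0 power2_eq_square sum_divide_distrib[symmetric] sum_negf)
  also have "(\<Prod>i<n. sqrt (2 * pi)) = sqrt ((2 * pi) ^ n)"
    by (simp only: prod_constant card_lessThan real_sqrt_power)
  finally show ?thesis .
qed

text \<open>If \<open>K\<close> inverts \<open>L\<close>, then \<open>transpose_mat K * K\<close>
  inverts the covariance, and the form becomes the squared length of
  \<open>K *\<^sub>v (L *\<^sub>v y) = y\<close>.\<close>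

lemma quadratic_form_inverse:
  fixes L :: "real mat"
  assumes L: "L \<in> carrier_mat p p" "det L \<noteq> 0" and y: "y \<in> carrier_vec p"
  shows "(L *\<^sub>v y) \<bullet> (mat_inv (L * transpose_mat L) *\<^sub>v (L *\<^sub>v y)) = y \<bullet> y"
proof -
  obtain K where K: "K \<in> carrier_mat p p" "L * K = 1\<^sub>m p" "K * L = 1\<^sub>m p"
    using inverse_matE[OF L] by blast
  have tK: "transpose_mat L * transpose_mat K = 1\<^sub>m p"
    using transpose_mult[OF K(1) L(1)] K(3) by simp
  have "L * transpose_mat L * (transpose_mat K * K) = L * (transpose_mat L * transpose_mat K) * K"
    using L K by (simp add: assoc_mult_mat[of _ p p _ p _ p])
  also have "\<dots> = 1\<^sub>m p" using tK L K by simp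
  finally have inv: "mat_inv (L * transpose_mat L) = transpose_mat K * K"
    using L K by (intro mat_inv_eqI[of _ p]) auto
  have "(transpose_mat K * K) *\<^sub>v (L *\<^sub>v y) = transpose_mat K *\<^sub>v (K *\<^sub>v (L *\<^sub>v y))"
    using L K y by (intro assoc_mult_mat_vec) auto
  also have "K *\<^sub>v (L *\<^sub>v y) = (K * L) *\<^sub>v y"
    using L K y by (intro assoc_mult_mat_vec[symmetric]) auto
  also have "\<dots> = y" using K y by simp
  finally have "(L *\<^sub>v y) \<bullet> (mat_inv (L * transpose_mat L) *\<^sub>v (L *\<^sub>v y)) = (L *\<^sub>v y) \<bullet> (transpose_mat K *\<^sub>v y)"
    by (simp add: inv)
  also have "\<dots> = y \<bullet> (transpose_mat L *\<^sub>v (transpose_mat K *\<^sub>v y))"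
    using L K y by (subst comm_scalar_prod[of _ p], simp, simp)
      (subst transpose_vec_mult_scalar[of "L" p p], auto intro: comm_scalar_prod[of _ p])
  also have "transpose_mat L *\<^sub>v (transpose_mat K *\<^sub>v y) = y"
    using L K y tK by (subst assoc_mult_mat_vec[symmetric, of _ p p _ p]) auto
  finally show ?thesis .
qed

text \<open>Since the square root of \<open>det (L * transpose_mat L)\<close> is the absolute value
  of \<open>det L\<close>, the normal density at \<open>L *\<^sub>v y + \<mu>\<close> times that
  absolute value is the product of the standard normal densities of the coordinates of y. Linear
  change of variables and translation invariance do the rest.\<close>

proposition distr_std_normal_vec_affine:
  assumes L: "L \<in> carrier_mat p p" "det L \<noteq> 0" and \<mu>: "\<mu> \<in> carrier_vec p"
  shows "distr (std_normal_vec p) (borel_vec p) (\<lambda>g. L *\<^sub>v g + \<mu>) = multivariate_normal \<mu> (L * transpose_mat L)"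
    (is "?D = ?N")
proof (rule measure_eqI)
  show s: "sets ?D = sets ?N" using \<mu> by (simp add: multivariate_normal_def)
  let ?S = "L * transpose_mat L"
  fix A assume "A \<in> sets ?D"
  then have A[measurable]: "A \<in> sets (borel_vec p)" by simp
  have [measurable]: "(\<lambda>g. L *\<^sub>v g + \<mu>) \<in> measurable (borel_vec p) (borel_vec p)"
    by (rule measurable_compose[OF measurable_mult_mat_vec measurable_add_vec]) (use assms in auto)
  note [measurable] = measurable_mult_mat_vec[OF L(1)] measurable_add_vec[OF \<mu>]
  obtain K where K: "K \<in> carrier_mat p p" "L * K = 1\<^sub>m p" "K * L = 1\<^sub>m p"
    using inverse_matE[OF L] by blast
  have tK: "transpose_mat L * transpose_mat K = 1\<^sub>m p"
    using transpose_mult[OF K(1) L(1)] K(3) by simp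
  have SK: "L * transpose_mat L * (transpose_mat K * K) = L * (transpose_mat L * transpose_mat K) * K"
    using L K by (simp add: assoc_mult_mat[of _ p p _ p _ p])
  have Sinv: "mat_inv ?S = transpose_mat K * K" "mat_inv ?S \<in> carrier_mat p p"
    using L K tK SK by (auto simp: mat_inv_eqI[of _ p "transpose_mat K * K"])
  define h where "h = multivariate_normal_density \<mu> ?S"
  have minus: "(\<lambda>v. v - \<mu>) \<in> measurable (borel_vec p) (borel_vec p)"
    by (rule measurable_borel_vecI)
      (use \<mu> in \<open>auto intro!: borel_measurable_diff measurable_vec_index borel_measurable_const\<close>)
  have sp: "(\<lambda>v. v \<bullet> (mat_inv ?S *\<^sub>v v)) \<in> borel_measurable (borel_vec p)"
  proof -
    have "(\<lambda>v. \<Sum>i<p. v $ i * (mat_inv ?S *\<^sub>v v) $ i) \<in> borel_measurable (borel_vec p)"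
      by (intro borel_measurable_sum borel_measurable_times measurable_vec_index
          measurable_compose[OF measurable_mult_mat_vec[OF Sinv(2)] measurable_vec_index]) auto
    then show ?thesis
      by (rule measurable_cong[THEN iffD1, rotated])
         (use Sinv(2) in \<open>auto simp: scalar_prod_def lessThan_atLeast0 simp del: index_mult_mat_vec\<close>)
  qed
  have h[measurable]: "h \<in> borel_measurable (borel_vec p)"
    unfolding h_def multivariate_normal_density_def
    by (intro borel_measurable_divide borel_measurable_const measurable_compose[OF _ borel_measurable_exp]
       borel_measurable_times measurable_compose[OF minus sp])
  have pos: "0 \<le> h x" for x
    using L by (simp add: h_def multivariate_normal_density_def det_mult[of _ p] det_transpose)
  have dens: "ennreal \<bar>det L\<bar> * ennreal (h (L *\<^sub>v y + \<mu>)) = ennreal (\<Prod>i<p. std_normal_density (y $ i))"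
    if y: "y \<in> carrier_vec p" for y
  proof -
    have "L *\<^sub>v y + \<mu> - \<mu> = L *\<^sub>v y" using L y \<mu> by (intro eq_vecI) auto
    then have "h (L *\<^sub>v y + \<mu>) = exp (- (1 / 2) * (y \<bullet> y)) / sqrt ((2 * pi) ^ p * (det L * det L))"
      using \<mu> L quadratic_form_inverse[OF L y]
      by (simp add: h_def multivariate_normal_density_def det_mult[of _ p] det_transpose)
    also have "sqrt ((2 * pi) ^ p * (det L * det L)) = sqrt ((2 * pi) ^ p) * \<bar>det L\<bar>"
      by (simp only: real_sqrt_mult real_sqrt_mult_self)
    finally show ?thesis
      using L by (simp add: ennreal_mult[symmetric] prod_std_normal_density[OF y] pos)
  qed
  have "emeasure ?D A = (\<integral>\<^sup>+g. indicator A (L *\<^sub>v g + \<mu>) \<partial>std_normal_vec p)"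
    by (subst nn_integral_indicator[symmetric], simp, subst nn_integral_distr) auto
  also have "\<dots> = (\<integral>\<^sup>+g. ennreal (\<Prod>i<p. std_normal_density (g $ i)) * indicator A (L *\<^sub>v g + \<mu>) \<partial>lborel_vec p)"
    by (rule nn_integral_iid_vec_density) (auto intro: sigma_finite_std_normal)
  also have "\<dots> = (\<integral>\<^sup>+g. ennreal \<bar>det L\<bar> * (ennreal (h (L *\<^sub>v g + \<mu>)) * indicator A (L *\<^sub>v g + \<mu>)) \<partial>lborel_vec p)"
    by (intro nn_integral_cong) (simp add: dens[symmetric] mult.assoc)
  also have "\<dots> = ennreal \<bar>det L\<bar> * (\<integral>\<^sup>+g. ennreal (h (L *\<^sub>v g + \<mu>)) * indicator A (L *\<^sub>v g + \<mu>) \<partial>lborel_vec p)"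
    by (intro nn_integral_cmult) measurable
  also have "\<dots> = (\<integral>\<^sup>+g. ennreal (h (g + \<mu>)) * indicator A (g + \<mu>) \<partial>lborel_vec p)"
  proof -
    have "(\<lambda>g. ennreal (h (g + \<mu>)) * indicator A (g + \<mu>)) \<in> borel_measurable (borel_vec p)" by measurable
    then show ?thesis
      by (rule lborel_scalingD[OF lborel_scaling[OF L], of "\<lambda>g. ennreal (h (g + \<mu>)) * indicator A (g + \<mu>)"])
  qed
  also have "\<dots> = (\<integral>\<^sup>+g. ennreal (h g) * indicator A g \<partial>lborel_vec p)"
    by (rule nn_integral_lborel_vec_translate[where f="\<lambda>g. ennreal (h g) * indicator A g"]) (use \<mu> in measurable)
  also have "\<dots> = emeasure ?N A"
    using \<mu> by (simp add: multivariate_normal_def h_def[symmetric] emeasure_density)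
  finally show "emeasure ?D A = emeasure ?N A" .
qed

text \<open>Both \<open>Q\<close> and \<open>1\<^sub>m n\<close> factor the identity covariance, and
  the affine formula sees the linear map only through that covariance.\<close>

corollary distr_std_normal_vec_orthogonal:
  assumes Q: "Q \<in> carrier_mat n n" "Q * transpose_mat Q = 1\<^sub>m n"
  shows "distr (std_normal_vec n) (borel_vec n) (\<lambda>g. Q *\<^sub>v g) = std_normal_vec n"
proof -
  have "det Q * det Q = 1"
    using det_mult[OF Q(1), of "transpose_mat Q"] Q det_transpose[OF Q(1)] by simp
  then have d: "det Q \<noteq> 0" by auto
  have eq: "distr (std_normal_vec n) (borel_vec n) (\<lambda>g. A *\<^sub>v g + 0\<^sub>v n) = distr (std_normal_vec n) (borel_vec n) (\<lambda>g. A *\<^sub>v g)"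
    if "A \<in> carrier_mat n n" for A
    using that by (intro distr_cong) auto
  have "distr (std_normal_vec n) (borel_vec n) (\<lambda>g. Q *\<^sub>v g) = distr (std_normal_vec n) (borel_vec n) (\<lambda>g. 1\<^sub>m n *\<^sub>v g)"
    using distr_std_normal_vec_affine[OF Q(1) d, of "0\<^sub>v n"] distr_std_normal_vec_affine[of "1\<^sub>m n" n "0\<^sub>v n"] Q
    by (simp add: eq)
  also have "\<dots> = distr (std_normal_vec n) (std_normal_vec n) (\<lambda>g. g)"
    by (intro distr_cong) auto
  finally show ?thesis by (simp add: distr_id)
qed

section \<open>Gram determinants\<close>

text \<open>Lists instead of matrices, since vectors are adjoined, permuted and removed one at a
  time.\<close>

definition gram :: "real vec list \<Rightarrow> real mat" where
  "gram vs = mat (length vs) (length vs) (\<lambda>(i, j). vs ! i \<bullet> vs ! j)"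

definition gram_det :: "real vec list \<Rightarrow> real" where
  "gram_det vs = det (gram vs)"

lemma gram_carrier [simp]: "gram vs \<in> carrier_mat (length vs) (length vs)"
  by (simp add: gram_def)

lemma gram_det_Nil [simp]: "gram_det [] = 1"
  by (simp add: gram_det_def gram_def det_dim_zero)

lemma gram_det_cong:
  assumes "length vs = length ws"
    and "\<And>i j. i < length vs \<Longrightarrow> j < length vs \<Longrightarrow> vs ! i \<bullet> vs ! j = ws ! i \<bullet> ws ! j"
  shows "gram_det vs = gram_det ws"
proof -
  have "gram vs = gram ws" using assms by (auto simp: gram_def intro!: eq_matI)
  then show ?thesis by (simp add: gram_det_def)
qed

text \<open>Permuting the list permutes both the rows and the columns of the Gram matrix, so the
  sign of the permutation enters twice and squares to 1.\<close>

lemma gram_det_mset: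
  assumes "mset vs = mset ws"
  shows "gram_det vs = gram_det ws"
proof -
  obtain \<pi> where \<pi>: "\<pi> permutes {..<length ws}" "permute_list \<pi> ws = vs"
    using mset_eq_permutation[OF assms] by blast
  let ?n = "length ws"
  let ?A = "gram ws"
  let ?B = "mat ?n ?n (\<lambda>(i, j). transpose_mat ?A $$ (\<pi> i, j))"
  have \<pi>': "\<pi> permutes {0..<?n}" using \<pi>(1) by (simp add: lessThan_atLeast0)
  have len: "length vs = ?n" using \<pi> by auto
  have lt: "\<pi> i < ?n" if "i < ?n" for i using \<pi>(1) that permutes_in_image[of \<pi> "{..<?n}" i] by auto
  have "gram vs = mat ?n ?n (\<lambda>(i, j). (transpose_mat ?B) $$ (\<pi> i, j))"
  proof (intro eq_matI, goal_cases)
    case (1 i j)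
    then have ij: "i < ?n" "j < ?n" by auto
    have "vs ! i = ws ! \<pi> i" "vs ! j = ws ! \<pi> j"
      using ij \<pi> permute_list_nth[OF \<pi>(1)] by auto
    then show ?case using ij lt len by (simp add: gram_def)
  qed (use len in \<open>auto simp: gram_def\<close>)
  also have "det \<dots> = signof \<pi> * det (transpose_mat ?B)"
    by (rule det_permute_rows) (use \<pi>' in auto)
  also have "det (transpose_mat ?B) = signof \<pi> * det (transpose_mat ?A)"
    by (subst det_transpose[of _ ?n], simp, rule det_permute_rows) (use \<pi>' in auto)
  also have "det (transpose_mat ?A) = det ?A"
    by (rule det_transpose) (rule gram_carrier)
  finally show ?thesis
    by (cases \<pi> rule: sign_cases) (simp_all add: gram_det_def)
qed

lemma gram_mat_rows:
  assumes "F \<in> carrier_mat k n"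
  shows "gram (rows F) = F * transpose_mat F"
  using assms by (intro eq_matI) (auto simp: gram_def)

lemma gram_det_rows_mult:
  assumes F: "F \<in> carrier_mat k n" and T: "T \<in> carrier_mat k k"
  shows "gram_det (rows (T * F)) = (det T)\<^sup>2 * gram_det (rows F)"
proof -
  have TF: "T * F \<in> carrier_mat k n" using F T by auto
  have "(T * F) * transpose_mat (T * F) = T * (F * transpose_mat F) * transpose_mat T"
    using F T by (simp add: transpose_mult[OF T F] assoc_mult_mat[of _ k k _ k _ k] assoc_mult_mat[of _ k k _ n _ k]
       assoc_mult_mat[of _ k n _ k _ k])
  then show ?thesis
    unfolding gram_det_def gram_mat_rows[OF TF] gram_mat_rows[OF F]
    using F T by (simp add: det_mult[of _ k] det_transpose power2_eq_square mult_ac)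
qed

lemma scalar_prod_vsnoc:
  assumes "v \<in> carrier_vec n" "w \<in> carrier_vec n"
  shows "vsnoc v x \<bullet> vsnoc w y = v \<bullet> w + x * y"
  unfolding vsnoc_def using assms
  by (subst scalar_prod_append[of _ n _ 1]) (auto simp: scalar_prod_def)

text \<open>Elimination with the pivot \<open>c^2\<close> of the axis vector cancels exactly the
  products of last coordinates, which leaves the Gram matrix of the projections along that
  axis.\<close>

lemma gram_det_snoc_axis:
  assumes a: "\<And>v. v \<in> set vs \<Longrightarrow> a v \<in> carrier_vec m" and c: "c \<noteq> 0"
  shows "gram_det (map (\<lambda>v. vsnoc (a v) (l v)) vs @ [vsnoc (0\<^sub>v m) c]) = c\<^sup>2 * gram_det (map a vs)"
proof -
  let ?k = "length vs"
  let ?A = "mat ?k ?k (\<lambda>(i, j). a (vs ! i) \<bullet> a (vs ! j) + l (vs ! i) * l (vs ! j))"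
  let ?B = "mat ?k 1 (\<lambda>(i, j). c * l (vs ! i))"
  let ?C = "mat 1 ?k (\<lambda>(i, j). c * l (vs ! j))"
  let ?D = "mat 1 1 (\<lambda>(i, j). c\<^sup>2)"
  let ?Di = "mat 1 1 (\<lambda>(i, j). 1 / c\<^sup>2)"
  let ?ws = "map (\<lambda>v. vsnoc (a v) (l v)) vs @ [vsnoc (0\<^sub>v m) c]"
  have an: "a (vs ! i) \<in> carrier_vec m" if "i < ?k" for i using a that by auto
  have "gram ?ws = four_block_mat ?A ?B ?C ?D"
    by (intro eq_matI)
       (auto simp: gram_def nth_append scalar_prod_vsnoc[of _ m] an power2_eq_square less_Suc_eq)
  moreover have "det (four_block_mat ?A ?B ?C ?D) = det (?A - ?B * ?Di * ?C) * det ?D"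
    by (rule det_four_block_schur) (use c in \<open>auto intro!: eq_matI simp: scalar_prod_def\<close>)
  moreover have "?A - ?B * ?Di * ?C = gram (map a vs)"
    using c by (intro eq_matI) (auto simp: gram_def scalar_prod_def power2_eq_square)
  moreover have "det ?D = c\<^sup>2" by (subst det_single) auto
  ultimately show ?thesis by (simp add: gram_det_def)
qed

section \<open>Reduction of Gram determinants by rotations\<close>

lemma orthogonal_scalar_prod:
  fixes Q :: "real mat"
  assumes Q: "Q \<in> carrier_mat n n" "Q * transpose_mat Q = 1\<^sub>m n"
    and v: "v \<in> carrier_vec n" and w: "w \<in> carrier_vec n"
  shows "(Q *\<^sub>v v) \<bullet> (Q *\<^sub>v w) = v \<bullet> w"
proof -
  have QQ: "transpose_mat Q * Q = 1\<^sub>m n"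
    by (rule mat_mult_left_right_inverse[OF Q(1) _ Q(2)]) (use Q in auto)
  have "(Q *\<^sub>v v) \<bullet> (Q *\<^sub>v w) = (transpose_mat Q *\<^sub>v (Q *\<^sub>v v)) \<bullet> w"
    by (rule transpose_vec_mult_scalar[symmetric, of Q n n]) (use assms in auto)
  also have "transpose_mat Q *\<^sub>v (Q *\<^sub>v v) = v"
    using assms QQ by (subst assoc_mult_mat_vec[symmetric, of _ n n _ n]) auto
  finally show ?thesis .
qed

lemma scalar_prod_self_eq_0:
  fixes v :: "real vec"
  assumes v: "v \<in> carrier_vec n" and "v \<bullet> v = 0"
  shows "v = 0\<^sub>v n"
proof (rule eq_vecI)
  have "(\<Sum>i = 0..<n. v $ i * v $ i) = 0" using assms by (simp add: scalar_prod_def)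
  then have "\<forall>i\<in>{0..<n}. v $ i * v $ i = 0"
    by (subst (asm) sum_nonneg_eq_0_iff) auto
  then show "v $ i = 0\<^sub>v n $ i" if "i < dim_vec (0\<^sub>v n)" for i using that by auto
qed (use v in simp)

text \<open>The reflection that exchanges \<open>z\<close> with the vector \<open>e\<close> of the
  same length on the last axis, in the hyperplane orthogonal to \<open>w = z - e\<close>. If the two
  vectors coincide, the identity is taken.\<close>

lemma householder:
  fixes z :: "real vec"
  assumes z: "z \<in> carrier_vec (Suc m)"
  obtains Q where "Q \<in> carrier_mat (Suc m) (Suc m)" "Q * transpose_mat Q = 1\<^sub>m (Suc m)"
    "Q *\<^sub>v z = vsnoc (0\<^sub>v m) (sqrt (z \<bullet> z))"
proof -
  let ?n = "Suc m"
  define c where "c = sqrt (z \<bullet> z)"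
  define e where "e = vsnoc (0\<^sub>v m) c"
  define w where "w = z - e"
  have zz: "z \<bullet> z \<ge> 0" unfolding scalar_prod_def by (intro sum_nonneg) auto
  have e: "e \<in> carrier_vec ?n" by (simp add: e_def vsnoc_carrier)
  have w: "w \<in> carrier_vec ?n" using z e by (simp add: w_def)
  show ?thesis
  proof (cases "w \<bullet> w = 0")
    case True
    then have "w = 0\<^sub>v ?n" using scalar_prod_self_eq_0[OF w] by simp
    then have "z $ i = e $ i" if "i < ?n" for i
      using that e z unfolding w_def by (metis index_minus_vec(1) index_zero_vec(1) carrier_vecD right_minus_eq)
    then have "z = e" using z e by (intro eq_vecI) auto
    then show ?thesis
      using z by (intro that[of "1\<^sub>m ?n"]) (auto simp: e_def c_def)
  next
    case False
    define s where "s = w \<bullet> w"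
    define Q where "Q = mat ?n ?n (\<lambda>(i, j). (if i = j then 1 else 0) - 2 / s * (w $ i * w $ j))"
    have Q: "Q \<in> carrier_mat ?n ?n" by (simp add: Q_def)
    have ssum: "s = (\<Sum>k<?n. w $ k * w $ k)"
      using w by (simp add: s_def scalar_prod_def lessThan_atLeast0)
    have Qt: "transpose_mat Q = Q" by (intro eq_matI) (auto simp: Q_def)
    have "Q * Q = 1\<^sub>m ?n"
    proof (intro eq_matI, goal_cases)
      case (1 i j)
      then have ij: "i < ?n" "j < ?n" by auto
      \<comment> \<open>The coefficient of the squares of the coordinates of w in the product of the
        two rank-one parts; those squares sum to s, and \<open>c * s\<close> cancels the two cross
        terms.\<close>
      define c where "c = 4 / s\<^sup>2 * (w $ i * w $ j)"
      have "(Q * Q) $$ (i, j) = (\<Sum>k<?n. Q $$ (i, k) * Q $$ (k, j))"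
        using Q ij by (simp add: scalar_prod_def lessThan_atLeast0)
      also have "\<dots> = (\<Sum>k<?n. (if k = i then (if i = j then 1 else 0) - 2 / s * (w $ i * w $ j) else 0)
           - (if k = j then 2 / s * (w $ i * w $ j) else 0) + c * (w $ k * w $ k))"
        using ij by (intro sum.cong) (auto simp: Q_def c_def algebra_simps power2_eq_square)
      also have "\<dots> = (if i = j then 1 else 0) - 2 / s * (w $ i * w $ j) - 2 / s * (w $ i * w $ j)
           + c * s"
        using ij unfolding sum.distrib sum_subtractf sum_distrib_left[symmetric] ssum[symmetric]
        by (simp del: sum.lessThan_Suc)
      also have "\<dots> = (if i = j then 1 else 0)"
        using False by (simp add: c_def power2_eq_square s_def)
      finally show ?case using ij by simp
    qed (use Q in auto)
    moreover have "Q *\<^sub>v z = e"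
    proof -
      have ze: "z \<bullet> e = e \<bullet> z" using comm_scalar_prod[OF z e] .
      have ee: "e \<bullet> e = z \<bullet> z"
        using zz by (simp add: e_def scalar_prod_vsnoc[of _ m] c_def)
      have "s = z \<bullet> z - e \<bullet> z - (e \<bullet> z - e \<bullet> e)"
        using z e unfolding s_def w_def
        by (simp add: minus_scalar_prod_distrib[of _ ?n] scalar_prod_minus_distrib[of _ ?n] ze)
      moreover have "w \<bullet> z = z \<bullet> z - e \<bullet> z"
        unfolding w_def using z e by (simp add: minus_scalar_prod_distrib[of _ ?n])
      \<comment> \<open>Equality of the lengths of \<open>z\<close> and \<open>e\<close> enters
        here; it makes the reflection subtract exactly one copy of \<open>w\<close> from
        \<open>z\<close>.\<close>
      ultimately have s2: "s = 2 * (w \<bullet> z)" using ee by simp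
      have Qv: "(Q *\<^sub>v z) $ i = z $ i - 2 / s * (w \<bullet> z) * w $ i" if i: "i < ?n" for i
      proof -
        have "(Q *\<^sub>v z) $ i = (\<Sum>k<?n. Q $$ (i, k) * z $ k)"
          using Q i z by (simp add: scalar_prod_def lessThan_atLeast0)
        also have "\<dots> = (\<Sum>k<?n. (if k = i then z $ i else 0) - 2 / s * w $ i * (w $ k * z $ k))"
          using i by (intro sum.cong) (auto simp: Q_def algebra_simps)
        also have "\<dots> = z $ i - 2 / s * w $ i * (\<Sum>k<?n. w $ k * z $ k)"
          using i by (simp add: sum_subtractf sum_distrib_left del: sum.lessThan_Suc)
        also have "(\<Sum>k<?n. w $ k * z $ k) = w \<bullet> z"
          using w z by (simp add: scalar_prod_def lessThan_atLeast0)
        finally show ?thesis by (simp add: mult_ac)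
      qed
      have "2 / s * (w \<bullet> z) = 1" using s2 False by (simp add: s_def field_simps)
      then have Qi: "(Q *\<^sub>v z) $ i = z $ i - w $ i" if "i < ?n" for i using Qv[OF that] by simp
      then show ?thesis
        using Q z e by (intro eq_vecI) (auto simp: w_def simp del: index_mult_mat_vec)
    qed
    ultimately show ?thesis
      using Q Qt by (intro that[of Q]) (auto simp: e_def c_def)
  qed
qed

lemma vsnoc_vec_first:
  assumes "v \<in> carrier_vec (Suc m)"
  shows "v = vsnoc (vec_first v m) (v $ m)"
  using assms by (intro eq_vecI) (auto simp: index_vsnoc vec_first_def less_Suc_eq)

text \<open>Rotating \<open>z\<close> onto the last axis leaves all scalar products unchanged, and
  dropping that axis costs only the factor of its squared length. The inductions below use this to
  shorten the list and to lower the dimension together.\<close>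

lemma gram_det_snoc_reduce:
  assumes z: "z \<in> carrier_vec (Suc m)" "z \<bullet> z \<noteq> 0"
    and Q: "Q \<in> carrier_mat (Suc m) (Suc m)" "Q * transpose_mat Q = 1\<^sub>m (Suc m)"
    and Qz: "Q *\<^sub>v z = vsnoc (0\<^sub>v m) (sqrt (z \<bullet> z))"
    and vs: "set vs \<subseteq> carrier_vec (Suc m)"
  shows "gram_det (vs @ [z]) = z \<bullet> z * gram_det (map (\<lambda>v. vec_first (Q *\<^sub>v v) m) vs)"
proof -
  have zz: "z \<bullet> z \<ge> 0" unfolding scalar_prod_def by (intro sum_nonneg) auto
  have nth: "(vs @ [z]) ! i \<in> carrier_vec (Suc m)" if "i < Suc (length vs)" for i
    using that z vs by (auto simp: nth_append less_Suc_eq)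
  have "gram_det (vs @ [z]) = gram_det (map (\<lambda>v. Q *\<^sub>v v) (vs @ [z]))"
    using nth by (intro gram_det_cong) (auto simp del: map_append simp: orthogonal_scalar_prod[OF Q])
  also have "map (\<lambda>v. Q *\<^sub>v v) (vs @ [z]) =
     map (\<lambda>v. vsnoc (vec_first (Q *\<^sub>v v) m) ((Q *\<^sub>v v) $ m)) vs @ [vsnoc (0\<^sub>v m) (sqrt (z \<bullet> z))]"
    using Q vs by (auto simp: Qz simp del: index_mult_mat_vec intro!: vsnoc_vec_first)
  also have "gram_det \<dots> = (sqrt (z \<bullet> z))\<^sup>2 * gram_det (map (\<lambda>v. vec_first (Q *\<^sub>v v) m) vs)"
    by (rule gram_det_snoc_axis) (use z zz in auto)
  finally show ?thesis using zz by simp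
qed

lemma gram_det_zero_last:
  assumes z: "z \<in> carrier_vec n" "z \<bullet> z = 0" and vs: "set vs \<subseteq> carrier_vec n"
  shows "gram_det (vs @ [z]) = 0"
proof -
  have z0: "z = 0\<^sub>v n" using scalar_prod_self_eq_0[OF z] .
  have nth: "(vs @ [z]) ! i \<in> carrier_vec n" if "i < Suc (length vs)" for i
    using that z vs by (auto simp: nth_append less_Suc_eq)
  have "gram (vs @ [z]) *\<^sub>v unit_vec (Suc (length vs)) (length vs) = 0\<^sub>v (Suc (length vs))"
    using z z0 nth
    by (intro eq_vecI) (auto simp: gram_def scalar_prod_right_unit)
  then show ?thesis unfolding gram_det_def
    by (subst det_0_iff_vec_prod_zero[of _ "Suc (length vs)"])
       (auto simp: gram_def intro!: exI[of _ "unit_vec (Suc (length vs)) (length vs)"])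
qed

lemma set_vec_first_carrier: "set (map (\<lambda>v. vec_first (Q *\<^sub>v v) m) vs) \<subseteq> carrier_vec m"
  by auto

lemma carrier_vec_pos_dim:
  assumes "z \<in> carrier_vec n" "z \<bullet> z \<noteq> (0 :: real)"
  obtains m where "n = Suc m"
  using assms by (cases n) (auto simp: scalar_prod_def)

text \<open>The induction is on the length, with arbitrary dimension, because the reduced vectors
  are projections and not members of the list.\<close>

lemma gram_det_nonneg:
  assumes "set vs \<subseteq> carrier_vec n"
  shows "gram_det vs \<ge> 0"
  using assms
proof (induction vs arbitrary: n rule: length_induct)
  case (1 vs)
  show ?case
  proof (cases vs rule: rev_cases)
    case (snoc ws z)
    then have z: "z \<in> carrier_vec n" and ws: "set ws \<subseteq> carrier_vec n" using 1 by auto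
    show ?thesis
    proof (cases "z \<bullet> z = 0")
      case True
      then show ?thesis using gram_det_zero_last[OF z _ ws] snoc by simp
    next
      case False
      obtain m where n: "n = Suc m" using carrier_vec_pos_dim[OF z False] .
      obtain Q where Q: "Q \<in> carrier_mat n n" "Q * transpose_mat Q = 1\<^sub>m n"
        "Q *\<^sub>v z = vsnoc (0\<^sub>v m) (sqrt (z \<bullet> z))"
        using householder[of z m] z unfolding n by blast
      have "gram_det (map (\<lambda>v. vec_first (Q *\<^sub>v v) m) ws) \<ge> 0"
        using 1(1)[rule_format, OF _ set_vec_first_carrier[of Q m ws]] snoc by simp
      moreover have "z \<bullet> z \<ge> 0" unfolding scalar_prod_def by (intro sum_nonneg) auto
      ultimately show ?thesis
        using gram_det_snoc_reduce[of z m Q ws] z ws Q False snoc unfolding n by simp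
    qed
  qed simp
qed

text \<open>A subfamily of a linearly independent family is independent. Peeling vectors off the
  common end reduces both Gram determinants by the same rotation and the same nonzero
  factor.\<close>

lemma gram_det_suffix_nonzero:
  assumes "set as \<subseteq> carrier_vec n" "set bs \<subseteq> carrier_vec n" "gram_det (as @ bs) \<noteq> 0"
  shows "gram_det bs \<noteq> 0"
  using assms
proof (induction bs arbitrary: as n rule: length_induct)
  case (1 bs)
  show ?case
  proof (cases bs rule: rev_cases)
    case (snoc ws z)
    then have z: "z \<in> carrier_vec n" and ws: "set ws \<subseteq> carrier_vec n" and as: "set as \<subseteq> carrier_vec n" using 1 by auto
    have zz: "z \<bullet> z \<noteq> 0"
      using gram_det_zero_last[OF z, of "as @ ws"] 1(4) snoc ws as by auto
    obtain m where n: "n = Suc m" using carrier_vec_pos_dim[OF z zz] .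
    obtain Q where Q: "Q \<in> carrier_mat n n" "Q * transpose_mat Q = 1\<^sub>m n"
      "Q *\<^sub>v z = vsnoc (0\<^sub>v m) (sqrt (z \<bullet> z))"
      using householder[of z m] z unfolding n by blast
    let ?r = "map (\<lambda>v. vec_first (Q *\<^sub>v v) m)"
    have "gram_det (as @ bs) = z \<bullet> z * gram_det (?r as @ ?r ws)"
      using gram_det_snoc_reduce[of z m Q "as @ ws"] z ws as Q zz snoc unfolding n by simp
    then have "gram_det (?r as @ ?r ws) \<noteq> 0" using 1(4) by auto
    then have "gram_det (?r ws) \<noteq> 0"
      using 1(1) snoc set_vec_first_carrier[of Q m as] set_vec_first_carrier[of Q m ws]
      by (metis length_append_singleton length_map lessI)
    then show ?thesis
      using gram_det_snoc_reduce[of z m Q ws] z ws Q zz snoc unfolding n by simp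
  qed simp
qed

section \<open>Length and direction of a standard normal vector\<close>

lemma borel_measurable_scalar_prod:
  assumes f: "f \<in> measurable N (borel_vec n)" and g: "g \<in> measurable N (borel_vec n)"
  shows "(\<lambda>w. f w \<bullet> g w) \<in> borel_measurable N"
proof -
  have "(\<lambda>w. \<Sum>i<n. f w $ i * g w $ i) \<in> borel_measurable N"
    by (intro borel_measurable_sum borel_measurable_times measurable_compose[OF f measurable_vec_index]
          measurable_compose[OF g measurable_vec_index]) auto
  then show ?thesis
  proof (rule measurable_cong[THEN iffD1, rotated])
    fix w assume "w \<in> space N"
    then have "g w \<in> carrier_vec n" using measurable_space[OF g] by auto
    then show "(\<Sum>i<n. f w $ i * g w $ i) = f w \<bullet> g w" by (simp add: scalar_prod_def lessThan_atLeast0)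
  qed
qed

lemma borel_measurable_sqnorm: "(\<lambda>v. v \<bullet> v) \<in> borel_measurable (borel_vec n)"
  by (rule borel_measurable_scalar_prod[of "\<lambda>v. v" _ n "\<lambda>v. v"]) auto

lemma borel_measurable_cis [measurable (raw)]:
  assumes "f \<in> borel_measurable M"
  shows "(\<lambda>x. cis (f x)) \<in> borel_measurable M"
  by (rule measurable_compose[OF assms borel_measurable_continuous_onI]) (intro continuous_intros)

section \<open>Homogeneous measures on the real line\<close>

lemma homogeneous_measure_atMost_zero:
  fixes N :: "real measure"
  assumes a: "a > 0" and s: "sets N = sets borel"
    and hom: "\<And>r. r > 0 \<Longrightarrow> emeasure N {..r} = ennreal (r powr a) * emeasure N {..1}"
    and fin: "emeasure N {..1} \<noteq> \<infinity>" and r: "r \<le> 0"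
  shows "emeasure N {..r} = 0"
proof -
  obtain \<nu> where \<nu>: "emeasure N {..1} = ennreal \<nu>" "\<nu> \<ge> 0"
    using fin by (cases "emeasure N {..1}") auto
  have "(\<lambda>n. ennreal ((1 / real (Suc n)) powr a * \<nu>)) \<longlonglongrightarrow> ennreal (0 * \<nu>)"
    using a by (intro tendsto_ennrealI tendsto_mult tendsto_const) real_asymp
  moreover have "emeasure N {..r} \<le> ennreal ((1 / real (Suc n)) powr a * \<nu>)" for n
  proof -
    have "emeasure N {..r} \<le> emeasure N {..1 / real (Suc n)}"
      using r s by (intro emeasure_mono) (auto intro: order_trans)
    then show ?thesis using hom[of "1 / real (Suc n)"] \<nu> by (simp add: ennreal_mult)
  qed
  ultimately have "emeasure N {..r} \<le> ennreal (0 * \<nu>)"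
    by (intro LIMSEQ_le_const) auto
  then show ?thesis by simp
qed

text \<open>Homogeneity determines all half-lines from the one ending at 1, the half-lines with end
  point at most 0 being null, and half-lines generate the Borel sets. The constant is the quotient
  of the two masses at 1.\<close>

lemma homogeneous_measure_unique:
  fixes N P :: "real measure"
  assumes a: "a > 0" and sN: "sets N = sets borel" and sP: "sets P = sets borel"
    and N: "\<And>r. r > 0 \<Longrightarrow> emeasure N {..r} = ennreal (r powr a) * emeasure N {..1}"
    and P: "\<And>r. r > 0 \<Longrightarrow> emeasure P {..r} = ennreal (r powr a) * emeasure P {..1}"
    and fin: "emeasure N {..1} \<noteq> \<infinity>" "emeasure P {..1} \<noteq> \<infinity>" and nz: "emeasure P {..1} \<noteq> 0"
  obtains c where "N = scale_measure c P"
proof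
  let ?c = "emeasure N {..1} / emeasure P {..1}"
  have c: "?c * emeasure P {..1} = emeasure N {..1}"
    using fin nz by (simp add: ennreal_divide_times ennreal_divide_self top.not_eq_extremum)
  show "N = scale_measure ?c P"
  proof (rule measure_eqI_generator_eq[where E = "range atMost" and \<Omega> = UNIV and A = "\<lambda>i. {..real i}"])
    show "Int_stable (range atMost :: real set set)" by (auto simp: Int_stable_def)
    show "sets N = sigma_sets UNIV (range atMost)" "sets (scale_measure ?c P) = sigma_sets UNIV (range atMost)"
      using sN sP by (auto simp: borel_eq_atMost)
    show "(\<Union>i. {..real i}) = UNIV" by (auto simp: real_arch_simple)
    fix i show "emeasure N {..real i} \<noteq> \<infinity>"
      using N[of "real i"] homogeneous_measure_atMost_zero[OF a sN N fin(1), of "real i"] fin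
      by (cases "i = 0") (auto simp: ennreal_mult_eq_top_iff)
  next
    fix X :: "real set" assume "X \<in> range atMost"
    then obtain r where X: "X = {..r}" by auto
    show "emeasure N X = emeasure (scale_measure ?c P) X"
    proof (cases "r > 0")
      case True
      then show ?thesis unfolding X emeasure_scale_measure
        by (simp only: N[OF True] P[OF True] mult.left_commute[of ?c] c)
    next
      case False
      then show ?thesis unfolding X
        using homogeneous_measure_atMost_zero[OF a sN N fin(1), of r] homogeneous_measure_atMost_zero[OF a sP P fin(2), of r]
        by simp
    qed
  qed auto
qed

definition powr_measure :: "real \<Rightarrow> real measure" where
  "powr_measure a = density lborel (\<lambda>r. ennreal (indicator {0..} r * r powr (a - 1)))"

definition gamma_measure :: "real \<Rightarrow> real measure" where
  "gamma_measure a = density lborel (\<lambda>r. ennreal (indicator {0..} r * r powr (a - 1) / exp r / Gamma a))"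

lemma emeasure_powr_measure_atMost:
  assumes a: "a > 0"
  shows "r > 0 \<Longrightarrow> emeasure (powr_measure a) {..r} = ennreal (r powr a) * emeasure (powr_measure a) {..1}"
    and "emeasure (powr_measure a) {..1} \<noteq> \<infinity>"
    and "emeasure (powr_measure a) {..1} \<noteq> 0"
proof -
  have e: "emeasure (powr_measure a) {..r} = (\<integral>\<^sup>+x. ennreal (indicator {0..} x * x powr (a - 1)) * indicator {..r} x \<partial>lborel)" for r
    unfolding powr_measure_def by (intro emeasure_density) auto
  show "emeasure (powr_measure a) {..r} = ennreal (r powr a) * emeasure (powr_measure a) {..1}" if r: "r > 0"
  proof -
    have "emeasure (powr_measure a) {..r} =
       ennreal r * (\<integral>\<^sup>+x. ennreal (indicator {0..} (r * x) * (r * x) powr (a - 1)) * indicator {..r} (r * x) \<partial>lborel)"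
      unfolding e using r by (subst nn_integral_real_affine[where c = r and t = 0]) auto
    also have "\<dots> = ennreal r * (\<integral>\<^sup>+x. ennreal (r powr (a - 1)) * (ennreal (indicator {0..} x * x powr (a - 1)) * indicator {..1} x) \<partial>lborel)"
    proof (rule arg_cong[where f = "(*) (ennreal r)"], rule nn_integral_cong)
      fix x :: real
      have "indicator {..r} (r * x) = (indicator {..1} x :: ennreal)"
        using r by (simp add: indicator_def)
      moreover have "indicator {0..} (r * x) * (r * x) powr (a - 1) = r powr (a - 1) * (indicator {0..} x * x powr (a - 1))"
        using r by (auto simp: indicator_def powr_mult zero_le_mult_iff)
      ultimately show "ennreal (indicator {0..} (r * x) * (r * x) powr (a - 1)) * indicator {..r} (r * x) =
          ennreal (r powr (a - 1)) * (ennreal (indicator {0..} x * x powr (a - 1)) * indicator {..1} x)"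
        by (simp only: ennreal_mult'' ennreal_mult mult.assoc powr_ge_zero indicator_pos_le mult_nonneg_nonneg)
    qed
    also have "\<dots> = ennreal r * (ennreal (r powr (a - 1)) * emeasure (powr_measure a) {..1})"
      unfolding e by (subst nn_integral_cmult) auto
    also have "ennreal r * (ennreal (r powr (a - 1)) * emeasure (powr_measure a) {..1}) = ennreal (r * r powr (a - 1)) * emeasure (powr_measure a) {..1}"
      using r by (simp add: ennreal_mult mult.assoc)
    also have "r * r powr (a - 1) = r powr a" using r by (simp add: powr_diff)
    finally show ?thesis .
  qed
  \<comment> \<open>On [0,1] the factor \<open>exp 1 / exp x\<close> is at least 1, so the Gamma
    integral dominates.\<close>
  have "emeasure (powr_measure a) {..1} \<le> (\<integral>\<^sup>+x. ennreal (exp 1) * ennreal (indicator {0..} x * x powr (a - 1) / exp x) \<partial>lborel)"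
    unfolding e
    by (intro nn_integral_mono) (auto simp: indicator_def ennreal_mult[symmetric] field_simps intro!: ennreal_leI mult_right_mono)
  also have "\<dots> = ennreal (exp 1) * ennreal (Gamma a)"
    by (subst nn_integral_cmult) (auto simp: Gamma_conv_nn_integral_real[OF a])
  also have "\<dots> < \<infinity>" by (simp add: ennreal_mult_less_top)
  finally show "emeasure (powr_measure a) {..1} \<noteq> \<infinity>" by simp
  \<comment> \<open>Positivity is read off on [1/2, 1], where the density is bounded below whatever
    the sign of a - 1.\<close>
  have "ennreal ((1/2) powr a) * emeasure lborel {1/2..1::real} \<le> emeasure (powr_measure a) {..1}"
    unfolding e
  proof (subst nn_integral_cmult_indicator[symmetric], simp, intro nn_integral_mono)
    fix x :: real
    have "(1/2) powr a \<le> x powr (a - 1)" if "1/2 \<le> x" "x \<le> 1"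
    proof -
      have "(1/2) powr a \<le> x powr a" using that a by (intro powr_mono2) auto
      also have "\<dots> \<le> x powr (a - 1)" using that by (intro powr_mono') auto
      finally show ?thesis .
    qed
    then show "ennreal ((1/2) powr a) * indicator {1/2..1} x \<le> ennreal (indicator {0..} x * x powr (a - 1)) * indicator {..1} x"
      by (auto simp: indicator_def intro!: ennreal_leI)
  qed
  moreover have "0 < ennreal ((1/2) powr a) * emeasure lborel {1/2..1::real}"
  proof -
    have e: "emeasure lborel {1/2..1::real} = ennreal (1 - 1/2)" by (rule emeasure_lborel_Icc) simp
    have "0 < ennreal ((1/2) powr a * (1 - 1/2))" by (rule ennreal_less_zero_iff[THEN iffD2]) simp
    then show ?thesis unfolding e by (subst ennreal_mult[symmetric]) simp_all
  qed
  ultimately show "emeasure (powr_measure a) {..1} \<noteq> 0" by auto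
qed

lemma prob_space_gamma_measure:
  assumes "a > 0"
  shows "prob_space (gamma_measure a)"
proof
  have G: "Gamma a > 0" using assms by (rule Gamma_real_pos)
  have "emeasure (gamma_measure a) (space (gamma_measure a)) = (\<integral>\<^sup>+x. ennreal (1 / Gamma a) * ennreal (indicator {0..} x * x powr (a - 1) / exp x) \<partial>lborel)"
    unfolding gamma_measure_def using G
    by (subst emeasure_density) (auto intro!: nn_integral_cong simp: ennreal_mult[symmetric])
  also have "\<dots> = ennreal (1 / Gamma a) * ennreal (Gamma a)"
    by (subst nn_integral_cmult) (auto simp: Gamma_conv_nn_integral_real[OF assms])
  also have "\<dots> = 1" using G by (simp add: ennreal_mult[symmetric])
  finally show "emeasure (gamma_measure a) (space (gamma_measure a)) = 1" .
qed

lemma nn_integral_std_normal_vec: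
  assumes "f \<in> borel_measurable (borel_vec n)"
  shows "(\<integral>\<^sup>+v. f v \<partial>std_normal_vec n) = (\<integral>\<^sup>+v. ennreal (exp (- (v \<bullet> v / 2)) / sqrt ((2 * pi) ^ n)) * f v \<partial>lborel_vec n)"
  by (subst nn_integral_iid_vec_density)
     (use assms in \<open>auto intro!: sigma_finite_std_normal nn_integral_cong simp: prod_std_normal_density\<close>)

text \<open>
  The push-forward of \<open>f dv\<close> under \<open>v \<mapsto> v \<bullet> v / 2\<close> is homogeneous of degree \<open>n / 2\<close>, hence a multiple
  of \<open>r powr (n / 2 - 1) dr\<close>: directions are independent of the length, and the length is
  gamma distributed.
\<close>

proposition std_normal_vec_radial:
  fixes f :: "real vec \<Rightarrow> ennreal" and h :: "real \<Rightarrow> ennreal"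
  assumes n: "n > 0" and f[measurable]: "f \<in> borel_measurable (borel_vec n)" and f1: "\<And>v. f v \<le> 1"
    and hom: "\<And>c v. c > 0 \<Longrightarrow> v \<in> carrier_vec n \<Longrightarrow> f (c \<cdot>\<^sub>v v) = f v"
    and h[measurable]: "h \<in> borel_measurable borel"
  shows "(\<integral>\<^sup>+v. f v * h (v \<bullet> v / 2) \<partial>std_normal_vec n) =
    (\<integral>\<^sup>+v. f v \<partial>std_normal_vec n) * (\<integral>\<^sup>+r. h r \<partial>gamma_measure (real n / 2))"
proof -
  define a where "a = real n / 2"
  have a: "a > 0" using n by (simp add: a_def)
  have G: "Gamma a > 0" using a by (rule Gamma_real_pos)
  define K where "K = sqrt ((2 * pi) ^ n)"
  have K: "K > 0" by (simp add: K_def)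
  have [measurable]: "(\<lambda>v. v \<bullet> v) \<in> borel_measurable (borel_vec n)"
    by (rule borel_measurable_sqnorm)
  define N where "N = distr (density (lborel_vec n) f) borel (\<lambda>v. v \<bullet> v / 2)"
  have nnN: "(\<integral>\<^sup>+r. g r \<partial>N) = (\<integral>\<^sup>+v. f v * g (v \<bullet> v / 2) \<partial>lborel_vec n)"
    if g[measurable]: "g \<in> borel_measurable borel" for g
    unfolding N_def by (subst nn_integral_distr, measurable, subst nn_integral_density) auto
  have eN: "emeasure N {..r} = (\<integral>\<^sup>+v. f v * indicator {..r} (v \<bullet> v / 2) \<partial>lborel_vec n)" for r
  proof -
    have "emeasure N {..r} = (\<integral>\<^sup>+x. indicator {..r} x \<partial>N)"
      by (rule nn_integral_indicator[symmetric]) (simp add: N_def)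
    then show ?thesis by (simp add: nnN)
  qed
  have hN: "emeasure N {..r} = ennreal (r powr a) * emeasure N {..1}" if r: "r > 0" for r
  proof -
    \<comment> \<open>The dilation by \<open>sqrt r\<close> multiplies the squared length by r and
      leaves \<open>f\<close> unchanged; its determinant \<open>r powr (n / 2)\<close> is the degree
      of homogeneity.\<close>
    let ?A = "sqrt r \<cdot>\<^sub>m 1\<^sub>m n"
    have A: "?A \<in> carrier_mat n n" "det ?A = sqrt r ^ n" by (auto simp: det_smult)
    have Av: "?A *\<^sub>v v = sqrt r \<cdot>\<^sub>v v" if "v \<in> carrier_vec n" for v
    proof (intro eq_vecI)
      fix i assume "i < dim_vec (sqrt r \<cdot>\<^sub>v v)"
      then have i: "i < n" using that by simp
      have "sqrt r * (if j = i then 1 else 0) * v $ j = (if j = i then sqrt r * v $ i else 0)" for j by simp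
      then have "(?A *\<^sub>v v) $ i = (\<Sum>j = 0..<n. if j = i then sqrt r * v $ i else 0)"
        using i that by (simp add: scalar_prod_def)
      then show "(?A *\<^sub>v v) $ i = (sqrt r \<cdot>\<^sub>v v) $ i" using i that by simp
    qed (use that in simp)
    have *: "f (?A *\<^sub>v v) * indicator {..r} ((?A *\<^sub>v v) \<bullet> (?A *\<^sub>v v) / 2) = f v * indicator {..1} (v \<bullet> v / 2)"
      if v: "v \<in> carrier_vec n" for v
    proof -
      have sp: "(sqrt r \<cdot>\<^sub>v v) \<bullet> (sqrt r \<cdot>\<^sub>v v) = r * (v \<bullet> v)"
        using v r by (simp add: mult.assoc[symmetric])
      have "r * (v \<bullet> v) / 2 \<le> r \<longleftrightarrow> v \<bullet> v / 2 \<le> 1" using r by simp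
      then have "indicator {..r} (r * (v \<bullet> v) / 2) = (indicator {..1} (v \<bullet> v / 2) :: ennreal)"
        by (simp only: indicator_def atMost_iff)
      then show ?thesis unfolding Av[OF v] sp using hom[of "sqrt r" v] v r by simp
    qed
    have "(\<lambda>v. f v * indicator {..r} (v \<bullet> v / 2)) \<in> borel_measurable (borel_vec n)" by measurable
    then have "emeasure N {..r} = ennreal \<bar>det ?A\<bar> * (\<integral>\<^sup>+v. f (?A *\<^sub>v v) * indicator {..r} ((?A *\<^sub>v v) \<bullet> (?A *\<^sub>v v) / 2) \<partial>lborel_vec n)"
      unfolding eN using A r by (intro lborel_scalingD[OF lborel_scaling, symmetric]) auto
    also have "(\<integral>\<^sup>+v. f (?A *\<^sub>v v) * indicator {..r} ((?A *\<^sub>v v) \<bullet> (?A *\<^sub>v v) / 2) \<partial>lborel_vec n) = emeasure N {..1}"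
      unfolding eN by (intro nn_integral_cong) (simp add: *)
    also have "\<bar>det ?A\<bar> = r powr a"
      using r A by (simp add: a_def powr_half_sqrt[symmetric] powr_powr powr_realpow[symmetric])
    finally show ?thesis .
  qed
  have fN: "emeasure N {..1} \<noteq> \<infinity>"
  proof -
    \<comment> \<open>Where half the squared length is at most 1, the normal density is at least
      \<open>exp (- 1) / K\<close>, so Lebesgue measure there is dominated by a multiple of the
      normal law.\<close>
    have "emeasure N {..1} \<le> (\<integral>\<^sup>+v. ennreal (exp 1 * K) * (ennreal (exp (- (v \<bullet> v / 2)) / K) * 1) \<partial>lborel_vec n)"
      unfolding eN
    proof (intro nn_integral_mono)
      fix v :: "real vec"
      have "f v * indicator {..1} (v \<bullet> v / 2) \<le> indicator {..1} (v \<bullet> v / 2)"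
        using mult_right_mono[OF f1[of v], of "indicator {..1} (v \<bullet> v / 2)"] by simp
      also have "\<dots> \<le> ennreal (exp 1 * exp (- (v \<bullet> v / 2)))"
        by (auto simp: indicator_def exp_add[symmetric] simp flip: ennreal_1 intro!: ennreal_leI)
      also have "\<dots> = ennreal (exp 1 * K) * (ennreal (exp (- (v \<bullet> v / 2)) / K) * 1)"
        using K by (simp add: ennreal_mult[symmetric])
      finally show "f v * indicator {..1} (v \<bullet> v / 2) \<le> ennreal (exp 1 * K) * (ennreal (exp (- (v \<bullet> v / 2)) / K) * 1)" .
    qed
    also have "\<dots> = ennreal (exp 1 * K) * (\<integral>\<^sup>+v. 1 \<partial>std_normal_vec n)"
      by (subst nn_integral_cmult, measurable, subst nn_integral_std_normal_vec) (auto simp: K_def)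
    also have "\<dots> < \<infinity>"
      using prob_space.emeasure_space_1[OF prob_space_std_normal_vec[of n]] by (simp add: ennreal_mult_less_top)
    finally show ?thesis by simp
  qed
  have sN: "sets N = sets borel" and sP: "sets (powr_measure a) = sets borel"
    by (simp_all add: N_def powr_measure_def)
  note P = emeasure_powr_measure_atMost[OF a]
  obtain c where c: "N = scale_measure c (powr_measure a)"
    by (rule homogeneous_measure_unique[OF a sN sP hN P(1) fN P(2) P(3)])
  have J: "(\<integral>\<^sup>+v. f v * g (v \<bullet> v / 2) \<partial>std_normal_vec n) = c * ennreal (Gamma a / K) * (\<integral>\<^sup>+r. g r \<partial>gamma_measure a)"
    if g[measurable]: "g \<in> borel_measurable borel" for g
  proof -
    have "(\<integral>\<^sup>+v. f v * g (v \<bullet> v / 2) \<partial>std_normal_vec n) =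
        (\<integral>\<^sup>+v. f v * (ennreal (exp (- (v \<bullet> v / 2)) / K) * g (v \<bullet> v / 2)) \<partial>lborel_vec n)"
      by (subst nn_integral_std_normal_vec) (auto simp: K_def mult_ac)
    also have "\<dots> = (\<integral>\<^sup>+r. ennreal (exp (- r) / K) * g r \<partial>N)"
      by (subst nnN) auto
    also have "\<dots> = c * (\<integral>\<^sup>+r. ennreal (exp (- r) / K) * g r \<partial>powr_measure a)"
      unfolding c by (intro nn_integral_scale_measure) (auto simp: powr_measure_def)
    also have "(\<integral>\<^sup>+r. ennreal (exp (- r) / K) * g r \<partial>powr_measure a) =
        (\<integral>\<^sup>+r. ennreal (Gamma a / K) * (ennreal (indicator {0..} r * r powr (a - 1) / exp r / Gamma a) * g r) \<partial>lborel)"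
    proof -
      have "(\<integral>\<^sup>+r. ennreal (exp (- r) / K) * g r \<partial>powr_measure a) =
          (\<integral>\<^sup>+r. ennreal (indicator {0..} r * r powr (a - 1)) * (ennreal (exp (- r) / K) * g r) \<partial>lborel)"
        unfolding powr_measure_def by (rule nn_integral_density) measurable
      also have "\<dots> = (\<integral>\<^sup>+r. ennreal (Gamma a / K) * (ennreal (indicator {0..} r * r powr (a - 1) / exp r / Gamma a) * g r) \<partial>lborel)"
      proof (rule nn_integral_cong)
        fix r :: real
        define A where "A = indicator {0..} r * r powr (a - 1)"
        have A: "A \<ge> 0" by (simp add: A_def)
        have "A * (exp (- r) / K) = Gamma a / K * (A / exp r / Gamma a)"
          using G by (simp add: exp_minus inverse_eq_divide)
        then have "ennreal A * ennreal (exp (- r) / K) = ennreal (Gamma a / K) * ennreal (A / exp r / Gamma a)"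
          using A G K by (subst (1 2) ennreal_mult[symmetric]) simp_all
        then show "ennreal (indicator {0..} r * r powr (a - 1)) * (ennreal (exp (- r) / K) * g r) =
            ennreal (Gamma a / K) * (ennreal (indicator {0..} r * r powr (a - 1) / exp r / Gamma a) * g r)"
          unfolding A_def[symmetric] by (simp only: mult.assoc[symmetric])
      qed
      finally show ?thesis .
    qed
    also have "\<dots> = ennreal (Gamma a / K) * (\<integral>\<^sup>+r. g r \<partial>gamma_measure a)"
      unfolding gamma_measure_def by (subst nn_integral_cmult, measurable, subst nn_integral_density) auto
    finally show ?thesis by (simp add: mult.assoc)
  qed
  \<comment> \<open>Testing with the constant 1 identifies the unknown factor, which depends on
    \<open>f\<close>, with the normal integral of \<open>f\<close>.\<close>
  have "(\<integral>\<^sup>+v. f v \<partial>std_normal_vec n) = c * ennreal (Gamma a / K)"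
    using J[of "\<lambda>_. 1"] prob_space.emeasure_space_1[OF prob_space_gamma_measure[OF a]] by simp
  then show ?thesis using J[OF h] by (simp add: a_def)
qed

section \<open>Law of the length and its independence of the direction\<close>

lemma distr_std_normal_vec_sqnorm:
  assumes n: "n > 0"
  shows "distr (std_normal_vec n) borel (\<lambda>v. v \<bullet> v / 2) = gamma_measure (real n / 2)"
proof (rule measure_eqI)
  have [measurable]: "(\<lambda>v. v \<bullet> v) \<in> borel_measurable (borel_vec n)"
    by (rule borel_measurable_sqnorm)
  fix A assume "A \<in> sets (distr (std_normal_vec n) borel (\<lambda>v. v \<bullet> v / 2))"
  then have A[measurable]: "A \<in> sets borel" by simp
  have "emeasure (distr (std_normal_vec n) borel (\<lambda>v. v \<bullet> v / 2)) A = (\<integral>\<^sup>+v. 1 * indicator A (v \<bullet> v / 2) \<partial>std_normal_vec n)"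
    by (subst nn_integral_indicator[symmetric], simp, subst nn_integral_distr) auto
  also have "\<dots> = (\<integral>\<^sup>+v. 1 \<partial>std_normal_vec n) * (\<integral>\<^sup>+r. indicator A r \<partial>gamma_measure (real n / 2))"
    by (rule std_normal_vec_radial[OF n]) auto
  also have "\<dots> = emeasure (gamma_measure (real n / 2)) A"
    using prob_space.emeasure_space_1[OF prob_space_std_normal_vec[of n]] by (simp add: gamma_measure_def)
  finally show "emeasure (distr (std_normal_vec n) borel (\<lambda>v. v \<bullet> v / 2)) A = emeasure (gamma_measure (real n / 2)) A" .
qed (simp add: gamma_measure_def)

text \<open>The indicator of a set composed with \<open>R\<close> inherits the invariance under
  dilations, so the radial formula factorises the joint law on rectangles.\<close>

lemma indep_var_direction_length:
  fixes R :: "real vec \<Rightarrow> real"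
  assumes n: "n > 0" and R[measurable]: "R \<in> borel_measurable (borel_vec n)"
    and hom: "\<And>c v. c > 0 \<Longrightarrow> v \<in> carrier_vec n \<Longrightarrow> R (c \<cdot>\<^sub>v v) = R v"
  shows "prob_space.indep_var (std_normal_vec n) borel R borel (\<lambda>v. v \<bullet> v / 2)"
proof -
  interpret prob_space "std_normal_vec n" by (rule prob_space_std_normal_vec)
  have [measurable]: "(\<lambda>v. v \<bullet> v) \<in> borel_measurable (borel_vec n)"
    by (rule borel_measurable_sqnorm)
  show ?thesis
    unfolding indep_var_distribution_eq
  proof (intro conjI pair_measure_eqI)
    show "sigma_finite_measure (distr (std_normal_vec n) borel R)"
      "sigma_finite_measure (distr (std_normal_vec n) borel (\<lambda>v. v \<bullet> v / 2))"
      by (intro prob_space_imp_sigma_finite prob_space_distr; measurable)+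
    fix A B assume "A \<in> sets (distr (std_normal_vec n) borel R)" "B \<in> sets (distr (std_normal_vec n) borel (\<lambda>v. v \<bullet> v / 2))"
    then have [measurable]: "A \<in> sets borel" "B \<in> sets borel" by auto
    have "emeasure (distr (std_normal_vec n) (borel \<Otimes>\<^sub>M borel) (\<lambda>x. (R x, x \<bullet> x / 2))) (A \<times> B) =
       (\<integral>\<^sup>+v. indicator A (R v) * indicator B (v \<bullet> v / 2) \<partial>std_normal_vec n)"
      by (subst nn_integral_indicator[symmetric], simp, subst nn_integral_distr) (auto simp: indicator_times)
    also have "\<dots> = (\<integral>\<^sup>+v. indicator A (R v) \<partial>std_normal_vec n) * (\<integral>\<^sup>+r. indicator B r \<partial>gamma_measure (real n / 2))"
      by (rule std_normal_vec_radial[OF n]) (auto simp: hom indicator_def)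
    also have "(\<integral>\<^sup>+v. indicator A (R v) \<partial>std_normal_vec n) = emeasure (distr (std_normal_vec n) borel R) A"
      by (subst nn_integral_indicator[symmetric], simp, subst nn_integral_distr) auto
    also have "(\<integral>\<^sup>+r. indicator B r \<partial>gamma_measure (real n / 2)) = emeasure (distr (std_normal_vec n) borel (\<lambda>v. v \<bullet> v / 2)) B"
      by (simp add: distr_std_normal_vec_sqnorm[OF n] gamma_measure_def)
    finally show "emeasure (distr (std_normal_vec n) borel R) A * emeasure (distr (std_normal_vec n) borel (\<lambda>v. v \<bullet> v / 2)) B =
       emeasure (distr (std_normal_vec n) (borel \<Otimes>\<^sub>M borel) (\<lambda>x. (R x, x \<bullet> x / 2))) (A \<times> B)" by simp
  qed (auto intro: sets_pair_measure_cong)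
qed

text \<open>For r > 0, \<open>cis (t * ln r)\<close> is r to the power i t, so the integral is the
  Euler integral at the complex argument a + i t, divided by the normalising constant.\<close>

lemma integral_cis_ln_gamma_measure:
  assumes a: "a > 0"
  shows "(\<integral>r. cis (t * ln r) \<partial>gamma_measure a) = Gamma (Complex a t) / of_real (Gamma a)"
proof -
  let ?z = "Complex a t"
  let ?f = "\<lambda>r::real. complex_of_real r powr (?z - 1) / of_real (exp r)"
  have G: "Gamma a > 0" using a by (rule Gamma_real_pos)
  have "(\<lambda>r. indicator {0<..} r *\<^sub>R ?f r) \<in> borel_measurable lborel"
    by (auto intro!: borel_measurable_continuous_on_indicator continuous_intros)
  then have "set_integrable lborel {0<..} ?f"
    using absolutely_integrable_Gamma_integral'[of ?z] a unfolding set_integrable_def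
    by (simp add: integrable_completion)
  then have "(LINT r:{0<..}|lborel. ?f r) = integral {0<..} ?f" by (rule set_borel_integral_eq_integral)
  also have "\<dots> = Gamma ?z" using Gamma_integral_complex'[of ?z] a by (intro integral_unique) auto
  finally have I: "(LINT r:{0<..}|lborel. ?f r) = Gamma ?z" .
  have "(\<integral>r. cis (t * ln r) \<partial>gamma_measure a) = (\<integral>r. (indicator {0..} r * r powr (a - 1) / exp r / Gamma a) *\<^sub>R cis (t * ln r) \<partial>lborel)"
    unfolding gamma_measure_def using G by (intro integral_density) auto
  also have "\<dots> = (\<integral>r. (1 / of_real (Gamma a)) * (indicator {0<..} r *\<^sub>R ?f r) \<partial>lborel)"
  proof (intro Bochner_Integration.integral_cong refl)
    fix r :: real
    have "complex_of_real r powr (?z - 1) = of_real (r powr (a - 1)) * cis (t * ln r)" if "r > 0"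
    proof -
      have "?z - 1 = of_real (a - 1) + \<i> * of_real t" by (simp add: complex_eq_iff)
      then have "complex_of_real r powr (?z - 1) = of_real r powr of_real (a - 1) * of_real r powr (\<i> * of_real t)"
        by (simp only: powr_add)
      also have "complex_of_real r powr (\<i> * of_real t) = cis (t * ln r)"
        using that by (simp add: powr_def Ln_of_real cis_conv_exp mult_ac)
      finally show ?thesis using that by (simp add: powr_of_real[symmetric])
    qed
    then show "(indicator {0..} r * r powr (a - 1) / exp r / Gamma a) *\<^sub>R cis (t * ln r) =
        (1 / of_real (Gamma a)) * (indicator {0<..} r *\<^sub>R ?f r)"
      by (cases "r > 0") (auto simp: indicator_def scaleR_conv_of_real)
  qed
  also have "\<dots> = (1 / of_real (Gamma a)) * Gamma ?z"
    unfolding integral_mult_right_zero using I unfolding set_lebesgue_integral_def by (simp only:)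
  finally show ?thesis by simp
qed

section \<open>Distances of a standard normal vector to subspaces\<close>

lemma borel_measurable_gram_det:
  assumes "\<And>f. f \<in> set fs \<Longrightarrow> f \<in> measurable N (borel_vec n)"
  shows "(\<lambda>w. gram_det (map (\<lambda>f. f w) fs)) \<in> borel_measurable N"
proof -
  let ?k = "length fs"
  have "(\<lambda>w. \<Sum>\<pi> | \<pi> permutes {0..<?k}. signof \<pi> * (\<Prod>i = 0..<?k. (fs ! i) w \<bullet> (fs ! \<pi> i) w)) \<in> borel_measurable N"
  proof (intro borel_measurable_sum borel_measurable_times borel_measurable_const borel_measurable_prod)
    fix \<pi> i assume "\<pi> \<in> {\<pi>. \<pi> permutes {0..<?k}}" "i \<in> {0..<?k}"
    then have "i < ?k" "\<pi> i < ?k" using permutes_in_image[of \<pi> "{0..<?k}" i] by auto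
    then show "(\<lambda>w. (fs ! i) w \<bullet> (fs ! \<pi> i) w) \<in> borel_measurable N"
      using assms by (intro borel_measurable_scalar_prod[of _ _ n]) auto
  qed
  also have "(\<lambda>w. \<Sum>\<pi> | \<pi> permutes {0..<?k}. signof \<pi> * (\<Prod>i = 0..<?k. (fs ! i) w \<bullet> (fs ! \<pi> i) w)) =
      (\<lambda>w. gram_det (map (\<lambda>f. f w) fs))"
  proof
    fix w
    have "gram_det (map (\<lambda>f. f w) fs) = (\<Sum>\<pi> | \<pi> permutes {0..<?k}. signof \<pi> * (\<Prod>i = 0..<?k. gram (map (\<lambda>f. f w) fs) $$ (i, \<pi> i)))"
      unfolding gram_det_def by (rule det_def') (metis gram_carrier length_map)
    also have "\<dots> = (\<Sum>\<pi> | \<pi> permutes {0..<?k}. signof \<pi> * (\<Prod>i = 0..<?k. (fs ! i) w \<bullet> (fs ! \<pi> i) w))"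
    proof (intro sum.cong refl arg_cong2[where f = "(*)"] prod.cong)
      fix \<pi> i assume "\<pi> \<in> {\<pi>. \<pi> permutes {0..<?k}}" "i \<in> {0..<?k}"
      then have "i < ?k" "\<pi> i < ?k" using permutes_in_image[of \<pi> "{0..<?k}" i] by auto
      then show "gram (map (\<lambda>f. f w) fs) $$ (i, \<pi> i) = (fs ! i) w \<bullet> (fs ! \<pi> i) w" by (simp add: gram_def)
    qed
    finally show "(\<Sum>\<pi> | \<pi> permutes {0..<?k}. signof \<pi> * (\<Prod>i = 0..<?k. (fs ! i) w \<bullet> (fs ! \<pi> i) w)) = gram_det (map (\<lambda>f. f w) fs)" by simp
  qed
  finally show ?thesis .
qed

text \<open>The squared distance from \<open>g\<close> to the span of \<open>Z\<close> if \<open>Z\<close> is linearly independent, and \<open>0\<close> otherwise.\<close>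

definition sq_dist :: "real vec list \<Rightarrow> real vec \<Rightarrow> real" where
  "sq_dist Z g = gram_det (g # Z) / gram_det Z"

lemma borel_measurable_sq_dist:
  assumes "set Z \<subseteq> carrier_vec n"
  shows "sq_dist Z \<in> borel_measurable (borel_vec n)"
proof -
  have "(\<lambda>g. gram_det (map (\<lambda>f. f g) ((\<lambda>g. g) # map (\<lambda>z _. z) Z))) \<in> borel_measurable (borel_vec n)"
    by (rule borel_measurable_gram_det[of _ _ n]) (use assms in auto)
  then show ?thesis unfolding sq_dist_def by (simp add: comp_def)
qed

lemma sq_dist_Nil [simp]: "sq_dist [] g = g \<bullet> g"
  by (simp add: sq_dist_def gram_det_def gram_def det_single)

lemma sq_dist_smult:
  assumes Z: "set Z \<subseteq> carrier_vec n" and g: "g \<in> carrier_vec n"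
  shows "sq_dist Z (c \<cdot>\<^sub>v g) = c\<^sup>2 * sq_dist Z g"
proof -
  let ?G = "gram (g # Z)" and ?k = "Suc (length Z)"
  have Zi: "Z ! i \<in> carrier_vec n" if "i < length Z" for i using Z that by auto
  have "gram ((c \<cdot>\<^sub>v g) # Z) = transpose_mat (multrow 0 c (transpose_mat (multrow 0 c ?G)))"
    by (intro eq_matI) (use g Zi in \<open>auto simp: gram_def nth_Cons split: nat.splits\<close>)
  moreover have "det (transpose_mat (multrow 0 c (transpose_mat (multrow 0 c ?G)))) = c * (c * det ?G)"
  proof -
    have G: "?G \<in> carrier_mat ?k ?k" by (simp add: gram_def)
    define A where "A = multrow 0 c ?G"
    define B where "B = multrow 0 c (transpose_mat A)"
    have A: "A \<in> carrier_mat ?k ?k" and B: "B \<in> carrier_mat ?k ?k"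
      using G by (auto simp: A_def B_def)
    have "det (transpose_mat B) = det B" by (rule det_transpose[OF B])
    also have "\<dots> = c * det (transpose_mat A)"
      unfolding B_def by (rule det_multrow[of _ ?k]) (use A in auto)
    also have "det (transpose_mat A) = det A" by (rule det_transpose[OF A])
    also have "det A = c * det ?G" unfolding A_def by (rule det_multrow[OF _ G]) simp
    finally show ?thesis by (simp only: A_def B_def)
  qed
  ultimately show ?thesis
    by (simp add: sq_dist_def gram_det_def power2_eq_square)
qed

lemma distr_std_normal_vec_first:
  "distr (std_normal_vec (Suc m)) (borel_vec m) (\<lambda>g. vec_first g m) = std_normal_vec m"
proof (rule measure_eqI)
  have [measurable]: "(\<lambda>g. vec_first g m) \<in> measurable (borel_vec (Suc m)) (borel_vec m)"
    by (rule measurable_borel_vecI) (auto simp: vec_first_def intro!: measurable_vec_index)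
  fix A assume "A \<in> sets (distr (std_normal_vec (Suc m)) (borel_vec m) (\<lambda>g. vec_first g m))"
  then have [measurable]: "A \<in> sets (borel_vec m)" by simp
  have vf: "vec_first (vsnoc v x) m = v" if "v \<in> carrier_vec m" for v x
    using that by (intro eq_vecI) (auto simp: vec_first_def index_vsnoc)
  have "emeasure (distr (std_normal_vec (Suc m)) (borel_vec m) (\<lambda>g. vec_first g m)) A = (\<integral>\<^sup>+g. indicator A (vec_first g m) \<partial>std_normal_vec (Suc m))"
    by (subst nn_integral_indicator[symmetric], simp, subst nn_integral_distr) auto
  also have "\<dots> = (\<integral>\<^sup>+x. \<integral>\<^sup>+v. indicator A (vec_first (vsnoc v x) m) \<partial>std_normal_vec m \<partial>std_normal_distribution)"
    by (rule nn_integral_iid_vec_Suc[OF sigma_finite_std_normal]) auto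
  also have "\<dots> = (\<integral>\<^sup>+x. emeasure (std_normal_vec m) A \<partial>std_normal_distribution)"
  proof (rule nn_integral_cong)
    fix x
    have "(\<integral>\<^sup>+v. indicator A (vec_first (vsnoc v x) m) \<partial>std_normal_vec m) = (\<integral>\<^sup>+v. indicator A v \<partial>std_normal_vec m)"
      by (rule nn_integral_cong) (simp add: vf)
    then show "(\<integral>\<^sup>+v. indicator A (vec_first (vsnoc v x) m) \<partial>std_normal_vec m) = emeasure (std_normal_vec m) A"
      by simp
  qed
  also have "\<dots> = emeasure (std_normal_vec m) A"
    using prob_space.emeasure_space_1[OF prob_space_std_normal] by simp
  finally show "emeasure (distr (std_normal_vec (Suc m)) (borel_vec m) (\<lambda>g. vec_first g m)) A = emeasure (std_normal_vec m) A" .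
qed simp

lemma sq_dist_reduce:
  assumes z: "z \<in> carrier_vec (Suc m)" "z \<bullet> z \<noteq> 0" "set Z \<subseteq> carrier_vec (Suc m)" "g \<in> carrier_vec (Suc m)"
    and Q: "Q \<in> carrier_mat (Suc m) (Suc m)" "Q * transpose_mat Q = 1\<^sub>m (Suc m)"
    "Q *\<^sub>v z = vsnoc (0\<^sub>v m) (sqrt (z \<bullet> z))"
  shows "sq_dist (Z @ [z]) g = sq_dist (map (\<lambda>v. vec_first (Q *\<^sub>v v) m) Z) (vec_first (Q *\<^sub>v g) m)"
  using gram_det_snoc_reduce[OF z(1,2) Q, of "g # Z"] gram_det_snoc_reduce[OF z(1,2) Q, of Z] z
  by (simp add: sq_dist_def)

text \<open>
  Rotate the last vector of \<open>Z2\<close> onto the last coordinate axis and drop that coordinate.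
\<close>

proposition distr_sq_dist_pair:
  assumes "set Z1 \<subseteq> carrier_vec n" "set Z2 \<subseteq> carrier_vec n" "gram_det (Z1 @ Z2) \<noteq> 0"
  shows "length Z2 \<le> n \<and> (\<exists>Y. length Y = length Z1 \<and> set Y \<subseteq> carrier_vec (n - length Z2) \<and> gram_det Y \<noteq> 0 \<and>
    distr (std_normal_vec n) (borel \<Otimes>\<^sub>M borel) (\<lambda>g. (sq_dist (Z1 @ Z2) g, sq_dist Z2 g)) =
    distr (std_normal_vec (n - length Z2)) (borel \<Otimes>\<^sub>M borel) (\<lambda>g. (sq_dist Y g, g \<bullet> g)))"
  using assms
proof (induction Z2 arbitrary: Z1 n rule: length_induct)
  case (1 Z2)
  show ?case
  proof (cases Z2 rule: rev_cases)
    case Nil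
    with 1 show ?thesis by (auto intro!: exI[of _ Z1])
  next
    case (snoc Z z)
    then have z: "z \<in> carrier_vec n" and Z: "set Z \<subseteq> carrier_vec n" and Z1: "set Z1 \<subseteq> carrier_vec n" using 1 by auto
    have zz: "z \<bullet> z \<noteq> 0"
      using gram_det_zero_last[OF z, of "Z1 @ Z"] 1(4) snoc Z Z1 by auto
    obtain m where n: "n = Suc m" using carrier_vec_pos_dim[OF z zz] .
    note z = z[unfolded n] and Z = Z[unfolded n] and Z1 = Z1[unfolded n]
    obtain Q where Q: "Q \<in> carrier_mat (Suc m) (Suc m)" "Q * transpose_mat Q = 1\<^sub>m (Suc m)"
      "Q *\<^sub>v z = vsnoc (0\<^sub>v m) (sqrt (z \<bullet> z))"
      using householder[of z m] z by blast
    let ?r = "map (\<lambda>v. vec_first (Q *\<^sub>v v) m)"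
    have gr: "gram_det (?r Z1 @ ?r Z) \<noteq> 0"
      using gram_det_snoc_reduce[OF z zz Q, of "Z1 @ Z"] Z Z1 1(4) snoc by auto
    have len: "length Z < length Z2" using snoc by simp
    obtain Y where Y: "length Z \<le> m" "length Y = length Z1" "set Y \<subseteq> carrier_vec (m - length Z)" "gram_det Y \<noteq> 0"
      "distr (std_normal_vec m) (borel \<Otimes>\<^sub>M borel) (\<lambda>g. (sq_dist (?r Z1 @ ?r Z) g, sq_dist (?r Z) g)) =
        distr (std_normal_vec (m - length Z)) (borel \<Otimes>\<^sub>M borel) (\<lambda>g. (sq_dist Y g, g \<bullet> g))"
      using 1(1)[rule_format, of "?r Z", OF _ set_vec_first_carrier set_vec_first_carrier gr] len by auto
    have m1: "(\<lambda>g. Q *\<^sub>v g) \<in> measurable (borel_vec (Suc m)) (borel_vec (Suc m))"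
      by (rule measurable_mult_mat_vec[OF Q(1)])
    have m2: "(\<lambda>g. vec_first g m) \<in> measurable (borel_vec (Suc m)) (borel_vec m)"
      by (rule measurable_borel_vecI) (auto simp: vec_first_def intro!: measurable_vec_index)
    have m3: "(\<lambda>g. (sq_dist (?r Z1 @ ?r Z) g, sq_dist (?r Z) g)) \<in> measurable (borel_vec m) (borel \<Otimes>\<^sub>M borel)"
      by (intro measurable_Pair borel_measurable_sq_dist) auto
    have "distr (std_normal_vec m) (borel \<Otimes>\<^sub>M borel) (\<lambda>g. (sq_dist (?r Z1 @ ?r Z) g, sq_dist (?r Z) g)) =
      distr (distr (distr (std_normal_vec (Suc m)) (borel_vec (Suc m)) (\<lambda>g. Q *\<^sub>v g)) (borel_vec m) (\<lambda>g. vec_first g m))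
        (borel \<Otimes>\<^sub>M borel) (\<lambda>g. (sq_dist (?r Z1 @ ?r Z) g, sq_dist (?r Z) g))"
      using Q by (simp add: distr_std_normal_vec_orthogonal distr_std_normal_vec_first)
    also have "\<dots> = distr (std_normal_vec (Suc m)) (borel \<Otimes>\<^sub>M borel)
        (\<lambda>g. (sq_dist (?r Z1 @ ?r Z) (vec_first (Q *\<^sub>v g) m), sq_dist (?r Z) (vec_first (Q *\<^sub>v g) m)))"
      using m1 m2 m3 by (simp add: distr_distr measurable_comp comp_def measurable_compose)
    also have "\<dots> = distr (std_normal_vec (Suc m)) (borel \<Otimes>\<^sub>M borel) (\<lambda>g. (sq_dist (Z1 @ Z2) g, sq_dist Z2 g))"
    proof (intro distr_cong refl)
      fix g :: "real vec" assume "g \<in> space (std_normal_vec (Suc m))"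
      then show "(sq_dist (?r Z1 @ ?r Z) (vec_first (Q *\<^sub>v g) m), sq_dist (?r Z) (vec_first (Q *\<^sub>v g) m)) =
          (sq_dist (Z1 @ Z2) g, sq_dist Z2 g)"
        using sq_dist_reduce[OF z zz _ _ Q, of "Z1 @ Z" g] sq_dist_reduce[OF z zz _ _ Q, of Z g] Z Z1 snoc by simp
    qed
    finally have "distr (std_normal_vec n) (borel \<Otimes>\<^sub>M borel) (\<lambda>g. (sq_dist (Z1 @ Z2) g, sq_dist Z2 g)) =
        distr (std_normal_vec (n - length Z2)) (borel \<Otimes>\<^sub>M borel) (\<lambda>g. (sq_dist Y g, g \<bullet> g))"
      using Y(5) snoc n by simp
    then show ?thesis using Y snoc n by (auto intro!: exI[of _ Y])
  qed
qed

lemma distr_sq_dist: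
  assumes "set Z \<subseteq> carrier_vec n" "gram_det Z \<noteq> 0"
  shows "distr (std_normal_vec n) borel (sq_dist Z) = distr (std_normal_vec (n - length Z)) borel (\<lambda>g. g \<bullet> g)"
proof -
  obtain Y where Y: "Y = []"
    "distr (std_normal_vec n) (borel \<Otimes>\<^sub>M borel) (\<lambda>g. (sq_dist Z g, sq_dist Z g)) =
     distr (std_normal_vec (n - length Z)) (borel \<Otimes>\<^sub>M borel) (\<lambda>g. (sq_dist Y g, g \<bullet> g))"
    using distr_sq_dist_pair[of "[]" n Z] assms by auto
  have m: "sq_dist Z \<in> borel_measurable (borel_vec n)" "(\<lambda>g. g \<bullet> g) \<in> borel_measurable (borel_vec (n - length Z))"
    using assms by (auto intro!: borel_measurable_sq_dist borel_measurable_sqnorm)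
  have "distr (distr (std_normal_vec n) (borel \<Otimes>\<^sub>M borel) (\<lambda>g. (sq_dist Z g, sq_dist Z g))) borel snd =
     distr (distr (std_normal_vec (n - length Z)) (borel \<Otimes>\<^sub>M borel) (\<lambda>g. (sq_dist Y g, g \<bullet> g))) borel snd"
    by (simp only: Y)
  then show ?thesis
    using m Y(1) by (simp add: distr_distr comp_def measurable_Pair)
qed

text \<open>The characteristic function of the logarithm of a \<open>gamma_measure (k / 2)\<close> variable.\<close>

definition gamma_ratio :: "nat \<Rightarrow> real \<Rightarrow> complex" where
  "gamma_ratio k t = Gamma (Complex (real k / 2) t) / of_real (Gamma (real k / 2))"

section \<open>Almost sure positivity and characteristic functions of the distances\<close>

lemma AE_gamma_measure_pos: "AE r in gamma_measure a. r > 0"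
proof -
  have m: "(\<lambda>r. ennreal (indicator {0..} r * r powr (a - 1) / exp r / Gamma a)) \<in> borel_measurable lborel"
    by auto
  have "AE r in lborel. r \<noteq> (0::real)" by (rule AE_lborel_singleton)
  then have "AE r in lborel. 0 < ennreal (indicator {0..} r * r powr (a - 1) / exp r / Gamma a) \<longrightarrow> 0 < r"
    by eventually_elim (auto simp: indicator_def split: if_splits)
  then show ?thesis unfolding gamma_measure_def AE_density[OF m] .
qed

lemma borel_measurable_iid_vec:
  "f \<in> measurable (borel_vec n) N \<Longrightarrow> f \<in> measurable (iid_vec \<nu> n) N"
  unfolding measurable_cong_sets[OF sets_iid_vec refl] .

lemma AE_sqnorm_pos:
  assumes "n > 0"
  shows "AE g in std_normal_vec n. g \<bullet> g > 0"
proof -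
  have m: "(\<lambda>g. g \<bullet> g / 2) \<in> borel_measurable (std_normal_vec n)"
    by (intro borel_measurable_iid_vec borel_measurable_divide borel_measurable_sqnorm borel_measurable_const)
  have "AE r in distr (std_normal_vec n) borel (\<lambda>v. v \<bullet> v / 2). r > 0"
    unfolding distr_std_normal_vec_sqnorm[OF assms] by (rule AE_gamma_measure_pos)
  then have "AE g in std_normal_vec n. g \<bullet> g / 2 > 0"
    by (rule AE_distrD[OF m])
  then show ?thesis by eventually_elim simp
qed

lemma AE_sq_dist_pos:
  assumes Z: "set Z \<subseteq> carrier_vec n" "gram_det Z \<noteq> 0" and n: "length Z < n"
  shows "AE g in std_normal_vec n. sq_dist Z g > 0"
proof -
  have m: "sq_dist Z \<in> borel_measurable (std_normal_vec n)" "(\<lambda>g. g \<bullet> g) \<in> borel_measurable (std_normal_vec (n - length Z))"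
    by (intro borel_measurable_iid_vec borel_measurable_sq_dist borel_measurable_sqnorm Z)+
  have "AE g in std_normal_vec (n - length Z). g \<bullet> g > 0" using n by (intro AE_sqnorm_pos) simp
  then have "AE x in distr (std_normal_vec (n - length Z)) borel (\<lambda>g. g \<bullet> g). x > 0"
    using AE_distr_iff[OF m(2), of "\<lambda>x. x > 0"] by simp
  then show ?thesis unfolding distr_sq_dist[OF Z, symmetric] by (rule AE_distrD[OF m(1)])
qed

lemma integral_cis_ln_sqnorm:
  assumes "n > 0"
  shows "(\<integral>g. cis (t * ln (g \<bullet> g / 2)) \<partial>std_normal_vec n) = gamma_ratio n t"
proof -
  have m: "(\<lambda>g. g \<bullet> g / 2) \<in> borel_measurable (std_normal_vec n)"
    by (intro borel_measurable_iid_vec borel_measurable_divide borel_measurable_sqnorm borel_measurable_const)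
  have "(\<integral>g. cis (t * ln (g \<bullet> g / 2)) \<partial>std_normal_vec n) = (\<integral>r. cis (t * ln r) \<partial>distr (std_normal_vec n) borel (\<lambda>g. g \<bullet> g / 2))"
    using m by (subst integral_distr) auto
  then show ?thesis
    using assms by (simp add: distr_std_normal_vec_sqnorm integral_cis_ln_gamma_measure gamma_ratio_def)
qed

lemma integral_cis_ln_sq_dist:
  assumes Z: "set Z \<subseteq> carrier_vec n" "gram_det Z \<noteq> 0" and n: "length Z < n"
  shows "(\<integral>g. cis (t * ln (sq_dist Z g / 2)) \<partial>std_normal_vec n) = gamma_ratio (n - length Z) t"
proof -
  have m: "sq_dist Z \<in> borel_measurable (std_normal_vec n)" "(\<lambda>g. g \<bullet> g) \<in> borel_measurable (std_normal_vec (n - length Z))"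
    by (intro borel_measurable_iid_vec borel_measurable_sq_dist borel_measurable_sqnorm Z)+
  have "(\<integral>g. cis (t * ln (sq_dist Z g / 2)) \<partial>std_normal_vec n) = (\<integral>r. cis (t * ln (r / 2)) \<partial>distr (std_normal_vec n) borel (sq_dist Z))"
    using m by (subst integral_distr) auto
  also have "\<dots> = (\<integral>g. cis (t * ln (g \<bullet> g / 2)) \<partial>std_normal_vec (n - length Z))"
    unfolding distr_sq_dist[OF Z] using m by (subst integral_distr) auto
  finally show ?thesis using n by (simp add: integral_cis_ln_sqnorm)
qed

text \<open>Gamma has no zeros, so a factor of this kind can be cancelled from a product of
  characteristic functions.\<close>

lemma gamma_ratio_nonzero:
  assumes "k > 0"
  shows "gamma_ratio k t \<noteq> 0"
proof -
  have "Complex (real k / 2) t \<notin> \<int>\<^sub>\<le>\<^sub>0"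
    using assms by (auto elim!: nonpos_Ints_cases simp: complex_eq_iff)
  moreover have "Gamma (real k / 2) > 0" using assms by (intro Gamma_real_pos) simp
  ultimately have "Gamma (Complex (real k / 2) t) \<noteq> 0" "complex_of_real (Gamma (real k / 2)) \<noteq> 0"
    unfolding Gamma_eq_zero_iff of_real_eq_0_iff by auto
  then show ?thesis unfolding gamma_ratio_def divide_eq_0_iff by blast
qed

text \<open>After the reduction the ratio is a function \<open>R\<close> of degree zero, hence
  independent of the length of the reduced vector, and \<open>R\<close> times the squared length is
  a squared distance again. Both of the latter have known characteristic functions, and dividing one
  by the other yields that of the ratio.\<close>

proposition integral_cis_ln_sq_dist_ratio:
  assumes Z1: "set Z1 \<subseteq> carrier_vec n" and Z2: "set Z2 \<subseteq> carrier_vec n" and gr: "gram_det (Z1 @ Z2) \<noteq> 0"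
    and n: "length Z1 + length Z2 < n"
  shows "(\<integral>g. cis (t * ln (sq_dist (Z1 @ Z2) g / sq_dist Z2 g)) \<partial>std_normal_vec n) =
    gamma_ratio (n - (length Z1 + length Z2)) t / gamma_ratio (n - length Z2) t"
proof -
  define k where "k = n - length Z2"
  have k: "k > 0" "length Z1 < k" using n by (auto simp: k_def)
  obtain Y where Y: "length Y = length Z1" "set Y \<subseteq> carrier_vec k" "gram_det Y \<noteq> 0"
    "distr (std_normal_vec n) (borel \<Otimes>\<^sub>M borel) (\<lambda>g. (sq_dist (Z1 @ Z2) g, sq_dist Z2 g)) =
     distr (std_normal_vec k) (borel \<Otimes>\<^sub>M borel) (\<lambda>g. (sq_dist Y g, g \<bullet> g))"
    using distr_sq_dist_pair[OF Z1 Z2 gr] unfolding k_def by auto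
  interpret prob_space "std_normal_vec k" by (rule prob_space_std_normal_vec)
  have [measurable]: "sq_dist (Z1 @ Z2) \<in> borel_measurable (borel_vec n)" "sq_dist Z2 \<in> borel_measurable (borel_vec n)"
    "sq_dist Y \<in> borel_measurable (borel_vec k)" "(\<lambda>g. g \<bullet> g) \<in> borel_measurable (borel_vec k)"
    using Z1 Z2 Y by (auto intro!: borel_measurable_sq_dist borel_measurable_sqnorm)
  define R where "R = (\<lambda>g. sq_dist Y g / (g \<bullet> g))"
  have R[measurable]: "R \<in> borel_measurable (borel_vec k)" unfolding R_def by measurable
  have hom: "R (c \<cdot>\<^sub>v v) = R v" if "c > 0" "v \<in> carrier_vec k" for c v
    using that Y(2) by (simp add: R_def sq_dist_smult power2_eq_square)
  have ind: "indep_var borel (\<lambda>v. cis (t * ln (R v))) borel (\<lambda>v. cis (t * ln (v \<bullet> v / 2)))"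
    using indep_var_compose[OF indep_var_direction_length[OF k(1) R hom], of "\<lambda>r. cis (t * ln r)" borel "\<lambda>r. cis (t * ln r)" borel]
    by (simp add: comp_def)
  have "(\<integral>g. cis (t * ln (sq_dist (Z1 @ Z2) g / sq_dist Z2 g)) \<partial>std_normal_vec n) =
     (\<integral>x. cis (t * ln (fst x / snd x)) \<partial>distr (std_normal_vec n) (borel \<Otimes>\<^sub>M borel) (\<lambda>g. (sq_dist (Z1 @ Z2) g, sq_dist Z2 g)))"
    by (subst integral_distr) auto
  also have "\<dots> = (\<integral>v. cis (t * ln (R v)) \<partial>std_normal_vec k)"
    unfolding Y(4) R_def by (subst integral_distr) auto
  finally have 1: "(\<integral>g. cis (t * ln (sq_dist (Z1 @ Z2) g / sq_dist Z2 g)) \<partial>std_normal_vec n) = (\<integral>v. cis (t * ln (R v)) \<partial>std_normal_vec k)" .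
  have "(\<integral>v. cis (t * ln (R v)) * cis (t * ln (v \<bullet> v / 2)) \<partial>std_normal_vec k) =
     (\<integral>v. cis (t * ln (R v)) \<partial>std_normal_vec k) * (\<integral>v. cis (t * ln (v \<bullet> v / 2)) \<partial>std_normal_vec k)"
    by (rule indep_var_lebesgue_integral[OF ind])
       (auto intro!: integrable_const_bound[where B = 1] AE_I2)
  moreover have "(\<integral>v. cis (t * ln (R v)) * cis (t * ln (v \<bullet> v / 2)) \<partial>std_normal_vec k) = (\<integral>v. cis (t * ln (sq_dist Y v / 2)) \<partial>std_normal_vec k)"
  proof (rule integral_cong_AE)
    show "AE v in std_normal_vec k. cis (t * ln (R v)) * cis (t * ln (v \<bullet> v / 2)) = cis (t * ln (sq_dist Y v / 2))"
      using AE_sqnorm_pos[OF k(1)] AE_sq_dist_pos[OF Y(2,3) k(2)[folded Y(1)]]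
    proof eventually_elim
      case (elim v)
      then have "ln (R v) + ln (v \<bullet> v / 2) = ln (sq_dist Y v / 2)"
        by (simp add: R_def ln_div)
      then show ?case by (simp add: cis_mult distrib_left[symmetric])
    qed
  qed measurable
  ultimately have "(\<integral>v. cis (t * ln (R v)) \<partial>std_normal_vec k) * gamma_ratio k t = gamma_ratio (k - length Z1) t"
    using integral_cis_ln_sqnorm[OF k(1)] integral_cis_ln_sq_dist[OF Y(2,3)] k Y(1) by simp
  then show ?thesis
    unfolding 1 using gamma_ratio_nonzero[OF k(1), of t] by (simp add: k_def field_simps add.commute)
qed

section \<open>Residual covariance matrices\<close>

text \<open>A maximal independent set of columns has n elements by the rank assumption and is
  therefore a basis of the whole space.\<close>

lemma (in vec_space) span_cols_full_rank:
  assumes A: "A \<in> carrier_mat n nc" and r: "rank A = n"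
  shows "span (set (cols A)) = carrier_vec n"
proof -
  have c: "set (cols A) \<subseteq> carrier_vec n" using A cols_dim by blast
  have "lin_indpt {}" unfolding lin_dep_def by auto
  then obtain U where U: "finite U" "maximal U (\<lambda>T. T \<subseteq> set (cols A) \<and> lin_indpt T)"
    using maximal_exists_superset[of "set (cols A)" "\<lambda>T. T \<subseteq> set (cols A) \<and> lin_indpt T" "{}"] by auto
  then have U': "U \<subseteq> set (cols A)" "lin_indpt U" by (auto simp: maximal_def)
  have "card U = n" using rank_card_indpt[OF A U(2)] r by simp
  then have "basis U" using U U' c by (intro dim_li_is_basis) (auto simp: dim_is_n)
  then have "carrier_vec n = span U" by (simp add: basis_def)
  also have "\<dots> \<subseteq> span (set (cols A))" using span_is_monotone[OF U'(1)] .
  finally show ?thesis using span_closed[OF c] by auto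
qed

text \<open>A null vector \<open>v\<close> of the product is annihilated by the transpose of
  \<open>Z\<close>, as the squared length of its image is the quadratic form of the product at
  \<open>v\<close>. By full rank \<open>v = Z *\<^sub>v x\<close>, and moving \<open>Z\<close>
  across the scalar product gives \<open>v \<bullet> v = 0\<close>.\<close>

lemma det_mult_transpose_full_rank:
  fixes Z :: "real mat"
  assumes Z: "Z \<in> carrier_mat q n" and r: "vec_space.rank q Z = q"
  shows "det (Z * transpose_mat Z) \<noteq> 0"
proof
  interpret vec_space "TYPE(real)" q .
  assume "det (Z * transpose_mat Z) = 0"
  then obtain v where v: "v \<in> carrier_vec q" "v \<noteq> 0\<^sub>v q" "(Z * transpose_mat Z) *\<^sub>v v = 0\<^sub>v q"
    using det_0_iff_vec_prod_zero[of "Z * transpose_mat Z" q] Z by auto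
  let ?w = "transpose_mat Z *\<^sub>v v"
  have w: "?w \<in> carrier_vec n" using Z v by auto
  have "?w \<bullet> ?w = v \<bullet> (Z *\<^sub>v ?w)"
    using transpose_vec_mult_scalar[OF Z w v(1)] by simp
  also have "Z *\<^sub>v ?w = 0\<^sub>v q"
    unfolding v(3)[symmetric] by (rule assoc_mult_mat_vec[OF Z _ v(1), symmetric]) (use Z in simp)
  finally have "?w \<bullet> ?w = 0" using v by simp
  then have w0: "?w = 0\<^sub>v n" using scalar_prod_self_eq_0[OF w] by simp
  have "v \<in> col_space Z" using span_cols_full_rank[OF Z r] v by (simp add: col_space_def)
  then obtain x where x: "x \<in> carrier_vec n" "Z *\<^sub>v x = v"
    using col_space_eq[OF Z] Z by auto
  have "v \<bullet> v = ?w \<bullet> x" using transpose_vec_mult_scalar[OF Z x(1) v(1)] x by simp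
  then have "v \<bullet> v = 0" using w0 x by simp
  then show False using scalar_prod_self_eq_0[OF v(1)] v by simp
qed

section \<open>Gram determinants of stacked matrices\<close>

lemma rows_append_rows:
  assumes "A \<in> carrier_mat r n" "B \<in> carrier_mat k n"
  shows "rows (A @\<^sub>r B) = rows A @ rows B"
proof (rule nth_equalityI)
  show "length (rows (A @\<^sub>r B)) = length (rows A @ rows B)" using assms by (simp add: append_rows_def)
  fix i assume "i < length (rows (A @\<^sub>r B))"
  then have i: "i < r + k" using assms by (simp add: append_rows_def)
  show "rows (A @\<^sub>r B) ! i = (rows A @ rows B) ! i"
    using i assms by (intro eq_vecI) (auto simp: append_rows_def nth_append row_def)
qed

lemma mult_append_rows:
  fixes X Z :: "'a :: comm_ring_1 mat"
  assumes "U \<in> carrier_mat p p" "V \<in> carrier_mat p q" "W \<in> carrier_mat q p" "D \<in> carrier_mat q q"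
    and "X \<in> carrier_mat p n" "Z \<in> carrier_mat q n"
  shows "four_block_mat U V W D * (X @\<^sub>r Z) = (U * X + V * Z) @\<^sub>r (W * X + D * Z)"
proof -
  have "four_block_mat U V W D * (X @\<^sub>r Z) =
     four_block_mat (U * X + V * Z) (U * 0\<^sub>m p 0 + V * 0\<^sub>m q 0) (W * X + D * Z) (W * 0\<^sub>m p 0 + D * 0\<^sub>m q 0)"
    unfolding append_rows_def using assms
    by (subst mult_four_block_mat[of _ p p _ q _ q _ _ n _ 0]) auto
  moreover have "U * 0\<^sub>m p 0 + V * 0\<^sub>m q 0 = 0\<^sub>m p 0" "W * 0\<^sub>m p 0 + D * 0\<^sub>m q 0 = 0\<^sub>m q 0"
    using assms by auto
  ultimately show ?thesis using assms by (simp add: append_rows_def)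
qed

text \<open>The stacked matrix is multiplied by a block triangular one of determinant
  \<open>det L\<close>. This serves twice: to remove the fitted values from the data, and to strip
  the regression mean and the covariance factor from them.\<close>

lemma gram_det_shear:
  assumes L: "L \<in> carrier_mat p p" and B: "B \<in> carrier_mat p q"
    and X: "X \<in> carrier_mat p n" and Z: "Z \<in> carrier_mat q n"
  shows "gram_det (rows (L * X + B * Z) @ rows Z) = (det L)\<^sup>2 * gram_det (rows X @ rows Z)"
proof -
  let ?T = "four_block_mat L B (0\<^sub>m q p) (1\<^sub>m q)"
  have "0\<^sub>m q p * X + 1\<^sub>m q * Z = Z" using X Z by auto
  then have "?T * (X @\<^sub>r Z) = (L * X + B * Z) @\<^sub>r Z"
    using mult_append_rows[OF L B _ _ X Z, of "0\<^sub>m q p" "1\<^sub>m q"] by simp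
  moreover have "det ?T = det L"
    using L B by (subst det_four_block_mat_lower_left_zero[of _ p _ q]) auto
  moreover have "gram_det (rows (?T * (X @\<^sub>r Z))) = (det ?T)\<^sup>2 * gram_det (rows (X @\<^sub>r Z))"
    by (rule gram_det_rows_mult[of _ "p + q" n]) (use assms in auto)
  ultimately show ?thesis
    using assms by (simp add: rows_append_rows[of _ p n _ q])
qed

lemma gram_det_orthogonal_rows:
  assumes R: "R \<in> carrier_mat p n" and Z: "Z \<in> carrier_mat q n" and RZ: "R * transpose_mat Z = 0\<^sub>m p q"
  shows "gram_det (rows R @ rows Z) = det (R * transpose_mat R) * gram_det (rows Z)"
proof -
  have ZR: "Z * transpose_mat R = 0\<^sub>m q p"
    using arg_cong[OF RZ, of transpose_mat] R Z by (simp add: transpose_mult[of _ p n _ q])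
  have a: "row R i \<bullet> row Z j = 0" if "i < p" "j < q" for i j
    using arg_cong[OF RZ, of "\<lambda>A. A $$ (i, j)"] that R Z by simp
  have b: "row Z j \<bullet> row R i = 0" if "i < p" "j < q" for i j
    using arg_cong[OF ZR, of "\<lambda>A. A $$ (j, i)"] that R Z by simp
  have "gram (rows R @ rows Z) = four_block_mat (R * transpose_mat R) (0\<^sub>m p q) (0\<^sub>m q p) (Z * transpose_mat Z)"
    by (intro eq_matI) (use R Z a b in \<open>auto simp: gram_def nth_append\<close>)
  then show ?thesis
    using R Z by (simp add: gram_det_def gram_mat_rows[OF Z] det_four_block_mat_upper_right_zero[of _ p _ q])
qed

text \<open>The normal equations make the residuals orthogonal to the rows of \<open>Z\<close>, so
  the Gram matrix of both is block diagonal; and the residuals arise from \<open>X\<close> by a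
  shear, which does not change the Gram determinant.\<close>

lemma gram_det_regression_residual:
  assumes X: "X \<in> carrier_mat p n" and Z: "Z \<in> carrier_mat q n" and d: "det (Z * transpose_mat Z) \<noteq> 0"
  defines "R \<equiv> X - X * transpose_mat Z * mat_inv (Z * transpose_mat Z) * Z"
  shows "det (R * transpose_mat R) * gram_det (rows Z) = gram_det (rows X @ rows Z)"
proof -
  let ?S = "Z * transpose_mat Z"
  have S: "?S \<in> carrier_mat q q" using Z by auto
  obtain S' where S': "S' \<in> carrier_mat q q" "?S * S' = 1\<^sub>m q" "S' * ?S = 1\<^sub>m q"
    using inverse_matE[OF S d] by blast
  have inv: "mat_inv ?S = S'" using mat_inv_eqI[OF S S'(1,2)] .
  let ?B = "X * transpose_mat Z * S'"
  have Zt: "transpose_mat Z \<in> carrier_mat n q" using Z by simp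
  have XZ: "X * transpose_mat Z \<in> carrier_mat p q" using X Z by auto
  have B: "?B \<in> carrier_mat p q" using XZ S' by auto
  have R2: "R = X - ?B * Z" by (simp only: R_def inv)
  have R1: "R \<in> carrier_mat p n" unfolding R2 by (rule minus_carrier_mat) (rule mult_carrier_mat[OF B Z])
  have "?B * Z * transpose_mat Z = ?B * ?S" by (rule assoc_mult_mat[OF B Z Zt])
  also have "\<dots> = X * transpose_mat Z * (S' * ?S)" by (rule assoc_mult_mat[OF XZ S'(1) S])
  also have "\<dots> = X * transpose_mat Z" unfolding S'(3) by (rule right_mult_one_mat[OF XZ])
  finally have "R * transpose_mat Z = 0\<^sub>m p q"
    unfolding R2 using X Z B by (subst minus_mult_distrib_mat[of _ p n _ _ q]) auto
  then have 1: "det (R * transpose_mat R) * gram_det (rows Z) = gram_det (rows R @ rows Z)"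
    using gram_det_orthogonal_rows[OF R1 Z] by simp
  have R3: "R = 1\<^sub>m p * X + (- ?B) * Z"
    unfolding R2 using X Z B by (intro eq_matI) (auto simp: scalar_prod_def sum_negf)
  have "gram_det (rows (1\<^sub>m p * X + (- ?B) * Z) @ rows Z) = (det (1\<^sub>m p :: real mat))\<^sup>2 * gram_det (rows X @ rows Z)"
    by (rule gram_det_shear) (use X Z B in auto)
  then show ?thesis unfolding 1 R3[symmetric] by simp
qed

text \<open>Column \<open>k\<close>, counted from \<open>0\<close>, is the observation \<open>x (Suc k)\<close>.\<close>

definition data_mat :: "nat \<Rightarrow> nat \<Rightarrow> (nat \<Rightarrow> real vec) \<Rightarrow> real mat" where
  "data_mat p n x = mat p n (\<lambda>(i, k). x (Suc k) $ i)"

lemma data_mat_carrier [simp]: "data_mat p n x \<in> carrier_mat p n"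
  by (simp add: data_mat_def)

lemma data_mat_dims [simp]: "dim_row (data_mat p n x) = p" "dim_col (data_mat p n x) = n"
  by (simp_all add: data_mat_def)

lemma mat_of_cols_data_mat: "mat_of_cols p (map x [1..<Suc n]) = data_mat p n x"
  by (intro eq_matI) (auto simp: mat_of_cols_def data_mat_def nth_append simp del: upt_Suc)

lemma mat_setsum_outer_prod:
  assumes "\<And>k. k \<in> {1..n} \<Longrightarrow> x k \<in> carrier_vec p" "\<And>k. k \<in> {1..n} \<Longrightarrow> y k \<in> carrier_vec q"
  shows "mat_setsum p q (\<lambda>k. outer_prod (x k) (y k)) {1..n} = data_mat p n x * transpose_mat (data_mat q n y)"
proof (intro eq_matI, goal_cases)
  case (1 i j)
  then have ij: "i < p" "j < q" by auto
  have "mat_setsum p q (\<lambda>k. outer_prod (x k) (y k)) {1..n} $$ (i, j) = (\<Sum>k\<in>{1..n}. x k $ i * y k $ j)"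
  proof -
    have "outer_prod (x k) (y k) $$ (i, j) = x k $ i * y k $ j" if "k \<in> {1..n}" for k
      using carrier_vecD[OF assms(1)[OF that]] carrier_vecD[OF assms(2)[OF that]] ij
      by (simp add: outer_prod_def)
    then show ?thesis unfolding mat_setsum_def using ij by (simp del: One_nat_def)
  qed
  also have "\<dots> = (\<Sum>k<n. x (Suc k) $ i * y (Suc k) $ j)"
    by (simp add: sum.atLeast1_atMost_eq)
  finally show ?case using ij by (simp add: scalar_prod_def data_mat_def lessThan_atLeast0)
qed (auto simp: mat_setsum_def)

lemma data_mat_cong:
  assumes "\<And>k. k \<in> {1..n} \<Longrightarrow> x k = y k"
  shows "data_mat p n x = data_mat p n y"
  using assms by (intro eq_matI) (auto simp: data_mat_def)

lemma data_mat_mult: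
  assumes "A \<in> carrier_mat p q" "\<And>k. k \<in> {1..n} \<Longrightarrow> z k \<in> carrier_vec q"
  shows "data_mat p n (\<lambda>k. A *\<^sub>v z k) = A * data_mat q n z"
proof -
  have "dim_vec (z (Suc k)) = q" if "k < n" for k using carrier_vecD[OF assms(2)[of "Suc k"]] that by simp
  then show ?thesis using assms(1) by (intro eq_matI) (auto simp: data_mat_def scalar_prod_def)
qed

lemma data_mat_add:
  assumes "\<And>k. k \<in> {1..n} \<Longrightarrow> y k \<in> carrier_vec p"
  shows "data_mat p n (\<lambda>k. x k + y k) = data_mat p n x + data_mat p n y"
proof -
  have "dim_vec (y (Suc k)) = p" if "k < n" for k using carrier_vecD[OF assms[of "Suc k"]] that by simp
  then show ?thesis by (intro eq_matI) (auto simp: data_mat_def)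
qed

lemma data_mat_minus:
  assumes "\<And>k. k \<in> {1..n} \<Longrightarrow> y k \<in> carrier_vec p"
  shows "data_mat p n (\<lambda>k. x k - y k) = data_mat p n x - data_mat p n y"
proof -
  have "dim_vec (y (Suc k)) = p" if "k < n" for k using carrier_vecD[OF assms[of "Suc k"]] that by simp
  then show ?thesis by (intro eq_matI) (auto simp: data_mat_def)
qed

text \<open>One formula for both estimators: the restricted one is the regression of the data minus
  their known part on the second block of the design. The mean drops out, and the covariance enters
  only through the square of \<open>det L\<close>, which later cancels in the quotient.\<close>

lemma det_residual_cov:
  assumes z: "\<And>k. k \<in> {1..n} \<Longrightarrow> z k \<in> carrier_vec q"
    and g: "\<And>k. k \<in> {1..n} \<Longrightarrow> g k \<in> carrier_vec p"
    and L: "L \<in> carrier_mat p p" and B: "B \<in> carrier_mat p q"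
    and x: "\<And>k. k \<in> {1..n} \<Longrightarrow> x k = L *\<^sub>v g k + B *\<^sub>v z k"
    and gz: "gram_det (rows (data_mat q n z)) \<noteq> 0"
  defines "C \<equiv> mat_setsum p q (\<lambda>k. outer_prod (x k) (z k)) {1..n} *
     mat_inv (mat_setsum q q (\<lambda>k. outer_prod (z k) (z k)) {1..n})"
  shows "det ((1 / real n) \<cdot>\<^sub>m mat_setsum p p (\<lambda>k. outer_prod (x k - C *\<^sub>v z k) (x k - C *\<^sub>v z k)) {1..n}) =
    (1 / real n) ^ p * (det L)\<^sup>2 * gram_det (rows (data_mat p n g) @ rows (data_mat q n z)) / gram_det (rows (data_mat q n z))"
proof -
  let ?Z = "data_mat q n z" and ?X = "data_mat p n x" and ?G = "data_mat p n g"
  have xc: "x k \<in> carrier_vec p" if "k \<in> {1..n}" for k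
    unfolding x[OF that] using L B g[OF that] z[OF that] by auto
  have d: "det (?Z * transpose_mat ?Z) \<noteq> 0"
    using gz gram_mat_rows[of ?Z q n] by (simp add: gram_det_def)
  have S: "?Z * transpose_mat ?Z \<in> carrier_mat q q" by auto
  obtain S' where S': "S' \<in> carrier_mat q q" "?Z * transpose_mat ?Z * S' = 1\<^sub>m q"
    using inverse_matE[OF S d] by blast
  have Ceq: "C = ?X * transpose_mat ?Z * mat_inv (?Z * transpose_mat ?Z)"
    unfolding C_def by (simp only: mat_setsum_outer_prod[OF xc z] mat_setsum_outer_prod[OF z z])
  have C: "C \<in> carrier_mat p q"
    unfolding Ceq mat_inv_eqI[OF S S'] by (rule mult_carrier_mat[OF mult_carrier_mat[OF data_mat_carrier] S'(1)]) simp
  let ?r = "\<lambda>k. x k - C *\<^sub>v z k"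
  have rc: "?r k \<in> carrier_vec p" if "k \<in> {1..n}" for k using xc[OF that] C z[OF that] by auto
  have R: "data_mat p n ?r = ?X - ?X * transpose_mat ?Z * mat_inv (?Z * transpose_mat ?Z) * ?Z"
  proof -
    have "C *\<^sub>v z k \<in> carrier_vec p" if "k \<in> {1..n}" for k using C z[OF that] by simp
    then have "data_mat p n ?r = ?X - data_mat p n (\<lambda>k. C *\<^sub>v z k)" by (rule data_mat_minus)
    also have "data_mat p n (\<lambda>k. C *\<^sub>v z k) = C * ?Z" by (rule data_mat_mult[OF C z])
    finally show ?thesis unfolding Ceq .
  qed
  have X: "?X = L * ?G + B * ?Z"
  proof -
    have "?X = data_mat p n (\<lambda>k. L *\<^sub>v g k + B *\<^sub>v z k)" by (rule data_mat_cong) (rule x)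
    also have "\<dots> = data_mat p n (\<lambda>k. L *\<^sub>v g k) + data_mat p n (\<lambda>k. B *\<^sub>v z k)"
      by (rule data_mat_add) (use mult_mat_vec_carrier[OF B z] in blast)
    finally show ?thesis by (simp only: data_mat_mult[OF L g] data_mat_mult[OF B z])
  qed
  have "det (data_mat p n ?r * transpose_mat (data_mat p n ?r)) * gram_det (rows ?Z) = gram_det (rows ?X @ rows ?Z)"
    unfolding R by (rule gram_det_regression_residual[OF _ _ d]) auto
  also have "\<dots> = (det L)\<^sup>2 * gram_det (rows ?G @ rows ?Z)"
    unfolding X by (rule gram_det_shear[OF L B]) auto
  finally have "det (data_mat p n ?r * transpose_mat (data_mat p n ?r)) = (det L)\<^sup>2 * gram_det (rows ?G @ rows ?Z) / gram_det (rows ?Z)"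
    using gz by (simp add: field_simps)
  moreover have "mat_setsum p p (\<lambda>k. outer_prod (?r k) (?r k)) {1..n} = data_mat p n ?r * transpose_mat (data_mat p n ?r)"
    by (rule mat_setsum_outer_prod[OF rc rc])
  ultimately show ?thesis
    by (simp only: det_smult carrier_matD[OF mult_carrier_mat[OF data_mat_carrier transpose_carrier_mat[THEN iffD2, OF data_mat_carrier]]]) (simp add: mult.assoc)
qed

lemma rows_data_mat_split:
  assumes z: "\<And>k. k \<in> {1..n} \<Longrightarrow> z k \<in> carrier_vec (q1 + q2)"
  shows "rows (data_mat (q1 + q2) n z) =
    rows (data_mat q1 n (\<lambda>k. vec_first (z k) q1)) @ rows (data_mat q2 n (\<lambda>k. vec_last (z k) q2))"
proof (rule nth_equalityI)
  fix i assume "i < length (rows (data_mat (q1 + q2) n z))"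
  then have i: "i < q1 + q2" by simp
  show "rows (data_mat (q1 + q2) n z) ! i =
      (rows (data_mat q1 n (\<lambda>k. vec_first (z k) q1)) @ rows (data_mat q2 n (\<lambda>k. vec_last (z k) q2))) ! i"
  proof (cases "i < q1")
    case True
    then show ?thesis using i
      by (intro eq_vecI) (auto simp: nth_append data_mat_def vec_first_def)
  next
    case False
    have "dim_vec (z (Suc k)) = q1 + q2" if "k < n" for k using z[of "Suc k"] that by auto
    then show ?thesis using i False
      by (intro eq_vecI) (auto simp: nth_append data_mat_def vec_last_def)
  qed
qed simp

lemma append_cols_mult_vec:
  assumes "A \<in> carrier_mat p q1" "B \<in> carrier_mat p q2" "z \<in> carrier_vec (q1 + q2)"
  shows "append_cols A B *\<^sub>v z = A *\<^sub>v vec_first z q1 + B *\<^sub>v vec_last z q2"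
proof -
  \<comment> \<open>The lower blocks in \<open>append_cols\<close> have no rows, so the appended
    second part is the empty vector.\<close>
  have "append_cols A B *\<^sub>v (vec_first z q1 @\<^sub>v vec_last z q2) =
     (A *\<^sub>v vec_first z q1 + B *\<^sub>v vec_last z q2) @\<^sub>v (0\<^sub>m 0 q1 *\<^sub>v vec_first z q1 + 0\<^sub>m 0 q2 *\<^sub>v vec_last z q2)"
    unfolding append_cols_def using assms by (subst four_block_mat_mult_vec[of _ p q1 _ q2 _ 0]) auto
  also have "\<dots> = A *\<^sub>v vec_first z q1 + B *\<^sub>v vec_last z q2"
    using assms by (intro eq_vecI) auto
  finally show ?thesis using assms by simp
qed

text \<open>The factor is built upper triangular, from the last row upwards: the Schur complement
  \<open>T\<close> of the last diagonal entry is again positive definite, and its factor becomes the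
  upper left block.\<close>

lemma positive_definite_cholesky:
  assumes "positive_definite_mat p S"
  shows "\<exists>L. L \<in> carrier_mat p p \<and> L * transpose_mat L = S"
  using assms
proof (induction p arbitrary: S)
  case 0
  then have "S = 1\<^sub>m 0" by (auto simp: positive_definite_mat_def)
  then show ?case by (intro exI[of _ "1\<^sub>m 0"]) auto
next
  case (Suc p)
  have S: "S \<in> carrier_mat (Suc p) (Suc p)" "transpose_mat S = S"
    and pos: "\<And>v. v \<in> carrier_vec (Suc p) \<Longrightarrow> v \<noteq> 0\<^sub>v (Suc p) \<Longrightarrow> v \<bullet> (S *\<^sub>v v) > 0"
    using Suc.prems by (auto simp: positive_definite_mat_def)
  have sym: "S $$ (i, j) = S $$ (j, i)" if "i < Suc p" "j < Suc p" for i j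
  proof -
    have "S $$ (i, j) = transpose_mat S $$ (i, j)" by (simp only: S(2))
    also have "\<dots> = S $$ (j, i)" using that S(1) by simp
    finally show ?thesis .
  qed
  define d where "d = S $$ (p, p)"
  have "unit_vec (Suc p) p \<noteq> (0\<^sub>v (Suc p) :: real vec)" by (rule unit_vec_nonzero) simp
  then have "unit_vec (Suc p) p \<bullet> (S *\<^sub>v unit_vec (Suc p) p) > 0" by (intro pos) auto
  then have d: "d > 0" using S by (simp add: d_def scalar_prod_left_unit scalar_prod_right_unit)
  define T where "T = mat p p (\<lambda>(i, j). S $$ (i, j) - S $$ (i, p) * S $$ (p, j) / d)"
  have T: "T \<in> carrier_mat p p" by (simp add: T_def)
  have quad: "v \<bullet> (A *\<^sub>v v) = (\<Sum>i<n. \<Sum>j<n. v $ i * A $$ (i, j) * v $ j)"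
    if "A \<in> carrier_mat n n" "v \<in> carrier_vec n" for A :: "real mat" and v n
    using that by (auto simp: scalar_prod_def sum_distrib_left lessThan_atLeast0 mult.assoc intro!: sum.cong)
  have "positive_definite_mat p T"
    unfolding positive_definite_mat_def
  proof (intro conjI ballI impI)
    show "transpose_mat T = T" by (intro eq_matI) (auto simp: T_def sym mult.commute)
    fix w :: "real vec" assume w: "w \<in> carrier_vec p" "w \<noteq> 0\<^sub>v p"
    define b where "b = (\<Sum>j<p. S $$ (p, j) * w $ j)"
    \<comment> \<open>The last coordinate \<open>- b / d\<close> minimises the quadratic form of
      \<open>S\<close> among the extensions of \<open>w\<close>; the minimum is the form of the
      Schur complement at \<open>w\<close>.\<close>
    define v where "v = vsnoc w (- b / d)"
    have v: "v \<in> carrier_vec (Suc p)" using w by (simp add: v_def vsnoc_carrier)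
    have vi: "v $ i = w $ i" if "i < p" for i using that w by (simp add: v_def index_vsnoc)
    have vp: "v $ p = - b / d" using w by (simp add: v_def index_vsnoc)
    have "v \<noteq> 0\<^sub>v (Suc p)"
    proof
      assume "v = 0\<^sub>v (Suc p)"
      then have "w $ i = 0" if "i < p" for i using vi[OF that] that by simp
      then have "w = 0\<^sub>v p" using w by (intro eq_vecI) auto
      with w show False by simp
    qed
    then have "0 < v \<bullet> (S *\<^sub>v v)" using pos v by simp
    also have "v \<bullet> (S *\<^sub>v v) = (\<Sum>i<Suc p. \<Sum>j<Suc p. v $ i * S $$ (i, j) * v $ j)"
      by (rule quad[OF S(1) v])
    also have "\<dots> = (\<Sum>i<p. \<Sum>j<p. w $ i * S $$ (i, j) * w $ j) + (\<Sum>i<p. w $ i * S $$ (i, p)) * (- b / d)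
        + (- b / d) * b + d * (b / d)\<^sup>2"
    proof -
      let ?F = "\<lambda>i j. v $ i * S $$ (i, j) * v $ j"
      have 1: "(\<Sum>i<p. ?F i p) = (\<Sum>i<p. w $ i * S $$ (i, p)) * (- b / d)"
        unfolding sum_distrib_right by (intro sum.cong) (simp_all add: vi vp)
      have "(\<Sum>j<p. ?F p j) = (\<Sum>j<p. (- b / d) * (S $$ (p, j) * w $ j))"
        by (intro sum.cong) (simp_all add: vi vp)
      also have "\<dots> = (- b / d) * b"
        by (subst sum_distrib_left[symmetric]) (simp only: b_def)
      finally have 2: "(\<Sum>j<p. ?F p j) = (- b / d) * b" .
      have 3: "?F p p = d * (b / d)\<^sup>2" by (simp add: vp d_def power2_eq_square)
      have 4: "(\<Sum>i<p. \<Sum>j<p. ?F i j) = (\<Sum>i<p. \<Sum>j<p. w $ i * S $$ (i, j) * w $ j)"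
        by (intro sum.cong) (simp_all add: vi)
      have "(\<Sum>i<Suc p. \<Sum>j<Suc p. ?F i j) = (\<Sum>i<p. \<Sum>j<p. ?F i j) + (\<Sum>i<p. ?F i p) + (\<Sum>j<p. ?F p j) + ?F p p"
        by (simp only: sum.lessThan_Suc sum.distrib add.assoc)
      then show ?thesis unfolding 1 2 3 4 .
    qed
    also have "(\<Sum>i<p. w $ i * S $$ (i, p)) = b"
      unfolding b_def by (intro sum.cong) (auto simp: sym)
    also have "(\<Sum>i<p. \<Sum>j<p. w $ i * S $$ (i, j) * w $ j) + b * (- b / d) + (- b / d) * b + d * (b / d)\<^sup>2 =
        (\<Sum>i<p. \<Sum>j<p. w $ i * S $$ (i, j) * w $ j) - b * b / d"
      using d by (simp add: power2_eq_square field_simps)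
    also have "b * b / d = (\<Sum>i<p. \<Sum>j<p. w $ i * (S $$ (i, p) * S $$ (p, j) / d) * w $ j)"
    proof -
      have "b * b = (\<Sum>i<p. w $ i * S $$ (i, p)) * (\<Sum>j<p. S $$ (p, j) * w $ j)"
        by (simp add: b_def[symmetric] \<open>(\<Sum>i<p. w $ i * S $$ (i, p)) = b\<close>)
      also have "\<dots> = (\<Sum>i<p. \<Sum>j<p. w $ i * S $$ (i, p) * (S $$ (p, j) * w $ j))"
        by (rule sum_product)
      finally show ?thesis by (simp add: sum_divide_distrib mult_ac)
    qed
    also have "(\<Sum>i<p. \<Sum>j<p. w $ i * S $$ (i, j) * w $ j) - (\<Sum>i<p. \<Sum>j<p. w $ i * (S $$ (i, p) * S $$ (p, j) / d) * w $ j) =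
        w \<bullet> (T *\<^sub>v w)"
      by (subst quad[OF T w(1)]) (simp add: T_def sum_subtractf[symmetric] algebra_simps)
    finally show "0 < w \<bullet> (T *\<^sub>v w)" .
  qed (rule T)
  then obtain K where K: "K \<in> carrier_mat p p" "K * transpose_mat K = T" using Suc.IH by blast
  define L where "L = four_block_mat K (mat p 1 (\<lambda>(i, j). S $$ (i, p) / sqrt d)) (0\<^sub>m 1 p) (mat 1 1 (\<lambda>_. sqrt d))"
  have L: "L \<in> carrier_mat (Suc p) (Suc p)" using K by (intro carrier_matI) (auto simp: L_def)
  have KK: "(\<Sum>k<p. K $$ (i, k) * K $$ (j, k)) = T $$ (i, j)" if "i < p" "j < p" for i j
    using arg_cong[OF K(2), of "\<lambda>A. A $$ (i, j)"] that K(1) by (simp add: scalar_prod_def lessThan_atLeast0)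
  have "L * transpose_mat L = S"
  proof (intro eq_matI, goal_cases)
    case (1 i j)
    then have ij: "i < Suc p" "j < Suc p" using S by auto
    have "(L * transpose_mat L) $$ (i, j) = (\<Sum>k<Suc p. L $$ (i, k) * L $$ (j, k))"
      using L ij by (simp add: scalar_prod_def lessThan_atLeast0)
    also have "\<dots> = S $$ (i, j)"
    proof (cases "i < p"; cases "j < p")
      assume "i < p" "j < p"
      then have "(\<Sum>k<Suc p. L $$ (i, k) * L $$ (j, k)) = T $$ (i, j) + S $$ (i, p) * S $$ (j, p) / d"
        using K(1) d by (simp add: L_def KK[symmetric])
      then show ?thesis using \<open>i < p\<close> \<open>j < p\<close> by (simp add: T_def sym)
    qed (use ij K(1) d in \<open>auto simp: L_def less_Suc_eq sym d_def\<close>)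
    finally show ?case .
  qed (use L S in auto)
  then show ?case using L by blast
qed

section \<open>Characteristic function of the logarithm of the Gram ratio\<close>

text \<open>
  The quotient of the two residual covariance determinants if \<open>Gs\<close> are the rows of the
  standardized data.
\<close>

definition gram_ratio :: "real vec list \<Rightarrow> real vec list \<Rightarrow> real vec list \<Rightarrow> real" where
  "gram_ratio Z1 Z2 Gs = gram_det (Gs @ Z1 @ Z2) * gram_det Z2 / (gram_det (Z1 @ Z2) * gram_det (Gs @ Z2))"

lemma gram_det_snoc_nonzero:
  assumes "gram_det (Gs @ Z) \<noteq> 0" "sq_dist (Gs @ Z) g \<noteq> 0"
  shows "gram_det ((Gs @ [g]) @ Z) \<noteq> 0"
proof -
  have "gram_det ((Gs @ [g]) @ Z) = gram_det (g # Gs @ Z)" by (rule gram_det_mset) simp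
  then show ?thesis using assms by (auto simp: sq_dist_def)
qed

text \<open>All Gram determinants without the new vector cancel. The order
  \<open>Z1 @ Gs @ Z2\<close> puts the smaller subspace, spanned by \<open>Gs @ Z2\<close>, at the
  end of the list, as the formula for two nested distances expects.\<close>

lemma gram_ratio_snoc:
  assumes Z1: "set Z1 \<subseteq> carrier_vec n" and Z2: "set Z2 \<subseteq> carrier_vec n" and Gs: "set Gs \<subseteq> carrier_vec n"
    and nz: "gram_det (Gs @ Z1 @ Z2) \<noteq> 0"
  shows "gram_ratio Z1 Z2 (Gs @ [g]) = gram_ratio Z1 Z2 Gs * (sq_dist (Z1 @ Gs @ Z2) g / sq_dist (Gs @ Z2) g)"
    and "gram_ratio Z1 Z2 Gs > 0" and "gram_det (Z1 @ Gs @ Z2) \<noteq> 0"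
proof -
  have m: "gram_det ((Gs @ [g]) @ Z1 @ Z2) = gram_det (g # Z1 @ Gs @ Z2)" "gram_det (Gs @ Z1 @ Z2) = gram_det (Z1 @ Gs @ Z2)"
    "gram_det ((Gs @ [g]) @ Z2) = gram_det (g # Gs @ Z2)"
    by (rule gram_det_mset; simp)+
  show nz': "gram_det (Z1 @ Gs @ Z2) \<noteq> 0" using nz m by simp
  have "gram_det (Gs @ Z2) \<noteq> 0"
    by (rule gram_det_suffix_nonzero[of Z1 n]) (use Z1 Z2 Gs nz' in auto)
  moreover have "gram_det (Z1 @ Z2) \<noteq> 0"
    by (rule gram_det_suffix_nonzero[of Gs n]) (use Z1 Z2 Gs nz in auto)
  moreover have "gram_det Z2 \<noteq> 0"
    by (rule gram_det_suffix_nonzero[of "Gs @ Z1" n]) (use Z1 Z2 Gs nz in auto)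
  moreover have "gram_det (Gs @ Z2) \<ge> 0" "gram_det (Z1 @ Z2) \<ge> 0" "gram_det Z2 \<ge> 0" "gram_det (Gs @ Z1 @ Z2) \<ge> 0"
    using Z1 Z2 Gs by (auto intro!: gram_det_nonneg[of _ n])
  ultimately show "gram_ratio Z1 Z2 Gs > 0"
    unfolding gram_ratio_def using nz by (intro divide_pos_pos mult_pos_pos) auto
  show "gram_ratio Z1 Z2 (Gs @ [g]) = gram_ratio Z1 Z2 Gs * (sq_dist (Z1 @ Gs @ Z2) g / sq_dist (Gs @ Z2) g)"
    using \<open>gram_det (Gs @ Z2) \<noteq> 0\<close> nz' unfolding gram_ratio_def sq_dist_def m by simp
qed

lemma borel_measurable_gram_det_rows:
  assumes "set Z \<subseteq> carrier_vec n" "\<And>i. i < p \<Longrightarrow> (\<lambda>w. r w i) \<in> measurable N (borel_vec n)"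
  shows "(\<lambda>w. gram_det (map (r w) [0..<p] @ Z)) \<in> borel_measurable N"
proof -
  have "(\<lambda>w. gram_det (map (\<lambda>f. f w) (map (\<lambda>i w. r w i) [0..<p] @ map (\<lambda>z _. z) Z))) \<in> borel_measurable N"
    by (rule borel_measurable_gram_det[of _ _ n]) (use assms in auto)
  then show ?thesis by (simp add: comp_def)
qed

lemma borel_measurable_gram_ratio:
  assumes Z: "set Z1 \<subseteq> carrier_vec n" "set Z2 \<subseteq> carrier_vec n"
    and r: "\<And>i. i < p \<Longrightarrow> (\<lambda>w. r w i) \<in> measurable N (borel_vec n)"
  shows "(\<lambda>w. gram_ratio Z1 Z2 (map (r w) [0..<p])) \<in> borel_measurable N"
  unfolding gram_ratio_def using Z
  by (intro borel_measurable_divide borel_measurable_times borel_measurable_const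
      borel_measurable_gram_det_rows[of _ n] r) auto

abbreviation normal_rows :: "nat \<Rightarrow> nat \<Rightarrow> (nat \<Rightarrow> real vec) measure" where
  "normal_rows n p \<equiv> Pi\<^sub>M {..<p} (\<lambda>_. std_normal_vec n)"

lemma measurable_normal_rows_component:
  "i < p \<Longrightarrow> (\<lambda>w. w i) \<in> measurable (normal_rows n p) (borel_vec n)"
  using measurable_component_singleton[of i "{..<p}" "\<lambda>_. std_normal_vec n"]
  by (simp add: measurable_cong_sets[OF refl sets_iid_vec])

lemma space_normal_rows: "x \<in> space (normal_rows n p) \<Longrightarrow> i < p \<Longrightarrow> x i \<in> carrier_vec n"
  by (auto simp: space_PiM)

lemma map_fun_upd_upt: "map (x(p := y)) [0..<Suc p] = map x [0..<p] @ [y]"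
  by simp

text \<open>Given the earlier rows, the next one almost surely keeps a positive distance from the
  span of fewer than n vectors; the rows are adjoined one by one.\<close>

lemma AE_gram_det_rows_nonzero:
  assumes Z: "set Z \<subseteq> carrier_vec n" and gr: "gram_det Z \<noteq> 0" and len: "p + length Z \<le> n"
  shows "AE w in normal_rows n p. gram_det (map w [0..<p] @ Z) \<noteq> 0"
  using len
proof (induction p)
  case 0
  then show ?case using gr by simp
next
  case (Suc p)
  interpret product_sigma_finite "\<lambda>_::nat. std_normal_vec n"
    by (rule product_sigma_finite.intro) (rule prob_space_imp_sigma_finite[OF prob_space_std_normal_vec])
  have ins: "{..<Suc p} = insert p {..<p}" by auto
  \<comment> \<open>The exceptional event is written as an integral of its indicator so that Fubini
    isolates the last row.\<close>
  let ?h = "\<lambda>w. indicator {x. x = 0} (gram_det (map w [0..<Suc p] @ Z)) :: ennreal"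
  have meas: "(\<lambda>w. gram_det (map w [0..<Suc p] @ Z)) \<in> borel_measurable (normal_rows n (Suc p))"
    by (rule borel_measurable_gram_det_rows[OF Z measurable_normal_rows_component])
  have h: "?h \<in> borel_measurable (normal_rows n (Suc p))"
    by (rule measurable_compose[OF meas]) simp
  have IH: "AE w in normal_rows n p. gram_det (map w [0..<p] @ Z) \<noteq> 0" using Suc by simp
  have "(\<integral>\<^sup>+w. ?h w \<partial>normal_rows n (Suc p)) = (\<integral>\<^sup>+x. \<integral>\<^sup>+y. ?h (x(p := y)) \<partial>std_normal_vec n \<partial>normal_rows n p)"
    unfolding ins by (rule product_nn_integral_insert) (use h in \<open>simp_all add: ins\<close>)
  also have "\<dots> = (\<integral>\<^sup>+x. 0 \<partial>normal_rows n p)"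
  proof (rule nn_integral_cong_AE)
    show "AE x in normal_rows n p. (\<integral>\<^sup>+y. ?h (x(p := y)) \<partial>std_normal_vec n) = 0"
      using IH AE_space
    proof eventually_elim
      case (elim x)
      let ?V = "map x [0..<p] @ Z"
      have V: "set ?V \<subseteq> carrier_vec n" using Z space_normal_rows[OF elim(2)] by auto
      have "AE y in std_normal_vec n. sq_dist ?V y > 0"
        by (rule AE_sq_dist_pos[OF V elim(1)]) (use Suc.prems in simp)
      then have "AE y in std_normal_vec n. ?h (x(p := y)) = 0"
      proof eventually_elim
        case (elim y)
        then have "gram_det ((map x [0..<p] @ [y]) @ Z) \<noteq> 0"
          using \<open>gram_det ?V \<noteq> 0\<close> by (intro gram_det_snoc_nonzero) auto
        then show ?case unfolding map_fun_upd_upt by simp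
      qed
      then have "(\<integral>\<^sup>+y. ?h (x(p := y)) \<partial>std_normal_vec n) = (\<integral>\<^sup>+y. 0 \<partial>std_normal_vec n)"
        by (rule nn_integral_cong_AE)
      then show ?case by simp
    qed
  qed
  finally have "(\<integral>\<^sup>+w. ?h w \<partial>normal_rows n (Suc p)) = 0" by simp
  then have "AE w in normal_rows n (Suc p). ?h w = 0"
    using h by (subst (asm) nn_integral_0_iff_AE) auto
  then show ?case by eventually_elim (auto simp: indicator_def split: if_splits)
qed

text \<open>The last row is integrated first. For almost all earlier rows its integral is the same
  number \<open>c\<close>, because the law of the distance ratio depends only on the numbers of
  vectors; so each row contributes one factor.\<close>

proposition integral_cis_ln_gram_ratio:
  assumes Z1: "set Z1 \<subseteq> carrier_vec n" and Z2: "set Z2 \<subseteq> carrier_vec n" and gr: "gram_det (Z1 @ Z2) \<noteq> 0"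
    and len: "p + (length Z1 + length Z2) \<le> n"
  shows "(\<integral>w. cis (t * ln (gram_ratio Z1 Z2 (map w [0..<p]))) \<partial>normal_rows n p) =
    (\<Prod>j<p. gamma_ratio (n - (length Z1 + length Z2) - j) t / gamma_ratio (n - length Z2 - j) t)"
  using len
proof (induction p)
  case 0
  have "gram_det Z2 \<noteq> 0" using gram_det_suffix_nonzero[OF Z1 Z2 gr] .
  then show ?case using gr by (simp add: gram_ratio_def PiM_empty)
next
  case (Suc p)
  note upt_Suc [simp del]
  interpret sigma_finite_measure "std_normal_vec n"
    by (rule prob_space_imp_sigma_finite[OF prob_space_std_normal_vec])
  interpret product_sigma_finite "\<lambda>_::nat. std_normal_vec n"
    by (rule product_sigma_finite.intro) (rule prob_space_imp_sigma_finite[OF prob_space_std_normal_vec])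
  interpret P: prob_space "normal_rows n (Suc p)"
    by (intro prob_space_PiM prob_space_std_normal_vec)
  have ins: "{..<Suc p} = insert p {..<p}" by auto
  let ?f = "\<lambda>k w. cis (t * ln (gram_ratio Z1 Z2 (map w [0..<k])))"
  have f: "?f k \<in> borel_measurable (normal_rows n k)" for k
    using borel_measurable_gram_ratio[OF Z1 Z2 measurable_normal_rows_component] by measurable
  have fi: "integrable (normal_rows n (Suc p)) (?f (Suc p))"
    by (rule P.integrable_const_bound[where B = 1, OF _ f]) simp
  define q where "q = length Z1 + length Z2"
  define c where "c = gamma_ratio (n - q - p) t / gamma_ratio (n - length Z2 - p) t"
  have "(\<lambda>(x, y). ?f (Suc p) (x(p := y))) \<in> borel_measurable (normal_rows n p \<Otimes>\<^sub>M std_normal_vec n)"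
    using measurable_compose[OF measurable_add_dim[of p "{..<p}" "\<lambda>_. std_normal_vec n"], of "?f (Suc p)" borel] f[of "Suc p"]
    by (simp add: ins case_prod_unfold)
  then have meas: "(\<lambda>x. \<integral>y. ?f (Suc p) (x(p := y)) \<partial>std_normal_vec n) \<in> borel_measurable (normal_rows n p)"
    by (rule borel_measurable_lebesgue_integral)
  have "(\<integral>w. ?f (Suc p) w \<partial>normal_rows n (Suc p)) = (\<integral>x. (\<integral>y. ?f (Suc p) (x(p := y)) \<partial>std_normal_vec n) \<partial>normal_rows n p)"
    unfolding ins by (rule product_integral_insert) (use fi in \<open>simp_all add: ins\<close>)
  also have "\<dots> = (\<integral>x. ?f p x * c \<partial>normal_rows n p)"
  proof (rule integral_cong_AE)
    show "(\<lambda>x. \<integral>y. ?f (Suc p) (x(p := y)) \<partial>std_normal_vec n) \<in> borel_measurable (normal_rows n p)" by (rule meas)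
    show "(\<lambda>x. ?f p x * c) \<in> borel_measurable (normal_rows n p)" using f[of p] by measurable
    have "AE x in normal_rows n p. gram_det (map x [0..<p] @ Z1 @ Z2) \<noteq> 0"
      by (rule AE_gram_det_rows_nonzero) (use Z1 Z2 gr Suc.prems in auto)
    then show "AE x in normal_rows n p. (\<integral>y. ?f (Suc p) (x(p := y)) \<partial>std_normal_vec n) = ?f p x * c"
      using AE_space
    proof eventually_elim
      case (elim x)
      let ?Gs = "map x [0..<p]"
      have Gs: "set ?Gs \<subseteq> carrier_vec n" using space_normal_rows[OF elim(2)] by auto
      note gs = gram_ratio_snoc[OF Z1 Z2 Gs elim(1)]
      let ?R = "\<lambda>y. sq_dist (Z1 @ ?Gs @ Z2) y / sq_dist (?Gs @ Z2) y"
      have nz2: "gram_det (?Gs @ Z2) \<noteq> 0"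
        by (rule gram_det_suffix_nonzero[of Z1 n]) (use Z1 Z2 Gs gs(3) in auto)
      have V: "set (Z1 @ ?Gs @ Z2) \<subseteq> carrier_vec n" "set (?Gs @ Z2) \<subseteq> carrier_vec n" using Z1 Z2 Gs by auto
      have mR: "?R \<in> borel_measurable (std_normal_vec n)"
        using borel_measurable_sq_dist[OF V(1)] borel_measurable_sq_dist[OF V(2)]
        by (simp add: measurable_cong_sets[OF sets_iid_vec refl])
      have "(\<integral>y. ?f (Suc p) (x(p := y)) \<partial>std_normal_vec n) = (\<integral>y. ?f p x * cis (t * ln (?R y)) \<partial>std_normal_vec n)"
      proof (rule integral_cong_AE)
        have "AE y in std_normal_vec n. sq_dist (Z1 @ ?Gs @ Z2) y > 0"
          by (rule AE_sq_dist_pos[OF V(1) gs(3)]) (use Suc.prems in simp)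
        moreover have "AE y in std_normal_vec n. sq_dist (?Gs @ Z2) y > 0"
          by (rule AE_sq_dist_pos[OF V(2) nz2]) (use Suc.prems in simp)
        ultimately show "AE y in std_normal_vec n. ?f (Suc p) (x(p := y)) = ?f p x * cis (t * ln (?R y))"
        proof eventually_elim
          case (elim y)
          then have R: "?R y > 0" by simp
          show ?case
            unfolding map_fun_upd_upt gs(1) ln_mult_pos[OF gs(2) R] cis_mult by (simp only: distrib_left)
        qed
        show "(\<lambda>y. ?f (Suc p) (x(p := y))) \<in> borel_measurable (std_normal_vec n)"
        proof (rule measurable_compose[OF _ f])
          show "(\<lambda>y. x(p := y)) \<in> measurable (std_normal_vec n) (normal_rows n (Suc p))"
            unfolding ins by (rule measurable_component_update[OF elim(2)]) simp
        qed
        show "(\<lambda>y. ?f p x * cis (t * ln (?R y))) \<in> borel_measurable (std_normal_vec n)" using mR by measurable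
      qed
      also have "\<dots> = ?f p x * (\<integral>y. cis (t * ln (?R y)) \<partial>std_normal_vec n)"
        by simp
      also have "(\<integral>y. cis (t * ln (?R y)) \<partial>std_normal_vec n) = c"
        using integral_cis_ln_sq_dist_ratio[OF Z1 V(2) gs(3), of t] Suc.prems
        by (simp add: c_def q_def add_ac diff_diff_left)
      finally show ?case .
    qed
  qed
  also have "\<dots> = (\<integral>x. ?f p x \<partial>normal_rows n p) * c" by simp
  also have "(\<integral>x. ?f p x \<partial>normal_rows n p) = (\<Prod>j<p. gamma_ratio (n - q - j) t / gamma_ratio (n - length Z2 - j) t)"
    using Suc unfolding q_def by simp
  finally show ?case unfolding c_def q_def by simp
qed

section \<open>From independent observations to independent rows\<close>

text \<open>The scalars of one large product are grouped by their first index. Groups over disjoint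
  index sets are independent, and reindexing a single group gives the law
  \<open>iid_vec \<nu> p\<close>.\<close>

lemma distr_PiM_blocks:
  fixes \<nu> :: "real measure" and K :: "'k set"
  assumes \<nu>: "prob_space \<nu>" and s: "sets \<nu> = sets borel" and K: "finite K" "K \<noteq> {}" and p: "p > 0"
  shows "distr (Pi\<^sub>M (K \<times> {..<p}) (\<lambda>_. \<nu>)) (Pi\<^sub>M K (\<lambda>_. borel_vec p)) (\<lambda>h. \<lambda>k\<in>K. vec p (\<lambda>i. h (k, i))) =
    Pi\<^sub>M K (\<lambda>_. iid_vec \<nu> p)"
proof -
  let ?H = "Pi\<^sub>M (K \<times> {..<p}) (\<lambda>_. \<nu>)"
  interpret H: prob_space ?H by (intro prob_space_PiM \<nu>)
  have ne: "K \<times> {..<p} \<noteq> {}" using K p by (auto simp: lessThan_empty_iff)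
  have comp: "(\<lambda>h. h j) \<in> measurable ?H \<nu>" if "j \<in> K \<times> {..<p}" for j
    using that by (rule measurable_component_singleton)
  have "H.indep_vars (\<lambda>_. \<nu>) (\<lambda>j h. h j) (K \<times> {..<p})"
  proof (subst H.indep_vars_iff_distr_eq_PiM'[OF ne comp])
    have "distr ?H ?H (\<lambda>x. restrict x (K \<times> {..<p})) = distr ?H ?H (\<lambda>x. x)"
      by (intro distr_cong refl) (auto simp: space_PiM PiE_restrict)
    also have "\<dots> = ?H" by (rule distr_id)
    also have "?H = Pi\<^sub>M (K \<times> {..<p}) (\<lambda>i. distr ?H \<nu> (\<lambda>h. h i))"
      by (intro PiM_cong refl distr_PiM_component[symmetric] \<nu>)
    finally show "distr ?H ?H (\<lambda>x. \<lambda>i\<in>K \<times> {..<p}. x i) = Pi\<^sub>M (K \<times> {..<p}) (\<lambda>i. distr ?H \<nu> (\<lambda>h. h i))" .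
  qed
  then have "H.indep_vars (\<lambda>k. Pi\<^sub>M ({k} \<times> {..<p}) (\<lambda>_. \<nu>)) (\<lambda>k h. restrict (\<lambda>j. h j) ({k} \<times> {..<p})) K"
    by (rule H.indep_vars_restrict) (auto simp: disjoint_family_on_def)
  then have "H.indep_vars (\<lambda>_. borel_vec p) (\<lambda>k h. vec p (\<lambda>i. restrict (\<lambda>j. h j) ({k} \<times> {..<p}) (k, i))) K"
  proof (rule H.indep_vars_compose2[where Y = "\<lambda>k g. vec p (\<lambda>i. g (k, i))"])
    fix k assume "k \<in> K"
    show "(\<lambda>g. vec p (\<lambda>i. g (k, i))) \<in> measurable (Pi\<^sub>M ({k} \<times> {..<p}) (\<lambda>_. \<nu>)) (borel_vec p)"
    proof (rule measurable_borel_vecI)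
      fix i assume i: "i < p"
      have "(\<lambda>g. g (k, i)) \<in> measurable (Pi\<^sub>M ({k} \<times> {..<p}) (\<lambda>_. \<nu>)) \<nu>"
        using i by (intro measurable_component_singleton) auto
      then show "(\<lambda>g. vec p (\<lambda>i. g (k, i)) $ i) \<in> borel_measurable (Pi\<^sub>M ({k} \<times> {..<p}) (\<lambda>_. \<nu>))"
        using i by (simp add: measurable_cong_sets[OF refl s])
    qed auto
  qed
  moreover have "vec p (\<lambda>i. restrict (\<lambda>j. h j) ({k} \<times> {..<p}) (k, i)) = vec p (\<lambda>i. h (k, i))" for k and h :: "'k \<times> nat \<Rightarrow> real"
    by (intro eq_vecI) auto
  ultimately have ind: "H.indep_vars (\<lambda>_. borel_vec p) (\<lambda>k h. vec p (\<lambda>i. h (k, i))) K" by simp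
  have mv: "(\<lambda>h. vec p (\<lambda>i. h (k, i))) \<in> measurable ?H (borel_vec p)" if "k \<in> K" for k
    using ind that by (auto simp: H.indep_vars_def)
  have "distr ?H (borel_vec p) (\<lambda>h. vec p (\<lambda>i. h (k, i))) = iid_vec \<nu> p" if k: "k \<in> K" for k
  proof -
    have r: "(\<lambda>h. \<lambda>i\<in>{..<p}. h (k, i)) \<in> measurable ?H (Pi\<^sub>M {..<p} (\<lambda>_. \<nu>))"
      using k by (intro measurable_restrict comp) auto
    have "iid_vec \<nu> p = distr (distr ?H (Pi\<^sub>M {..<p} (\<lambda>_. \<nu>)) (\<lambda>h. \<lambda>i\<in>{..<p}. h (k, i))) (borel_vec p) (vec p)"
      unfolding iid_vec_def
      by (subst distr_PiM_reindex[of "K \<times> {..<p}" "\<lambda>_. \<nu>" "\<lambda>i. (k, i)" "{..<p}"]) (use \<nu> k in \<open>auto simp: inj_on_def\<close>)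
    also have "\<dots> = distr ?H (borel_vec p) (vec p \<circ> (\<lambda>h. \<lambda>i\<in>{..<p}. h (k, i)))"
      by (rule distr_distr[OF measurable_vec_iid[OF s] r])
    also have "\<dots> = distr ?H (borel_vec p) (\<lambda>h. vec p (\<lambda>i. h (k, i)))"
      by (intro distr_cong refl eq_vecI) auto
    finally show ?thesis by simp
  qed
  then have "Pi\<^sub>M K (\<lambda>k. distr ?H (borel_vec p) (\<lambda>h. vec p (\<lambda>i. h (k, i)))) = Pi\<^sub>M K (\<lambda>_. iid_vec \<nu> p)"
    by (intro PiM_cong refl) auto
  then show ?thesis
    using H.indep_vars_iff_distr_eq_PiM'[OF K(2) mv] ind by simp
qed

lemma measurable_transpose_rows:
  "(\<lambda>g. \<lambda>i\<in>{..<p}. vec n (\<lambda>k. g (Suc k) $ i :: real))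
    \<in> measurable (Pi\<^sub>M {1..n} (\<lambda>_. borel_vec p)) (Pi\<^sub>M {..<p} (\<lambda>_. borel_vec n))"
proof (intro measurable_restrict measurable_borel_vecI)
  fix i k assume "i \<in> {..<p}" "k < n"
  then have "(\<lambda>g. g (Suc k)) \<in> measurable (Pi\<^sub>M {1..n} (\<lambda>_. borel_vec p)) (borel_vec p)"
    by (intro measurable_component_singleton) auto
  then have "(\<lambda>g. g (Suc k) $ i) \<in> borel_measurable (Pi\<^sub>M {1..n} (\<lambda>_. borel_vec p))"
    by (rule measurable_compose) (use \<open>i \<in> {..<p}\<close> in \<open>auto intro: measurable_vec_index\<close>)
  then show "(\<lambda>g. vec n (\<lambda>k. g (Suc k) $ i) $ k) \<in> borel_measurable (Pi\<^sub>M {1..n} (\<lambda>_. borel_vec p))"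
    using \<open>k < n\<close> by simp
qed auto

text \<open>Both sides are images of the same array of n * p independent standard normal scalars,
  read by observations on the left and by coordinates on the right. Observations are numbered from 1
  and vector entries from 0, hence the \<open>Suc\<close>.\<close>

lemma distr_transpose_normal:
  assumes n: "n > 0" and p: "p > 0"
  shows "distr (Pi\<^sub>M {1..n} (\<lambda>_. std_normal_vec p)) (Pi\<^sub>M {..<p} (\<lambda>_. borel_vec n))
      (\<lambda>g. \<lambda>i\<in>{..<p}. vec n (\<lambda>k. g (Suc k) $ i)) = normal_rows n p"
proof -
  let ?\<nu> = "std_normal_distribution"
  let ?H1 = "Pi\<^sub>M ({1..n} \<times> {..<p}) (\<lambda>_. ?\<nu>)" and ?H2 = "Pi\<^sub>M ({..<p} \<times> {..<n}) (\<lambda>_. ?\<nu>)"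
  let ?U1 = "\<lambda>h. \<lambda>k\<in>{1..n}. vec p (\<lambda>i. h (k, i) :: real)" and ?U2 = "\<lambda>h. \<lambda>i\<in>{..<p}. vec n (\<lambda>k. h (i, k) :: real)"
  let ?T = "\<lambda>g. \<lambda>i\<in>{..<p}. vec n (\<lambda>k. g (Suc k) $ i :: real)"
  let ?s = "\<lambda>h. \<lambda>j\<in>{..<p} \<times> {..<n}. h (case j of (i, k) \<Rightarrow> (Suc k, i))"
  note b1 = distr_PiM_blocks[OF prob_space_std_normal, of "{1..n}" p]
  note b2 = distr_PiM_blocks[OF prob_space_std_normal, of "{..<p}" n]
  have mU1: "?U1 \<in> measurable ?H1 (Pi\<^sub>M {1..n} (\<lambda>_. borel_vec p))"
  proof (intro measurable_restrict measurable_borel_vecI)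
    fix k i assume "k \<in> {1..n}" "i < p"
    then have "(\<lambda>h. h (k, i)) \<in> measurable ?H1 ?\<nu>" by (intro measurable_component_singleton) auto
    then show "(\<lambda>h. vec p (\<lambda>i. h (k, i)) $ i) \<in> borel_measurable ?H1" using \<open>i < p\<close> by simp
  qed auto
  have mU2: "?U2 \<in> measurable ?H2 (Pi\<^sub>M {..<p} (\<lambda>_. borel_vec n))"
  proof (intro measurable_restrict measurable_borel_vecI)
    fix k i assume "k \<in> {..<p}" "i < n"
    then have "(\<lambda>h. h (k, i)) \<in> measurable ?H2 ?\<nu>" by (intro measurable_component_singleton) auto
    then show "(\<lambda>h. vec n (\<lambda>i. h (k, i)) $ i) \<in> borel_measurable ?H2" using \<open>i < n\<close> by simp
  qed auto
  note mT = measurable_transpose_rows[of n p]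
  have ms: "?s \<in> measurable ?H1 ?H2"
    by (intro measurable_restrict measurable_component_singleton) auto
  have re: "distr ?H1 ?H2 ?s = ?H2"
    by (rule distr_PiM_reindex[of "{1..n} \<times> {..<p}" "\<lambda>_. ?\<nu>" "\<lambda>j. case j of (i, k) \<Rightarrow> (Suc k, i)" "{..<p} \<times> {..<n}"])
       (auto simp: inj_on_def prob_space_std_normal)
  have "distr (Pi\<^sub>M {1..n} (\<lambda>_. std_normal_vec p)) (Pi\<^sub>M {..<p} (\<lambda>_. borel_vec n)) ?T =
     distr (distr ?H1 (Pi\<^sub>M {1..n} (\<lambda>_. borel_vec p)) ?U1) (Pi\<^sub>M {..<p} (\<lambda>_. borel_vec n)) ?T"
    using b1 n p by simp
  also have "\<dots> = distr ?H1 (Pi\<^sub>M {..<p} (\<lambda>_. borel_vec n)) (?T \<circ> ?U1)"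
    by (rule distr_distr[OF mT mU1])
  also have "\<dots> = distr ?H1 (Pi\<^sub>M {..<p} (\<lambda>_. borel_vec n)) (?U2 \<circ> ?s)"
  proof (intro distr_cong refl)
    fix h
    have "vec n (\<lambda>k. ?U1 h (Suc k) $ i) = vec n (\<lambda>k. ?s h (i, k))" if "i < p" for i
      using that by (intro eq_vecI) auto
    then show "(?T \<circ> ?U1) h = (?U2 \<circ> ?s) h" by (auto simp: fun_eq_iff restrict_def)
  qed
  also have "\<dots> = distr (distr ?H1 ?H2 ?s) (Pi\<^sub>M {..<p} (\<lambda>_. borel_vec n)) ?U2"
    by (rule distr_distr[OF mU2 ms, symmetric])
  also have "\<dots> = normal_rows n p" unfolding re using b2 n p by (simp add: lessThan_empty_iff)
  finally show ?thesis .
qed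

section \<open>Asymptotics of the products of Gamma quotients\<close>

text \<open>Only the exponential of \<open>ln_Gamma\<close> enters, so the choice of its branch does
  not affect the identity.\<close>

lemma gamma_ratio_eq_exp:
  assumes "k > 0"
  shows "gamma_ratio k t = exp (lgam_vert t (real k))"
proof -
  have r: "real k / 2 > 0" using assms by simp
  have "Complex (real k / 2) t \<notin> \<int>\<^sub>\<le>\<^sub>0"
    using assms by (auto elim!: nonpos_Ints_cases simp: complex_eq_iff)
  then have "exp (ln_Gamma (Complex (real k / 2) t)) = Gamma (Complex (real k / 2) t)"
    using Gamma_complex_altdef by metis
  moreover have "exp (ln_Gamma (complex_of_real (real k / 2))) = of_real (Gamma (real k / 2))"
    by (simp only: ln_Gamma_complex_of_real[OF r] exp_of_real Gamma_real_pos_exp[OF r])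
  ultimately show ?thesis by (simp only: gamma_ratio_def lgam_vert_def exp_diff)
qed

lemma prod_gamma_ratio_eq_exp:
  assumes "p < m"
  shows "(\<Prod>j<p. gamma_ratio (m - j) t / gamma_ratio (m + k - j) t) =
    exp ((\<Sum>j<p. lgam_vert t (real (m - j))) - (\<Sum>j<p. lgam_vert t (real (m + k - j))))"
proof -
  have "(\<Prod>j<p. gamma_ratio (m - j) t / gamma_ratio (m + k - j) t) =
    (\<Prod>j<p. exp (lgam_vert t (real (m - j)) - lgam_vert t (real (m + k - j))))"
    using assms by (intro prod.cong refl) (simp add: gamma_ratio_eq_exp exp_diff)
  also have "\<dots> = exp (\<Sum>j<p. lgam_vert t (real (m - j)) - lgam_vert t (real (m + k - j)))"
    by (simp only: exp_sum finite_lessThan)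
  finally show ?thesis by (simp only: sum_subtractf)
qed

text \<open>This is the centring sequence without \<open>\<sigma>2 / 4\<close>, in the variables m =
  n - q, k = q1 and p, so that n - q2 = m + k.\<close>

definition lrt_centre :: "real \<Rightarrow> real \<Rightarrow> real \<Rightarrow> real" where
  "lrt_centre m k p = (m + k - 1) * ln ((m - 1) / (m + k - 1)) + k * ln ((m - p - 1) / (m - 1))
     + (m + k - p - 1) * ln ((m + k - p - 1) / (m - p - 1))"

text \<open>The linear terms of \<open>lgam_centre\<close> cancel because both differences span the
  same step p. The products with logarithms regroup to \<open>lrt_centre\<close>, and the summand
  \<open>ln y / 2\<close> leaves the remainder, which converges to \<open>\<sigma>2 / 4\<close> in
  the limit theorem below.\<close>

lemma lgam_centre_diff:
  assumes "m - p > 1" "p > 0" "k > 0"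
  shows "lgam_centre m - lgam_centre (m - p) - (lgam_centre (m + k) - lgam_centre (m + k - p)) =
    lrt_centre m k p + ((ln m - ln (m - p)) - (ln (m + k) - ln (m + k - p))) / 2"
proof -
  have l: "ln ((m - 1) / (m + k - 1)) = ln (m - 1) - ln (m + k - 1)"
    "ln ((m - p - 1) / (m - 1)) = ln (m - p - 1) - ln (m - 1)"
    "ln ((m + k - p - 1) / (m - p - 1)) = ln (m + k - p - 1) - ln (m - p - 1)"
    using assms by (auto simp: ln_div)
  show ?thesis
    unfolding lrt_centre_def lgam_centre_def l by (simp add: field_simps)
qed

text \<open>A single sequence \<open>d\<close> with limit \<open>\<sigma>2 / 2\<close> governs both
  parts of the exponent: half of it corrects the centring, and \<open>t^2 * d\<close> is the real
  part, which yields the variance.\<close>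

proposition prod_gamma_ratio_asymptotics:
  fixes p k m :: "nat \<Rightarrow> nat" and y1 y2 t :: real
  assumes p: "filterlim p at_top sequentially" and k: "filterlim k at_top sequentially"
    and m: "filterlim m at_top sequentially"
    and y1_lim: "(\<lambda>n. real (p n) / real (k n)) \<longlonglongrightarrow> y1" and y1: "0 < y1"
    and y2_lim: "(\<lambda>n. real (p n) / real (m n)) \<longlonglongrightarrow> y2" and y2: "0 < y2" "y2 < 1"
    and \<sigma>2: "\<sigma>2 = 2 * (ln (1 / (1 - y2)) - ln ((y1 + y2) / (y1 + y2 - y1 * y2)))"
  shows "(\<lambda>n. (\<Prod>j<p n. gamma_ratio (m n - j) t / gamma_ratio (m n + k n - j) t) *
      cis (- t * (lrt_centre (real (m n)) (real (k n)) (real (p n)) + \<sigma>2 / 4))) \<longlonglongrightarrow> of_real (exp (- (t\<^sup>2 * \<sigma>2 / 2)))"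
proof -
  have rm: "filterlim (\<lambda>n. real (m n)) at_top sequentially" "filterlim (\<lambda>n. real (k n)) at_top sequentially"
    using filterlim_compose[OF filterlim_real_sequentially] m k by auto
  have ev0: "eventually (\<lambda>n. p n > 0 \<and> k n > 0 \<and> m n > 0) sequentially"
    using filterlim_at_top[THEN iffD1, OF p, rule_format, of 1] filterlim_at_top[THEN iffD1, OF k, rule_format, of 1]
      filterlim_at_top[THEN iffD1, OF m, rule_format, of 1]
    by eventually_elim auto
  have quot: "(\<lambda>n. 1 - real (p n) / real (m n)) \<longlonglongrightarrow> 1 - y2"
    by (intro tendsto_intros y2_lim)
  have D1: "(\<lambda>n. ln (real (m n)) - ln (real (m n) - real (p n))) \<longlonglongrightarrow> ln (1 / (1 - y2))"
  proof (rule Lim_transform_eventually)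
    show "(\<lambda>n. - ln (1 - real (p n) / real (m n))) \<longlonglongrightarrow> ln (1 / (1 - y2))"
      using y2 by (subst ln_div) (auto intro!: tendsto_intros quot)
    show "\<forall>\<^sub>F n in sequentially. - ln (1 - real (p n) / real (m n)) = ln (real (m n)) - ln (real (m n) - real (p n))"
      using ev0 order_tendstoD(1)[OF quot, of 0, unfolded diff_gt_0_iff_gt, OF y2(2)]
    proof eventually_elim
      case (elim n)
      have "1 - real (p n) / real (m n) = (real (m n) - real (p n)) / real (m n)" using elim by (simp add: field_simps)
      then show ?case using elim by (simp add: ln_div field_simps)
    qed
  qed
  \<comment> \<open>The quotient p / (m + k) is written through the two given quotients, as the
    reciprocal of m / p + k / p.\<close>
  have "(\<lambda>n. 1 / (1 / (real (p n) / real (m n)) + 1 / (real (p n) / real (k n)))) \<longlonglongrightarrow> 1 / (1 / y2 + 1 / y1)"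
    using y1 y2 by (intro tendsto_intros y1_lim y2_lim) (auto simp: add_pos_pos less_imp_neq[symmetric])
  then have "(\<lambda>n. real (p n) / (real (m n) + real (k n))) \<longlonglongrightarrow> 1 / (1 / y2 + 1 / y1)"
    by (rule Lim_transform_eventually) (rule eventually_mono[OF ev0], simp add: add_divide_distrib[symmetric])
  then have quot2: "(\<lambda>n. 1 - real (p n) / (real (m n) + real (k n))) \<longlonglongrightarrow> 1 - 1 / (1 / y2 + 1 / y1)"
    by (rule tendsto_diff[OF tendsto_const])
  have lim2: "1 - 1 / (1 / y2 + 1 / y1) = (y1 + y2 - y1 * y2) / (y1 + y2)"
    using y1 y2 by (simp add: field_simps)
  have pos2: "y1 + y2 - y1 * y2 > 0"
  proof -
    have "y1 * y2 < y1 * 1" using y1 y2 by (intro mult_strict_left_mono) auto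
    then show ?thesis using y2 by simp
  qed
  have D2: "(\<lambda>n. ln (real (m n) + real (k n)) - ln (real (m n) + real (k n) - real (p n))) \<longlonglongrightarrow> ln ((y1 + y2) / (y1 + y2 - y1 * y2))"
  proof (rule Lim_transform_eventually)
    have "(\<lambda>n. - ln (1 - real (p n) / (real (m n) + real (k n)))) \<longlonglongrightarrow> - ln ((y1 + y2 - y1 * y2) / (y1 + y2))"
      using quot2 unfolding lim2 using y1 y2 pos2 by (intro tendsto_intros) auto
    also have "- ln ((y1 + y2 - y1 * y2) / (y1 + y2)) = ln ((y1 + y2) / (y1 + y2 - y1 * y2))"
      using y1 y2 pos2 by (simp add: ln_div)
    finally show "(\<lambda>n. - ln (1 - real (p n) / (real (m n) + real (k n)))) \<longlonglongrightarrow> ln ((y1 + y2) / (y1 + y2 - y1 * y2))" .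
    have "0 < 1 - 1 / (1 / y2 + 1 / y1)" unfolding lim2 using y1 y2 pos2 by simp
    then have "\<forall>\<^sub>F n in sequentially. 0 < 1 - real (p n) / (real (m n) + real (k n))"
      using order_tendstoD(1)[OF quot2] by blast
    then show "\<forall>\<^sub>F n in sequentially. - ln (1 - real (p n) / (real (m n) + real (k n))) =
        ln (real (m n) + real (k n)) - ln (real (m n) + real (k n) - real (p n))"
      using ev0
    proof eventually_elim
      case (elim n)
      have "1 - real (p n) / (real (m n) + real (k n)) = (real (m n) + real (k n) - real (p n)) / (real (m n) + real (k n))"
        using elim by (simp add: field_simps)
      then show ?case using elim by (simp add: ln_div field_simps)
    qed
  qed
  \<comment> \<open>\<open>y2 < 1\<close> keeps m - p of the order of m; this drives the error sum
    to zero and eventually makes every logarithm in the centring well defined.\<close>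
  have gap: "filterlim (\<lambda>n. real (m n) - real (p n)) at_top sequentially"
  proof -
    have "filterlim (\<lambda>n. (1 - real (p n) / real (m n)) * real (m n)) at_top sequentially"
      using y2 by (intro filterlim_tendsto_pos_mult_at_top[OF quot _ rm(1)]) auto
    then show ?thesis
    proof (rule filterlim_mono_eventually[OF _ order_refl order_refl])
      show "\<forall>\<^sub>F n in sequentially. (1 - real (p n) / real (m n)) * real (m n) = real (m n) - real (p n)"
        by (rule eventually_mono[OF ev0]) (simp add: field_simps)
    qed
  qed
  define E where "E = (\<lambda>m p. \<Sum>j<p. lgam_vert t (real (m - j)))"
  define A where "A = (\<lambda>m p. lgam_approx t (real m) - lgam_approx t (real m - real p))"
  from lgam_vert_sum[of t] obtain C Y where C: "C \<ge> 0" and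
    "\<forall>m p. Y \<le> real m - real p \<longrightarrow> p < m \<longrightarrow>
      norm ((\<Sum>j<p. lgam_vert t (real (m - j))) - (lgam_approx t (real m) - lgam_approx t (real m - real p)))
        \<le> C * real p / (real m - real p)\<^sup>2"
    by (elim exE conjE)
  then have CY': "norm (E m p - A m p) \<le> C * real p / (real m - real p)\<^sup>2" if "Y \<le> real m - real p" "p < m" for m p
    using that by (simp add: E_def A_def)
  \<comment> \<open>Dividing numerator and denominator by the square of m leaves a convergent
    quantity times 1 / m.\<close>
  have err: "(\<lambda>n. C * real (p n) / (real (m n) - real (p n))\<^sup>2) \<longlonglongrightarrow> 0"
  proof (rule Lim_transform_eventually)
    have "(\<lambda>n. C * (real (p n) / real (m n)) / (1 - real (p n) / real (m n))\<^sup>2 * inverse (real (m n))) \<longlonglongrightarrow> C * y2 / (1 - y2)\<^sup>2 * 0"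
      using y2 by (intro tendsto_intros y2_lim quot tendsto_inverse_0_at_top rm) auto
    then show "(\<lambda>n. C * (real (p n) / real (m n)) / (1 - real (p n) / real (m n))\<^sup>2 * inverse (real (m n))) \<longlonglongrightarrow> 0" by simp
    show "\<forall>\<^sub>F n in sequentially. C * (real (p n) / real (m n)) / (1 - real (p n) / real (m n))\<^sup>2 * inverse (real (m n)) =
        C * real (p n) / (real (m n) - real (p n))\<^sup>2"
      using ev0 filterlim_at_top_dense[THEN iffD1, OF gap, rule_format, of 0]
    proof eventually_elim
      case (elim n)
      have "1 - real (p n) / real (m n) = (real (m n) - real (p n)) / real (m n)" using elim by (simp add: field_simps)
      then show ?case using elim by (simp add: power2_eq_square)
    qed
  qed
  have evY: "\<forall>\<^sub>F n in sequentially. real (m n) - real (p n) \<ge> Y \<and> real (m n) - real (p n) > 1 \<and> p n > 0 \<and> k n > 0"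
    using ev0 filterlim_at_top[THEN iffD1, OF gap, rule_format, of Y] filterlim_at_top_dense[THEN iffD1, OF gap, rule_format, of 1]
    by eventually_elim auto
  have e1: "(\<lambda>n. E (m n) (p n) - A (m n) (p n)) \<longlonglongrightarrow> 0"
  proof (rule Lim_null_comparison[OF _ err])
    show "\<forall>\<^sub>F n in sequentially. norm (E (m n) (p n) - A (m n) (p n)) \<le> C * real (p n) / (real (m n) - real (p n))\<^sup>2"
      using evY by eventually_elim (intro CY', auto)
  qed
  have e2: "(\<lambda>n. E (m n + k n) (p n) - A (m n + k n) (p n)) \<longlonglongrightarrow> 0"
  proof (rule Lim_null_comparison[OF _ err])
    show "\<forall>\<^sub>F n in sequentially. norm (E (m n + k n) (p n) - A (m n + k n) (p n)) \<le> C * real (p n) / (real (m n) - real (p n))\<^sup>2"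
      using evY
    proof eventually_elim
      case (elim n)
      \<comment> \<open>The second product has larger indices, so the error bound of the first one
        covers it.\<close>
      have "norm (E (m n + k n) (p n) - A (m n + k n) (p n)) \<le> C * real (p n) / (real (m n + k n) - real (p n))\<^sup>2"
        using elim by (intro CY') auto
      also have "\<dots> \<le> C * real (p n) / (real (m n) - real (p n))\<^sup>2"
        using elim C by (intro divide_left_mono power_mono mult_pos_pos mult_nonneg_nonneg) auto
      finally show ?case .
    qed
  qed
  define d where "d = (\<lambda>n. (ln (real (m n)) - ln (real (m n) - real (p n))) - (ln (real (m n) + real (k n)) - ln (real (m n) + real (k n) - real (p n))))"
  have d: "d \<longlonglongrightarrow> \<sigma>2 / 2"
  proof -
    have "\<sigma>2 / 2 = ln (1 / (1 - y2)) - ln ((y1 + y2) / (y1 + y2 - y1 * y2))"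
      unfolding \<sigma>2 by (rule nonzero_mult_div_cancel_left) simp
    then show ?thesis unfolding d_def using tendsto_diff[OF D1 D2] by (simp only:)
  qed
  \<comment> \<open>The exponent is grouped into two vanishing errors, an imaginary part that
    vanishes because half of \<open>d\<close> tends to \<open>\<sigma>2 / 4\<close>, and a real part
    tending to the exponent of the normal characteristic function.\<close>
  have "(\<lambda>n. (E (m n) (p n) - A (m n) (p n)) - (E (m n + k n) (p n) - A (m n + k n) (p n))
      + (\<i> * of_real (t * (d n / 2 - \<sigma>2 / 4)) - of_real (t\<^sup>2 * d n))) \<longlonglongrightarrow>
      0 - 0 + (\<i> * of_real (t * ((\<sigma>2 / 2) / 2 - \<sigma>2 / 4)) - of_real (t\<^sup>2 * (\<sigma>2 / 2)))"
    by (intro tendsto_intros e1 e2 d) auto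
  then have "(\<lambda>n. (E (m n) (p n) - A (m n) (p n)) - (E (m n + k n) (p n) - A (m n + k n) (p n))
      + (\<i> * of_real (t * (d n / 2 - \<sigma>2 / 4)) - of_real (t\<^sup>2 * d n))) \<longlonglongrightarrow> of_real (- (t\<^sup>2 * \<sigma>2 / 2))"
    by simp
  then have "(\<lambda>n. exp ((E (m n) (p n) - A (m n) (p n)) - (E (m n + k n) (p n) - A (m n + k n) (p n))
      + (\<i> * of_real (t * (d n / 2 - \<sigma>2 / 4)) - of_real (t\<^sup>2 * d n)))) \<longlonglongrightarrow> exp (of_real (- (t\<^sup>2 * \<sigma>2 / 2)))"
    by (rule tendsto_exp)
  then show ?thesis
    unfolding exp_of_real
  proof (rule Lim_transform_eventually)
    show "\<forall>\<^sub>F n in sequentially. exp ((E (m n) (p n) - A (m n) (p n)) - (E (m n + k n) (p n) - A (m n + k n) (p n))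
      + (\<i> * of_real (t * (d n / 2 - \<sigma>2 / 4)) - of_real (t\<^sup>2 * d n))) =
      (\<Prod>j<p n. gamma_ratio (m n - j) t / gamma_ratio (m n + k n - j) t) *
      cis (- t * (lrt_centre (real (m n)) (real (k n)) (real (p n)) + \<sigma>2 / 4))"
      using evY
    proof eventually_elim
      case (elim n)
      have lc: "lgam_centre (real (m n)) - lgam_centre (real (m n) - real (p n)) -
          (lgam_centre (real (m n) + real (k n)) - lgam_centre (real (m n) + real (k n) - real (p n))) =
          lrt_centre (real (m n)) (real (k n)) (real (p n)) + d n / 2"
        unfolding d_def using elim by (intro lgam_centre_diff) auto
      have "A (m n) (p n) - A (m n + k n) (p n) =
        \<i> * of_real (t * (lgam_centre (real (m n)) - lgam_centre (real (m n) - real (p n)) -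
          (lgam_centre (real (m n) + real (k n)) - lgam_centre (real (m n) + real (k n) - real (p n))))) - of_real (t\<^sup>2 * d n)"
        unfolding A_def d_def lgam_approx_def by (simp add: algebra_simps)
      then have A: "A (m n) (p n) - A (m n + k n) (p n) =
        \<i> * of_real (t * (lrt_centre (real (m n)) (real (k n)) (real (p n)) + d n / 2)) - of_real (t\<^sup>2 * d n)"
        unfolding lc .
      have "(E (m n) (p n) - A (m n) (p n)) - (E (m n + k n) (p n) - A (m n + k n) (p n))
         + (\<i> * of_real (t * (d n / 2 - \<sigma>2 / 4)) - of_real (t\<^sup>2 * d n)) =
         E (m n) (p n) - E (m n + k n) (p n) - (A (m n) (p n) - A (m n + k n) (p n))
         + (\<i> * of_real (t * (d n / 2 - \<sigma>2 / 4)) - of_real (t\<^sup>2 * d n))" by simp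
      also have "\<dots> = (E (m n) (p n) - E (m n + k n) (p n)) + \<i> * of_real (- t * (lrt_centre (real (m n)) (real (k n)) (real (p n)) + \<sigma>2 / 4))"
        unfolding A by (simp add: algebra_simps)
      moreover have "p n < m n" using elim by auto
      ultimately show ?case
        by (simp only: exp_add cis_conv_exp prod_gamma_ratio_eq_exp E_def)
    qed
  qed
qed

section \<open>The likelihood ratio statistic\<close>

lemma rows_data_mat: "rows (data_mat p n x) = map (\<lambda>i. vec n (\<lambda>k. x (Suc k) $ i)) [0..<p]"
  by (intro nth_equalityI) (auto simp: data_mat_def intro!: eq_vecI)

lemma set_rows_data_mat: "set (rows (data_mat p n x)) \<subseteq> carrier_vec n"
  by (auto simp: rows_data_mat)

lemma length_rows_data_mat [simp]: "length (rows (data_mat p n x)) = p"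
  by simp

text \<open>Both residual determinants carry the factor \<open>c\<close> made of the sample size and
  \<open>det L\<close>; it cancels, and what remains depends on the data only through the
  standardised errors \<open>g\<close>.\<close>

lemma lrt_statistic_eq_gram_ratio:
  fixes x :: "nat \<Rightarrow> real vec"
  assumes n: "n > 0" and z: "\<And>k. k \<in> {1..n} \<Longrightarrow> z k \<in> carrier_vec (q1 + q2)"
    and g: "\<And>k. k \<in> {1..n} \<Longrightarrow> g k \<in> carrier_vec p"
    and L: "L \<in> carrier_mat p p" "det L \<noteq> 0"
    and \<beta>1: "\<beta>1 \<in> carrier_mat p q1" and \<beta>2: "\<beta>2 \<in> carrier_mat p q2"
    and x: "\<And>k. k \<in> {1..n} \<Longrightarrow> x k = L *\<^sub>v g k + append_cols \<beta>1 \<beta>2 *\<^sub>v z k"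
    and gz: "gram_det (rows (data_mat (q1 + q2) n z)) \<noteq> 0"
  shows "2 / real n * ln (likelihood_ratio p q1 q2 n \<beta>1 z x) =
    ln (gram_ratio (rows (data_mat q1 n (\<lambda>k. vec_first (z k) q1))) (rows (data_mat q2 n (\<lambda>k. vec_last (z k) q2)))
         (rows (data_mat p n g)))"
proof -
  let ?Z1 = "rows (data_mat q1 n (\<lambda>k. vec_first (z k) q1))" and ?Z2 = "rows (data_mat q2 n (\<lambda>k. vec_last (z k) q2))"
  let ?G = "rows (data_mat p n g)"
  define c where "c = (1 / real n) ^ p * (det L)\<^sup>2"
  have c: "c > 0" using n L by (simp add: c_def)
  have Z: "rows (data_mat (q1 + q2) n z) = ?Z1 @ ?Z2" by (rule rows_data_mat_split) (rule z)
  have nz: "gram_det (?Z1 @ ?Z2) \<noteq> 0" using gz Z by simp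
  have nz2: "gram_det ?Z2 \<noteq> 0"
    using gram_det_suffix_nonzero[OF set_rows_data_mat set_rows_data_mat nz] .
  have B: "append_cols \<beta>1 \<beta>2 \<in> carrier_mat p (q1 + q2)"
    using \<beta>1 \<beta>2 by (auto simp: append_cols_def)
  define a where "a = det (mle_cov p (q1 + q2) n z x)"
  define b where "b = det (mle_cov0 p q1 q2 n \<beta>1 z x)"
  have a: "a = c * gram_det (?G @ ?Z1 @ ?Z2) / gram_det (?Z1 @ ?Z2)"
    unfolding a_def mle_cov_def mle_coeff_def Let_def c_def Z[symmetric]
    by (rule det_residual_cov[OF z g L(1) B x gz])
  \<comment> \<open>Under the null hypothesis subtracting the known part leaves a regression on the
    second design block alone, with the same errors.\<close>
  have y: "x k - \<beta>1 *\<^sub>v vec_first (z k) q1 = L *\<^sub>v g k + \<beta>2 *\<^sub>v vec_last (z k) q2" if k: "k \<in> {1..n}" for k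
    unfolding x[OF k] append_cols_mult_vec[OF \<beta>1 \<beta>2 z[OF k]]
    using L(1) \<beta>1 \<beta>2 g[OF k] by (intro eq_vecI) auto
  have b: "b = c * gram_det (?G @ ?Z2) / gram_det ?Z2"
    unfolding b_def mle_cov0_def mle_coeff0_def Let_def c_def
    by (rule det_residual_cov[OF _ g L(1) \<beta>2 y nz2]) auto
  have ge: "gram_det (?G @ ?Z1 @ ?Z2) \<ge> 0" "gram_det (?Z1 @ ?Z2) \<ge> 0" "gram_det (?G @ ?Z2) \<ge> 0" "gram_det ?Z2 \<ge> 0"
    using set_rows_data_mat by (auto intro!: gram_det_nonneg[of _ n] simp del: set_append) (auto simp: rows_data_mat)
  have ab: "a \<ge> 0" "b \<ge> 0" using c ge by (auto simp: a b)
  have "a / b = gram_ratio ?Z1 ?Z2 ?G"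
    using c nz nz2 by (simp add: a b gram_ratio_def)
  moreover have "likelihood_ratio p q1 q2 n \<beta>1 z x = (a / b) powr (real n / 2)"
    using ab by (simp add: likelihood_ratio_def a_def b_def powr_divide)
  \<comment> \<open>At \<open>r = 0\<close> both sides are 0 by \<open>0 powr _ = 0\<close> and
    \<open>ln 0 = 0\<close>, so the identity is pointwise and includes the null event on which a
    determinant vanishes.\<close>
  moreover have "2 / real n * ln (r powr (real n / 2)) = ln r" for r :: real
    using n by (cases "r = 0") (auto simp: ln_powr)
  ultimately show ?thesis by simp
qed

lemma positive_definite_det_nonzero:
  assumes "positive_definite_mat p S"
  shows "det S \<noteq> 0"
proof
  assume "det S = 0"
  then obtain v where "v \<in> carrier_vec p" "v \<noteq> 0\<^sub>v p" "S *\<^sub>v v = 0\<^sub>v p"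
    using assms det_0_iff_vec_prod_zero[of S p] by (auto simp: positive_definite_mat_def)
  then show False using assms by (auto simp: positive_definite_mat_def dest!: bspec[of _ _ v])
qed

text \<open>Whitening the observations turns them into independent standard normal vectors, and
  transposing the array turns these into independent rows. The statistic is a function of the rows,
  whose law is free of the unknown parameters.\<close>

lemma char_lrt_statistic:
  fixes M :: "'w measure" and X :: "nat \<Rightarrow> 'w \<Rightarrow> real vec"
  assumes M: "prob_space M" and p: "p > 0" and len: "p + (q1 + q2) \<le> n"
    and z: "\<And>k. k \<in> {1..n} \<Longrightarrow> z k \<in> carrier_vec (q1 + q2)"
    and rank: "vec_space.rank (q1 + q2) (mat_of_cols (q1 + q2) (map z [1..<Suc n])) = q1 + q2"
    and \<Sigma>: "positive_definite_mat p \<Sigma>"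
    and indep: "prob_space.indep_vars M (\<lambda>_. borel_vec p) X {1..n}"
    and \<beta>1: "\<beta>1 \<in> carrier_mat p q1" and \<beta>2: "\<beta>2 \<in> carrier_mat p q2"
    and normal: "\<And>k. k \<in> {1..n} \<Longrightarrow>
          distr M (borel_vec p) (X k) = multivariate_normal (append_cols \<beta>1 \<beta>2 *\<^sub>v z k) \<Sigma>"
  defines "T \<equiv> (\<lambda>\<omega>. 2 / real n * ln (likelihood_ratio p q1 q2 n \<beta>1 z (\<lambda>k. X k \<omega>)))"
  shows "T \<in> borel_measurable M"
    and "(\<integral>\<omega>. cis (t * T \<omega>) \<partial>M) = (\<Prod>j<p. gamma_ratio (n - (q1 + q2) - j) t / gamma_ratio (n - q2 - j) t)"
proof -
  interpret prob_space M by fact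
  have n: "n > 0" using p len by simp
  let ?\<mu> = "\<lambda>k. append_cols \<beta>1 \<beta>2 *\<^sub>v z k"
  have B: "append_cols \<beta>1 \<beta>2 \<in> carrier_mat p (q1 + q2)"
    using \<beta>1 \<beta>2 by (auto simp: append_cols_def)
  have \<mu>: "?\<mu> k \<in> carrier_vec p" if "k \<in> {1..n}" for k using B z[OF that] by auto
  obtain L where L: "L \<in> carrier_mat p p" "L * transpose_mat L = \<Sigma>"
    using positive_definite_cholesky[OF \<Sigma>] by blast
  have "det L * det L \<noteq> 0"
    using positive_definite_det_nonzero[OF \<Sigma>] L det_mult[OF L(1), of "transpose_mat L"] det_transpose[OF L(1)] by auto
  then have dL: "det L \<noteq> 0" by auto
  obtain K where K: "K \<in> carrier_mat p p" "L * K = 1\<^sub>m p" "K * L = 1\<^sub>m p"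
    using inverse_matE[OF L(1) dL] by blast
  have X: "X k \<in> measurable M (borel_vec p)" if "k \<in> {1..n}" for k
    using indep that by (auto simp: indep_vars_def)
  have Xc: "X k \<omega> \<in> carrier_vec p" if "k \<in> {1..n}" "\<omega> \<in> space M" for k \<omega>
    using measurable_space[OF X[OF that(1)] that(2)] by simp
  \<comment> \<open>The whitened errors, with \<open>K\<close> inverse to the covariance factor
    \<open>L\<close>; the observations are recovered from them at every point of the sample
    space.\<close>
  define g where "g = (\<lambda>k \<omega>. K *\<^sub>v (X k \<omega> - ?\<mu> k))"
  have std: "(\<lambda>x. K *\<^sub>v (x - ?\<mu> k)) \<in> measurable (borel_vec p) (borel_vec p)" if "k \<in> {1..n}" for k
  proof (rule measurable_compose[OF _ measurable_mult_mat_vec[OF K(1)]])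
    show "(\<lambda>x. x - ?\<mu> k) \<in> measurable (borel_vec p) (borel_vec p)"
    proof (rule measurable_borel_vecI)
      fix i assume i: "i < p"
      have "(x - ?\<mu> k) $ i = x $ i - ?\<mu> k $ i" for x
        by (rule index_minus_vec(1)) (simp only: carrier_vecD[OF \<mu>[OF that]] i)
      then show "(\<lambda>x. (x - ?\<mu> k) $ i) \<in> borel_measurable (borel_vec p)"
        by (simp only:) (intro borel_measurable_diff measurable_vec_index borel_measurable_const i)
    qed (use \<mu>[OF that] in auto)
  qed
  have g: "g k \<in> measurable M (borel_vec p)" if "k \<in> {1..n}" for k
    unfolding g_def using measurable_compose[OF X std] that by simp
  have distr_g: "distr M (borel_vec p) (g k) = std_normal_vec p" if k: "k \<in> {1..n}" for k
  proof -
    have aff: "(\<lambda>v. L *\<^sub>v v + ?\<mu> k) \<in> measurable (std_normal_vec p) (borel_vec p)"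
      using measurable_compose[OF measurable_mult_mat_vec[OF L(1)] measurable_add_vec[OF \<mu>[OF k]]]
      by (simp add: measurable_cong_sets[OF sets_iid_vec refl])
    have "distr M (borel_vec p) (g k) = distr (distr M (borel_vec p) (X k)) (borel_vec p) (\<lambda>x. K *\<^sub>v (x - ?\<mu> k))"
      by (subst distr_distr[OF std[OF k] X[OF k]]) (simp add: g_def comp_def)
    also have "distr M (borel_vec p) (X k) = distr (std_normal_vec p) (borel_vec p) (\<lambda>v. L *\<^sub>v v + ?\<mu> k)"
      unfolding normal[OF k] distr_std_normal_vec_affine[OF L(1) dL \<mu>[OF k]] L(2) ..
    also have "distr \<dots> (borel_vec p) (\<lambda>x. K *\<^sub>v (x - ?\<mu> k)) =
        distr (std_normal_vec p) (borel_vec p) ((\<lambda>x. K *\<^sub>v (x - ?\<mu> k)) \<circ> (\<lambda>v. L *\<^sub>v v + ?\<mu> k))"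
      by (rule distr_distr[OF std[OF k] aff])
    also have "\<dots> = distr (std_normal_vec p) (std_normal_vec p) (\<lambda>v. v)"
    proof (rule distr_cong)
      fix v :: "real vec" assume "v \<in> space (std_normal_vec p)"
      then have v: "v \<in> carrier_vec p" by simp
      have "a + b - b = a" if "a \<in> carrier_vec p" "b \<in> carrier_vec p" for a b :: "real vec"
        using that by (intro eq_vecI) auto
      from this[OF mult_mat_vec_carrier[OF L(1) v] \<mu>[OF k]] have "L *\<^sub>v v + ?\<mu> k - ?\<mu> k = L *\<^sub>v v" .
      moreover have "K *\<^sub>v (L *\<^sub>v v) = v"
        unfolding assoc_mult_mat_vec[OF K(1) L(1) v, symmetric] K(3) using v by simp
      ultimately show "((\<lambda>x. K *\<^sub>v (x - ?\<mu> k)) \<circ> (\<lambda>v. L *\<^sub>v v + ?\<mu> k)) v = v" by simp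
    qed simp_all
    finally show ?thesis by (simp add: distr_id)
  qed
  have "indep_vars (\<lambda>_. borel_vec p) g {1..n}"
    unfolding g_def by (rule indep_vars_compose2[OF indep]) (rule std)
  moreover have "{1..n} \<noteq> {}" using n by auto
  ultimately have joint: "distr M (Pi\<^sub>M {1..n} (\<lambda>_. borel_vec p)) (\<lambda>\<omega>. \<lambda>k\<in>{1..n}. g k \<omega>) = Pi\<^sub>M {1..n} (\<lambda>_. std_normal_vec p)"
  proof -
    have "distr M (Pi\<^sub>M {1..n} (\<lambda>_. borel_vec p)) (\<lambda>\<omega>. \<lambda>k\<in>{1..n}. g k \<omega>) = Pi\<^sub>M {1..n} (\<lambda>k. distr M (borel_vec p) (g k))"
      using indep_vars_iff_distr_eq_PiM'[OF \<open>{1..n} \<noteq> {}\<close> g] \<open>indep_vars (\<lambda>_. borel_vec p) g {1..n}\<close> by (rule iffD1)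
    also have "\<dots> = Pi\<^sub>M {1..n} (\<lambda>_. std_normal_vec p)" by (rule PiM_cong[OF refl distr_g])
    finally show ?thesis .
  qed
  \<comment> \<open>The rows of the matrix whose columns are the whitened errors, since
    \<open>gram_ratio\<close> adjoins rows.\<close>
  define W where "W = (\<lambda>\<omega>. \<lambda>i\<in>{..<p}. vec n (\<lambda>k. g (Suc k) \<omega> $ i))"
  have Wm: "W \<in> measurable M (Pi\<^sub>M {..<p} (\<lambda>_. borel_vec n))"
    unfolding W_def
  proof (intro measurable_restrict measurable_borel_vecI)
    fix i k assume "i \<in> {..<p}" "k < n"
    then show "(\<lambda>\<omega>. vec n (\<lambda>k. g (Suc k) \<omega> $ i) $ k) \<in> borel_measurable M"
      using measurable_compose[OF g[of "Suc k"] measurable_vec_index[of i p]] by simp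
  qed auto
  have gm: "(\<lambda>\<omega>. \<lambda>k\<in>{1..n}. g k \<omega>) \<in> measurable M (Pi\<^sub>M {1..n} (\<lambda>_. borel_vec p))"
    by (intro measurable_restrict g)
  note tm = measurable_transpose_rows[of n p]
  have dW: "distr M (Pi\<^sub>M {..<p} (\<lambda>_. borel_vec n)) W = normal_rows n p"
  proof -
    have "distr M (Pi\<^sub>M {..<p} (\<lambda>_. borel_vec n)) W =
       distr M (Pi\<^sub>M {..<p} (\<lambda>_. borel_vec n)) ((\<lambda>g. \<lambda>i\<in>{..<p}. vec n (\<lambda>k. g (Suc k) $ i)) \<circ> (\<lambda>\<omega>. \<lambda>k\<in>{1..n}. g k \<omega>))"
    proof (intro distr_cong refl)
      fix \<omega>
      have "vec n (\<lambda>k. g (Suc k) \<omega> $ i) = vec n (\<lambda>k. (\<lambda>k\<in>{1..n}. g k \<omega>) (Suc k) $ i)" for i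
        by (intro eq_vecI) auto
      then show "W \<omega> = ((\<lambda>g. \<lambda>i\<in>{..<p}. vec n (\<lambda>k. g (Suc k) $ i)) \<circ> (\<lambda>\<omega>. \<lambda>k\<in>{1..n}. g k \<omega>)) \<omega>"
        by (simp add: W_def)
    qed
    then show ?thesis
      using distr_distr[OF tm gm] distr_transpose_normal[OF n p] joint by simp
  qed
  let ?Z1 = "rows (data_mat q1 n (\<lambda>k. vec_first (z k) q1))" and ?Z2 = "rows (data_mat q2 n (\<lambda>k. vec_last (z k) q2))"
  have gz: "gram_det (rows (data_mat (q1 + q2) n z)) \<noteq> 0"
    using det_mult_transpose_full_rank[OF data_mat_carrier rank[unfolded mat_of_cols_data_mat]]
    by (simp add: gram_det_def gram_mat_rows[OF data_mat_carrier])
  then have gz': "gram_det (?Z1 @ ?Z2) \<noteq> 0"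
    using rows_data_mat_split[OF z] by simp
  have T: "T \<omega> = ln (gram_ratio ?Z1 ?Z2 (map (W \<omega>) [0..<p]))" if \<omega>: "\<omega> \<in> space M" for \<omega>
  proof -
    have "X k \<omega> = L *\<^sub>v g k \<omega> + ?\<mu> k" if k: "k \<in> {1..n}" for k
    proof -
      have d: "X k \<omega> - ?\<mu> k \<in> carrier_vec p" using Xc[OF k \<omega>] \<mu>[OF k] by simp
      have e: "L *\<^sub>v (K *\<^sub>v (X k \<omega> - ?\<mu> k)) = X k \<omega> - ?\<mu> k"
        unfolding assoc_mult_mat_vec[OF L(1) K(1) d, symmetric] K(2) using d by simp
      have "a = a - b + b" if "a \<in> carrier_vec p" "b \<in> carrier_vec p" for a b :: "real vec"
        using that by (intro eq_vecI) auto
      from this[OF Xc[OF k \<omega>] \<mu>[OF k]] show ?thesis unfolding g_def e .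
    qed
    moreover have "g k \<omega> \<in> carrier_vec p" if "k \<in> {1..n}" for k
      using measurable_space[OF g[OF that] \<omega>] by simp
    moreover have "rows (data_mat p n (\<lambda>k. g k \<omega>)) = map (W \<omega>) [0..<p]"
      by (simp add: rows_data_mat W_def)
    ultimately show ?thesis
      unfolding T_def
      using lrt_statistic_eq_gram_ratio[OF n z _ L(1) dL \<beta>1 \<beta>2 _ gz, of "\<lambda>k. g k \<omega>" "\<lambda>k. X k \<omega>"] by simp
  qed
  have Wc: "(\<lambda>\<omega>. W \<omega> i) \<in> measurable M (borel_vec n)" if "i < p" for i
    by (rule measurable_compose[OF Wm measurable_component_singleton]) (use that in simp)
  have "(\<lambda>\<omega>. ln (gram_ratio ?Z1 ?Z2 (map (W \<omega>) [0..<p]))) \<in> borel_measurable M"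
    using borel_measurable_gram_ratio[OF set_rows_data_mat set_rows_data_mat Wc] by measurable
  then show "T \<in> borel_measurable M"
    by (rule measurable_cong[THEN iffD1, rotated]) (simp add: T)
  have hm: "(\<lambda>w. cis (t * ln (gram_ratio ?Z1 ?Z2 (map w [0..<p])))) \<in> borel_measurable (Pi\<^sub>M {..<p} (\<lambda>_. borel_vec n))"
  proof -
    have "(\<lambda>w. gram_ratio ?Z1 ?Z2 (map w [0..<p])) \<in> borel_measurable (Pi\<^sub>M {..<p} (\<lambda>_. borel_vec n))"
      by (rule borel_measurable_gram_ratio[OF set_rows_data_mat set_rows_data_mat])
         (rule measurable_component_singleton, simp)
    then show ?thesis by measurable
  qed
  have "(\<integral>\<omega>. cis (t * T \<omega>) \<partial>M) = (\<integral>\<omega>. cis (t * ln (gram_ratio ?Z1 ?Z2 (map (W \<omega>) [0..<p]))) \<partial>M)"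
    by (intro Bochner_Integration.integral_cong refl) (simp add: T)
  also have "\<dots> = (\<integral>w. cis (t * ln (gram_ratio ?Z1 ?Z2 (map w [0..<p]))) \<partial>distr M (Pi\<^sub>M {..<p} (\<lambda>_. borel_vec n)) W)"
    by (rule integral_distr[OF Wm hm, symmetric])
  also have "\<dots> = (\<Prod>j<p. gamma_ratio (n - (q1 + q2) - j) t / gamma_ratio (n - q2 - j) t)"
    unfolding dW using integral_cis_ln_gram_ratio[OF set_rows_data_mat set_rows_data_mat gz', of p t] len by simp
  finally show "(\<integral>\<omega>. cis (t * T \<omega>) \<partial>M) = (\<Prod>j<p. gamma_ratio (n - (q1 + q2) - j) t / gamma_ratio (n - q2 - j) t)" .
qed

section \<open>The limit law and weak convergence\<close>

lemma char_normal_distribution: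
  assumes "\<sigma> > 0"
  shows "char (density lborel (normal_density 0 \<sigma>)) t = of_real (exp (- ((\<sigma> * t)\<^sup>2) / 2))"
proof -
  let ?D = "density lborel (\<lambda>x. ennreal (normal_density 0 \<sigma> x))"
  interpret prob_space ?D by (rule prob_space_normal_density[OF assms])
  have "distributed ?D lborel (\<lambda>x. x) (normal_density 0 \<sigma>)"
    by (auto simp: distributed_def distr_id2)
  then have "distributed ?D lborel (\<lambda>x. (x - 0) / \<sigma>) std_normal_density"
    using normal_standard_normal_convert[OF assms, of "\<lambda>x. x" 0] by simp
  then have d: "distr ?D lborel (\<lambda>x. x / \<sigma>) = std_normal_distribution"
    by (simp add: distributed_def)
  have "char ?D t = (\<integral>x. iexp ((\<sigma> * t) * (x / \<sigma>)) \<partial>?D)"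
    unfolding char_def using assms by simp
  also have "\<dots> = (\<integral>y. iexp ((\<sigma> * t) * y) \<partial>distr ?D lborel (\<lambda>x. x / \<sigma>))"
    by (subst integral_distr) auto
  also have "\<dots> = char std_normal_distribution (\<sigma> * t)"
    unfolding d char_def ..
  finally show ?thesis by (simp add: char_std_normal_distribution)
qed

text \<open>The product (y1 + y2)(1 - y2) falls short of y1 + y2 - y1 y2 by the square of y2, which
  orders the arguments of the two logarithms. Positivity makes \<open>sqrt \<sigma>2\<close> a
  genuine standard deviation.\<close>

lemma lrt_variance_pos:
  fixes y1 y2 :: real
  assumes "0 < y1" "0 < y2" "y2 < 1"
  shows "2 * (ln (1 / (1 - y2)) - ln ((y1 + y2) / (y1 + y2 - y1 * y2))) > 0"
proof -
  have "y1 * y2 < y1 * 1" using assms by (intro mult_strict_left_mono) auto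
  then have pos: "y1 + y2 - y1 * y2 > 0" using assms by linarith
  have "(y1 + y2) * (1 - y2) < y1 + y2 - y1 * y2"
    using assms by (simp add: algebra_simps)
  then have "(y1 + y2) / (y1 + y2 - y1 * y2) < 1 / (1 - y2)"
    using pos assms by (simp add: field_simps)
  moreover have "0 < (y1 + y2) / (y1 + y2 - y1 * y2)" using pos assms by simp
  ultimately have "ln ((y1 + y2) / (y1 + y2 - y1 * y2)) < ln (1 / (1 - y2))"
    using assms by (subst ln_less_cancel_iff) auto
  then show ?thesis by simp
qed

theorem theorem2p2:
  fixes M :: "nat \<Rightarrow> 'w measure"
    and X :: "nat \<Rightarrow> nat \<Rightarrow> 'w \<Rightarrow> real vec"
    and z :: "nat \<Rightarrow> nat \<Rightarrow> real vec"
    and p q q1 q2 :: "nat \<Rightarrow> nat"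
    and \<beta> \<beta>1 \<beta>2 \<beta>01 \<Sigma> :: "nat \<Rightarrow> real mat"
    and s :: "nat \<Rightarrow> real"
    and y1 y2 \<sigma>2 :: real
    and N :: nat
  assumes prob: "\<And>n. n \<ge> N \<Longrightarrow> prob_space (M n)"
    and dims: "\<And>n. n \<ge> N \<Longrightarrow> 0 < p n \<and> 0 < q1 n \<and> 0 < q2 n \<and> q n = q1 n + q2 n"
    and z: "\<And>n k. n \<ge> N \<Longrightarrow> k \<in> {1..n} \<Longrightarrow> z n k \<in> carrier_vec (q n)"
    and rank: "\<And>n. n \<ge> N \<Longrightarrow>
          vec_space.rank (q n) (mat_of_cols (q n) (map (z n) [1..<Suc n])) = q n"
    and \<beta>: "\<And>n. n \<ge> N \<Longrightarrow> \<beta> n \<in> carrier_mat (p n) (q n)"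
    and \<Sigma>: "\<And>n. n \<ge> N \<Longrightarrow> positive_definite_mat (p n) (\<Sigma> n)"
    and indep: "\<And>n. n \<ge> N \<Longrightarrow>
          prob_space.indep_vars (M n) (\<lambda>_. borel_vec (p n)) (X n) {1..n}"
    and normal: "\<And>n k. n \<ge> N \<Longrightarrow> k \<in> {1..n} \<Longrightarrow>
          distr (M n) (borel_vec (p n)) (X n k) = multivariate_normal (\<beta> n *\<^sub>v z n k) (\<Sigma> n)"
    and \<beta>1: "\<And>n. n \<ge> N \<Longrightarrow> \<beta>1 n \<in> carrier_mat (p n) (q1 n)"
    and \<beta>2: "\<And>n. n \<ge> N \<Longrightarrow> \<beta>2 n \<in> carrier_mat (p n) (q2 n)"
    and partition: "\<And>n. n \<ge> N \<Longrightarrow> \<beta> n = append_cols (\<beta>1 n) (\<beta>2 n)"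
    and \<beta>01: "\<And>n. n \<ge> N \<Longrightarrow> \<beta>01 n \<in> carrier_mat (p n) (q1 n)"
    and p_lim: "filterlim p at_top sequentially"
    and q1_lim: "filterlim q1 at_top sequentially"
    and nq_lim: "filterlim (\<lambda>n. real n - real (q n)) at_top sequentially"
    and y1_lim: "(\<lambda>n. real (p n) / real (q1 n)) \<longlonglongrightarrow> y1"
    and y1: "0 < y1"
    and y2_lim: "(\<lambda>n. real (p n) / (real n - real (q n))) \<longlonglongrightarrow> y2"
    and y2: "0 < y2" "y2 < 1"
    and H0: "\<And>n. n \<ge> N \<Longrightarrow> \<beta>1 n = \<beta>01 n"
    and \<sigma>2: "\<sigma>2 = 2 * (ln (1 / (1 - y2)) - ln ((y1 + y2) / (y1 + y2 - y1 * y2)))"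
    and s: "\<And>n. s n =
          (real n - real (q2 n) - 1) * ln ((real n - real (q n) - 1) / (real n - real (q2 n) - 1))
          + real (q1 n) * ln ((real n - real (q n) - real (p n) - 1) / (real n - real (q n) - 1))
          + (real n - real (q2 n) - real (p n) - 1)
              * ln ((real n - real (q2 n) - real (p n) - 1) / (real n - real (q n) - real (p n) - 1))
          + \<sigma>2 / 4"
  shows "weak_conv_m
    (\<lambda>n. distr (M n) borel (\<lambda>\<omega>.
       2 / real n * ln (likelihood_ratio (p n) (q1 n) (q2 n) n (\<beta>01 n) (z n) (\<lambda>k. X n k \<omega>)) - s n))
    (density lborel (normal_density 0 (sqrt \<sigma>2)))"
proof -
  have s0: "\<sigma>2 > 0" unfolding \<sigma>2 by (rule lrt_variance_pos[OF y1 y2])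
  \<comment> \<open>Natural subtraction, which agrees with the real difference once q is at most n;
    this holds eventually as n - q tends to infinity.\<close>
  define m where "m = (\<lambda>n. n - q n)"
  have m_lim: "filterlim m at_top sequentially"
    unfolding filterlim_at_top
  proof
    fix Z :: nat
    show "eventually (\<lambda>n. Z \<le> m n) sequentially"
      using filterlim_at_top[THEN iffD1, OF nq_lim, rule_format, of "real Z"]
      by eventually_elim (auto simp: m_def)
  qed
  have ev_le: "eventually (\<lambda>n. q n \<le> n) sequentially"
    using filterlim_at_top[THEN iffD1, OF nq_lim, rule_format, of 0] by eventually_elim auto
  have rm: "real (m n) = real n - real (q n)" if "q n \<le> n" for n using that by (simp add: m_def of_nat_diff)
  have y2_lim': "(\<lambda>n. real (p n) / real (m n)) \<longlonglongrightarrow> y2"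
    using y2_lim by (rule Lim_transform_eventually) (rule eventually_mono[OF ev_le], simp add: rm)
  have ev_m: "eventually (\<lambda>n. m n > 0) sequentially"
    using filterlim_at_top[THEN iffD1, OF m_lim, rule_format, of 1] by eventually_elim auto
  \<comment> \<open>A limit below 1 for p / (n - q) eventually forces p + q to be at most n, the
    range in which the exact characteristic function is available.\<close>
  have ev_p: "eventually (\<lambda>n. p n + q n \<le> n) sequentially"
    using order_tendstoD(2)[OF y2_lim' y2(2)] ev_le ev_m
    by eventually_elim (auto simp: m_def field_simps)
  obtain N0 where N0: "\<And>n. n \<ge> N0 \<Longrightarrow> N \<le> n \<and> p n + q n \<le> n"
    using eventually_conj[OF eventually_ge_at_top[of N] ev_p] unfolding eventually_sequentially by auto
  define T where "T = (\<lambda>n \<omega>. 2 / real n * ln (likelihood_ratio (p n) (q1 n) (q2 n) n (\<beta>01 n) (z n) (\<lambda>k. X n k \<omega>)))"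
  define D where "D = (\<lambda>n. distr (M n) borel (\<lambda>\<omega>. T n \<omega> - s n))"
  have T: "T n \<in> borel_measurable (M n)"
    "(\<integral>\<omega>. cis (t * T n \<omega>) \<partial>M n) = (\<Prod>j<p n. gamma_ratio (m n - j) t / gamma_ratio (m n + q1 n - j) t)"
    if n: "n \<ge> N0" for n t
  proof -
    have nN: "n \<ge> N" and le: "p n + (q1 n + q2 n) \<le> n" and q: "q n = q1 n + q2 n" and p: "p n > 0"
      using N0[OF n] dims[of n] by auto
    note hyps = prob[OF nN] p le z[OF nN, unfolded q] rank[OF nN, unfolded q] \<Sigma>[OF nN] indep[OF nN]
      \<beta>1[OF nN] \<beta>2[OF nN] normal[OF nN, unfolded partition[OF nN]]
    show "T n \<in> borel_measurable (M n)"
      unfolding T_def H0[OF nN, symmetric] by (rule char_lrt_statistic(1)[OF hyps])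
    have "m n = n - (q1 n + q2 n)" "m n + q1 n = n - q2 n" using le by (auto simp: m_def q)
    then show "(\<integral>\<omega>. cis (t * T n \<omega>) \<partial>M n) = (\<Prod>j<p n. gamma_ratio (m n - j) t / gamma_ratio (m n + q1 n - j) t)"
      unfolding T_def H0[OF nN, symmetric] using char_lrt_statistic(2)[OF hyps] by simp
  qed
  have D: "real_distribution (D n)" if n: "n \<ge> N0" for n
    unfolding D_def
    by (intro prob_space.real_distribution_distr prob) (use N0[OF n] T(1)[OF n] in auto)
  have char: "char (D n) t = (\<Prod>j<p n. gamma_ratio (m n - j) t / gamma_ratio (m n + q1 n - j) t) *
      cis (- t * (lrt_centre (real (m n)) (real (q1 n)) (real (p n)) + \<sigma>2 / 4))" if n: "n \<ge> N0" for n t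
  proof -
    have "q n = q1 n + q2 n" "q n \<le> n" using N0[OF n] dims[of n] by auto
    then have "s n = lrt_centre (real (m n)) (real (q1 n)) (real (p n)) + \<sigma>2 / 4"
      unfolding s lrt_centre_def by (simp add: rm algebra_simps)
    moreover have "char (D n) t = (\<integral>\<omega>. cis (t * T n \<omega>) * cis (- t * s n) \<partial>M n)"
    proof -
      have "iexp (t * (T n \<omega> - s n)) = cis (t * T n \<omega>) * cis (- t * s n)" for \<omega>
        by (simp only: cis_mult) (simp add: cis_conv_exp algebra_simps)
      then show ?thesis
        unfolding char_def D_def using T(1)[OF n] by (subst integral_distr) auto
    qed
    moreover have "\<dots> = (\<integral>\<omega>. cis (t * T n \<omega>) \<partial>M n) * cis (- t * s n)" by simp
    ultimately show ?thesis using T(2)[OF n] by simp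
  qed
  \<comment> \<open>The continuity theorem asks for real distributions at every index, which are
    guaranteed only from \<open>N0\<close> on; the shift is undone afterwards, since weak
    convergence ignores an initial segment.\<close>
  have "weak_conv_m (\<lambda>n. D (n + N0)) (density lborel (normal_density 0 (sqrt \<sigma>2)))"
  proof (rule levy_continuity)
    show "real_distribution (D (n + N0))" for n by (rule D) simp
    have "prob_space (density lborel (normal_density 0 (sqrt \<sigma>2)))"
      using s0 by (intro prob_space_normal_density) simp
    then show "real_distribution (density lborel (normal_density 0 (sqrt \<sigma>2)))"
      by (auto simp: real_distribution_def real_distribution_axioms_def)
    fix t
    have "(\<lambda>n. (\<Prod>j<p n. gamma_ratio (m n - j) t / gamma_ratio (m n + q1 n - j) t) *
      cis (- t * (lrt_centre (real (m n)) (real (q1 n)) (real (p n)) + \<sigma>2 / 4))) \<longlonglongrightarrow> of_real (exp (- (t\<^sup>2 * \<sigma>2 / 2)))"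
      by (rule prod_gamma_ratio_asymptotics[OF p_lim q1_lim m_lim y1_lim y1 y2_lim' y2 \<sigma>2])
    then have "(\<lambda>n. char (D n) t) \<longlonglongrightarrow> of_real (exp (- (t\<^sup>2 * \<sigma>2 / 2)))"
      by (rule Lim_transform_eventually) (use char in \<open>auto simp: eventually_sequentially intro!: exI[of _ N0]\<close>)
    moreover have "complex_of_real (exp (- (t\<^sup>2 * \<sigma>2 / 2))) = char (density lborel (normal_density 0 (sqrt \<sigma>2))) t"
      using s0 by (simp add: char_normal_distribution power_mult_distrib mult.commute)
    ultimately show "(\<lambda>n. char (D (n + N0)) t) \<longlonglongrightarrow> char (density lborel (normal_density 0 (sqrt \<sigma>2))) t"
      by (intro LIMSEQ_ignore_initial_segment) simp
  qed
  then have "weak_conv_m D (density lborel (normal_density 0 (sqrt \<sigma>2)))"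
    unfolding weak_conv_m_def weak_conv_def by (auto intro: LIMSEQ_offset)
  then show ?thesis unfolding D_def T_def .
qed

end
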